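(* Let $q\in(0,\infty]$ and let $b$ be a slowly varying function with $\lVert t^{-1/q}b(t)\chi_{(0,1)}(t)\rVert_q<\infty$. If $q=\infty$, assume further that $b$ is (locally) absolutely continuous on $(0,\infty)$ and non-decreasing. Let $\varphi_X$ be the fundamental function of $X=L^{\infty,q,b}$. Then: (1) If $q<\infty$, then $$\varphi_X(t)=\left(\int_0^t s^{-1}b^q(s)\,ds\right)^{1/q}\ \text{ for } t\in(0,\infty),\qquad \varphi_X(\infty)=\left(\int_0^\infty s^{-1}b^q(s)\,ds\right)^{1/q};$$ if $q=\infty$, then $$\varphi_X(t)=\operatorname*{ess\,sup}_{s\in(0,t)}b(s)\ \text{ for } t\in(0,\infty),\qquad \varphi_X(\infty)=\operatorname*{ess\,sup}_{s\in(0,\infty)}b(s).$$ (2) In all cases $\varphi_X$ is equivalent to a quasi-concave function and the corresponding Marcinkiewicz endpoint space is $M_{\varphi_X}=L^{(\infty,\infty,\varphi_X)}$, up to equivalence of the defining functionals. (3) If $q<\infty$, the corresponding Lorentz endpoint space is $\Lambda_{\varphi_X}=L^{\infty,1,a}$, up to equivalence of the defining functionals, where $$a(t)=\left(\int_0^t s^{-1}b^q(s)\,ds\right)^{\frac1q-1}b^q(t),\qquad t\in(0,\infty).$$ If $q=\infty$, then, up to equivalence of the defining functionals, $\Lambda_{\varphi_X}=\Lambda^1(b')$ when $\lim_{t\to0^+}b(t)=0$, and $\Lambda_{\varphi_X}=\Lambda^1(b')\cap L^\infty$ when $\lim_{t\to0^+}b(t)>0$, where $b'$ is the classical derivative of $b$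 (which exists a.e.). (4) If $\tilde X=L^{(\infty,q,b)}$, then $\varphi_{\tilde X}\approx\varphi_X$, and thus the corresponding Lorentz and Marcinkiewicz endpoint spaces are the same.
   Context: $(R,\mu)$ is a $\sigma$-finite non-atomic measure space with $\mu(R)=\infty$; $M=M(R,\mu)$ is the set of extended complex-valued $\mu$-measurable functions on $R$. For $f\in M$, $f^*(t)=\inf\{s\ge 0:\mu(\{|f|>s\})\le t\}$ and $f^{**}(t)=\frac1t\int_0^t f^*(s)\,ds$. Two non-negative functions (or functionals) $g,h$ are equivalent, $g\approx h$, if there are constants $0<c\le C<\infty$ with $cg\le h\le Cg$. Convention: $1/\infty=0$. A measurable $b:(0,\infty)\to(0,\infty)$ is slowly varying if for every $\varepsilon>0$ there are a non-decreasing function $b_\varepsilon$ and a non-increasing function $b_{-\varepsilon}$ with $t^\varepsilon b(t)\approx b_\varepsilon(t)$ and $t^{-\varepsilon}b(t)\approx b_{-\varepsilon}(t)$ on $(0,\infty)$. For $f\in M$, $\lVert f\rVert_{p,q,b}=\lVert t^{1/p-1/q}b(t)f^*(t)\rVert_q$ and $\lVert f\rVert_{(p,q,b)}=\lVert t^{1/p-1/q}b(t)f^{**}(t)\rVert_q$, where $\lVert\cdot\rVert_q$ is the Lebesgue $L^q$ (quasi)norm over $(0,\infty)$ in the variable $t$; $L^{p,q,b}$ and $L^{(p,q,b)}$ are the sets of $f\in M$ for which the respective functional is finite. For a measurable weight $v:(0,\infty)\to[0,\infty)$, $\Lambda^1(v)$ is the set of $f\in M$ with $\lVert f\rVert_{\Lambda^1(v)}=\int_0^\infty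 f^*(t)v(t)\,dt<\infty$; the intersection $\Lambda^1(v)\cap L^\infty$ carries the functional $\lVert f\rVert_{\Lambda^1(v)}+\lVert f\rVert_{\infty}$. If $X=L^{p,q,b}$ with the functional $\lVert\cdot\rVert_X=\lVert\cdot\rVert_{p,q,b}$, or $X=L^{(p,q,b)}$ with the functional $\lVert\cdot\rVert_X=\lVert\cdot\rVert_{(p,q,b)}$, then the fundamental function of $X$ is $\varphi_X(t)=\lVert\chi_E\rVert_X$, where $E\subseteq R$ is any measurable set with $\mu(E)=t$, $t\in[0,\infty]$ (so $\varphi_X(0)=0$). A function $\varphi:[0,\infty)\to[0,\infty)$ is quasi-concave if it is non-decreasing, vanishes only at $0$, and $t\mapsto t/\varphi(t)$ is non-decreasing on $(0,\infty)$. Every quasi-concave function is equivalent to a non-decreasing concave function vanishing at $0$. If $\varphi$ is equivalent to a quasi-concave function, pick a non-decreasing concave (on $[0,\infty)$) $\psi\approx\varphi$ with $\psi(0)=0$. The Marcinkiewicz endpoint space $M_\varphi$ is $\{f\in M:\sup_{t>0}\psi(t)f^{**}(t)<\infty\}$ with this supremum as norm; the Lorentz endpoint space $\Lambda_\varphi$ is $\{f\in M:\int_0^\infty f^*\,d\psi<\infty\}$ with this Lebesgue--Stieltjes integral over $[0,\infty)$ (including a possible atom of mass $\psi(0^+)$ at $0$, where $f^*(0)=\lVert f\rVert_\infty$) as norm. Up to equivalence of norms these do not depend on the choice of $\psi$. *)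

theory Defs
  imports "HOL-Analysis.Analysis" "HOL-Probability.Essential_Supremum"
begin

section \<open>Measurable functions with values in the extended complex plane\<close>

datatype ecomplex = Fin complex | Infty

primrec ecmod :: "ecomplex \<Rightarrow> ennreal" where
  "ecmod (Fin z) = ennreal (cmod z)"
| "ecmod Infty = \<infinity>"

definition meas_funs :: "'a measure \<Rightarrow> ('a \<Rightarrow> ecomplex) set" where
  "meas_funs R = {f. f -` {Infty} \<inter> space R \<in> sets R \<and>
     (\<forall>B \<in> sets (borel :: complex measure). f -` (Fin ` B) \<inter> space R \<in> sets R)}"

definition chi :: "'a set \<Rightarrow> 'a \<Rightarrow> ecomplex" where
  "chi E x = (if x \<in> E then Fin 1 else Fin 0)"

definition non_atomic :: "'a measure \<Rightarrow> bool" where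
  "non_atomic R \<longleftrightarrow> (\<forall>A \<in> sets R. 0 < emeasure R A \<longrightarrow>
     (\<exists>B \<in> sets R. B \<subseteq> A \<and> 0 < emeasure R B \<and> emeasure R B < emeasure R A))"

text \<open>If no \<open>s\<close> is admissible, the infimum is \<open>Inf {} = \<infinity>\<close>.\<close>

definition rearr :: "'a measure \<Rightarrow> ('a \<Rightarrow> ecomplex) \<Rightarrow> real \<Rightarrow> ennreal" where
  "rearr R f t = Inf {ennreal s | s. 0 \<le> s \<and>
     emeasure R {x \<in> space R. ecmod (f x) > ennreal s} \<le> ennreal t}"

definition max_rearr :: "'a measure \<Rightarrow> ('a \<Rightarrow> ecomplex) \<Rightarrow> real \<Rightarrow> ennreal" where
  "max_rearr R f t = (\<integral>\<^sup>+ s\<in>{0<..<t}. rearr R f s \<partial>lebesgue) / ennreal t"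

section \<open>Equivalence\<close>

definition equiv_on :: "'b set \<Rightarrow> ('b \<Rightarrow> ennreal) \<Rightarrow> ('b \<Rightarrow> ennreal) \<Rightarrow> bool" where
  "equiv_on S g h \<longleftrightarrow> (\<exists>c C :: real. 0 < c \<and> c \<le> C \<and>
     (\<forall>x \<in> S. ennreal c * g x \<le> h x \<and> h x \<le> ennreal C * g x))"

definition slowly_varying :: "(real \<Rightarrow> real) \<Rightarrow> bool" where
  "slowly_varying b \<longleftrightarrow>
     b \<in> borel_measurable (lebesgue_on {0<..}) \<and> (\<forall>t>0. 0 < b t) \<and>
     (\<forall>\<epsilon>>0. \<exists>g h :: real \<Rightarrow> real. mono_on {0<..} g \<and> antimono_on {0<..} h \<and>
        equiv_on {0<..} (\<lambda>t. ennreal (t powr \<epsilon> * b t)) (\<lambda>t. ennreal (g t)) \<and>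
        equiv_on {0<..} (\<lambda>t. ennreal (t powr (- \<epsilon>) * b t)) (\<lambda>t. ennreal (h t)))"

definition abs_cont_on_interval :: "real \<Rightarrow> real \<Rightarrow> (real \<Rightarrow> real) \<Rightarrow> bool" where
  "abs_cont_on_interval c d b \<longleftrightarrow> (\<forall>\<epsilon>>0. \<exists>\<delta>>0. \<forall>D :: (real \<times> real) set.
     finite D \<and> (\<forall>(u, v) \<in> D. c \<le> u \<and> u < v \<and> v \<le> d) \<and>
     pairwise (\<lambda>(u, v) (u', v'). {u<..<v} \<inter> {u'<..<v'} = {}) D \<and>
     (\<Sum>(u, v)\<in>D. v - u) < \<delta> \<longrightarrow> (\<Sum>(u, v)\<in>D. \<bar>b v - b u\<bar>) < \<epsilon>)"

definition locally_abs_cont :: "(real \<Rightarrow> real) \<Rightarrow> bool" where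
  "locally_abs_cont b \<longleftrightarrow> (\<forall>c d. 0 < c \<and> c < d \<longrightarrow> abs_cont_on_interval c d b)"

section \<open>The functionals\<close>

definition epowr :: "ennreal \<Rightarrow> real \<Rightarrow> ennreal" where
  "epowr x r =
     (if r = 0 then 1
      else if x = \<infinity> then (if 0 < r then \<infinity> else 0)
      else if x = 0 then (if 0 < r then 0 else \<infinity>)
      else ennreal (enn2real x powr r))"

definition Lq_norm :: "ennreal \<Rightarrow> (real \<Rightarrow> ennreal) \<Rightarrow> ennreal" where
  "Lq_norm q g =
     (if q = \<infinity> then esssup (lebesgue_on {0<..}) g
      else epowr (\<integral>\<^sup>+ t\<in>{0<..}. epowr (g t) (enn2real q) \<partial>lebesgue) (1 / enn2real q))"

text \<open>Since \<open>enn2real (1 / \<infinity>) = 0\<close>, infinite exponents follow the convention \<open>1/\<infinity> = 0\<close>.\<close>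

definition LK :: "'a measure \<Rightarrow> ennreal \<Rightarrow> ennreal \<Rightarrow> (real \<Rightarrow> ennreal) \<Rightarrow> ('a \<Rightarrow> ecomplex) \<Rightarrow> ennreal"
  where "LK R p q w f =
    Lq_norm q (\<lambda>t. ennreal (t powr (enn2real (1 / p) - enn2real (1 / q))) * w t * rearr R f t)"

definition LK_max :: "'a measure \<Rightarrow> ennreal \<Rightarrow> ennreal \<Rightarrow> (real \<Rightarrow> ennreal) \<Rightarrow> ('a \<Rightarrow> ecomplex) \<Rightarrow> ennreal"
  where "LK_max R p q w f =
    Lq_norm q (\<lambda>t. ennreal (t powr (enn2real (1 / p) - enn2real (1 / q))) * w t * max_rearr R f t)"

definition Lambda1 :: "'a measure \<Rightarrow> (real \<Rightarrow> ennreal) \<Rightarrow> ('a \<Rightarrow> ecomplex) \<Rightarrow> ennreal" where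
  "Lambda1 R v f = (\<integral>\<^sup>+ t\<in>{0<..}. rearr R f t * v t \<partial>lebesgue)"

definition Linf_norm :: "'a measure \<Rightarrow> ('a \<Rightarrow> ecomplex) \<Rightarrow> ennreal" where
  "Linf_norm R f = esssup R (\<lambda>x. ecmod (f x))"

definition space_of :: "'a measure \<Rightarrow> (('a \<Rightarrow> ecomplex) \<Rightarrow> ennreal) \<Rightarrow> ('a \<Rightarrow> ecomplex) set" where
  "space_of R N = {f \<in> meas_funs R. N f < \<infinity>}"

definition same_space ::
  "'a measure \<Rightarrow> (('a \<Rightarrow> ecomplex) \<Rightarrow> ennreal) \<Rightarrow> (('a \<Rightarrow> ecomplex) \<Rightarrow> ennreal) \<Rightarrow> bool" where
  "same_space R N N' \<longleftrightarrow> space_of R N = space_of R N' \<and> equiv_on (space_of R N) N N'"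

section \<open>Fundamental functions and endpoint spaces\<close>

text \<open>The value does not depend on the chosen set; see \<open>fundamental_LK\<close> and
  \<open>fundamental_LK_max\<close> below.\<close>

definition fundamental :: "'a measure \<Rightarrow> (('a \<Rightarrow> ecomplex) \<Rightarrow> ennreal) \<Rightarrow> ennreal \<Rightarrow> ennreal" where
  "fundamental R N t = N (chi (SOME E. E \<in> sets R \<and> emeasure R E = t))"

lemma rearr_chi_cong:
  assumes "E \<in> sets R" "F \<in> sets R" "emeasure R E = emeasure R F"
  shows "rearr R (chi E) = rearr R (chi F)"
proof -
  have *: "emeasure R {x \<in> space R. ecmod (chi A x) > ennreal s} =
      (if s < 1 then emeasure R A else 0)" if "A \<in> sets R" "0 \<le> s" for A and s :: real
  proof -
    have "ennreal s < ecmod (chi A x) \<longleftrightarrow> x \<in> A \<and> s < 1" for x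
      using that(2) ennreal_less_iff[of s 1] by (simp add: chi_def)
    moreover have "{x \<in> space R. x \<in> A} = A"
      using sets.sets_into_space[OF that(1)] by blast
    ultimately show ?thesis by simp
  qed
  have "(0 \<le> s \<and> emeasure R {x \<in> space R. ecmod (chi E x) > ennreal s} \<le> ennreal t) \<longleftrightarrow>
      (0 \<le> s \<and> emeasure R {x \<in> space R. ecmod (chi F x) > ennreal s} \<le> ennreal t)" for s t
    by (cases "0 \<le> s") (simp_all only: *[OF assms(1)] *[OF assms(2)] assms(3) simp_thms)
  then show ?thesis by (simp only: rearr_def fun_eq_iff simp_thms)
qed

lemma fundamental_witness:
  assumes "E \<in> sets R"
  obtains F where "fundamental R N (emeasure R E) = N (chi F)" "rearr R (chi F) = rearr R (chi E)"
proof -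
  define F where "F = (SOME F. F \<in> sets R \<and> emeasure R F = emeasure R E)"
  have "F \<in> sets R \<and> emeasure R F = emeasure R E"
    unfolding F_def by (rule someI[of _ E]) (use assms in blast)
  then have "rearr R (chi F) = rearr R (chi E)"
    using assms by (intro rearr_chi_cong) blast+
  then show thesis
    by (intro that[of F]) (simp_all only: fundamental_def F_def)
qed

lemma fundamental_LK:
  assumes "E \<in> sets R"
  shows "fundamental R (LK R p q w) (emeasure R E) = LK R p q w (chi E)"
  by (rule fundamental_witness[OF assms, of "LK R p q w"]) (simp only: LK_def)

lemma fundamental_LK_max:
  assumes "E \<in> sets R"
  shows "fundamental R (LK_max R p q w) (emeasure R E) = LK_max R p q w (chi E)"
  by (rule fundamental_witness[OF assms, of "LK_max R p q w"]) (simp only: LK_max_def max_rearr_def)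

definition quasi_concave :: "(real \<Rightarrow> real) \<Rightarrow> bool" where
  "quasi_concave g \<longleftrightarrow> mono_on {0..} g \<and> (\<forall>t\<ge>0. 0 \<le> g t \<and> (g t = 0 \<longleftrightarrow> t = 0)) \<and>
     mono_on {0<..} (\<lambda>t. t / g t)"

definition equiv_quasi_concave :: "(ennreal \<Rightarrow> ennreal) \<Rightarrow> bool" where
  "equiv_quasi_concave \<phi> \<longleftrightarrow>
     (\<exists>g. quasi_concave g \<and> equiv_on {0..} (\<lambda>t. \<phi> (ennreal t)) (\<lambda>t. ennreal (g t)))"

text \<open>The functions \<open>\<psi>\<close> that may be picked in the definition of the endpoint spaces of \<open>\<phi>\<close>.\<close>

definition concave_choice :: "(ennreal \<Rightarrow> ennreal) \<Rightarrow> (real \<Rightarrow> real) \<Rightarrow> bool" where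
  "concave_choice \<phi> \<psi> \<longleftrightarrow> mono_on {0..} \<psi> \<and> concave_on {0..} \<psi> \<and> \<psi> 0 = 0 \<and>
     equiv_on {0..} (\<lambda>t. \<phi> (ennreal t)) (\<lambda>t. ennreal (\<psi> t))"

definition Marcinkiewicz :: "'a measure \<Rightarrow> (real \<Rightarrow> real) \<Rightarrow> ('a \<Rightarrow> ecomplex) \<Rightarrow> ennreal" where
  "Marcinkiewicz R \<psi> f = (SUP t\<in>{0<..}. ennreal (\<psi> t) * max_rearr R f t)"

text \<open>\<open>interval_measure\<close> needs a right-continuous distribution function. Passing to right
  limits changes \<open>\<psi>\<close> only at \<open>0\<close>, and extending by \<open>0\<close> to the negative axis produces the
  atom of mass \<open>\<psi>(0+)\<close> at \<open>0\<close>.\<close>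

definition stieltjes :: "(real \<Rightarrow> real) \<Rightarrow> real measure" where
  "stieltjes \<psi> = interval_measure (\<lambda>t. if t < 0 then 0 else Lim (at_right t) \<psi>)"

definition Lorentz :: "'a measure \<Rightarrow> (real \<Rightarrow> real) \<Rightarrow> ('a \<Rightarrow> ecomplex) \<Rightarrow> ennreal" where
  "Lorentz R \<psi> f = (\<integral>\<^sup>+ t\<in>{0..}. rearr R f t \<partial>stieltjes \<psi>)"

end

theory Submission
  imports Defs "HOL-Probability.Distribution_Functions"
begin

text \<open>Slow variation with exponent \<open>1/2\<close> yields \<open>b(s) \<le> K (s/t)\<^sup>1\<^sup>/\<^sup>2 b(t)\<close> for \<open>t \<le> s\<close>. Hence
  \<open>b(t)\<^sup>q\<close> and the tail \<open>\<integral>\<^sub>t\<^sup>\<infinity> (t/s)\<^sup>q b(s)\<^sup>q ds/s\<close> are bounded by \<open>\<integral>\<^sub>0\<^sup>t b(s)\<^sup>q ds/s\<close>, up to constants, which makes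
  the fundamental function \<open>\<phi>\<close> equivalent to a concave function and to the fundamental function of
  \<open>L\<^sup>(\<^sup>\<infinity>\<^sup>,\<^sup>q\<^sup>,\<^sup>b\<^sup>)\<close>. Every Lorentz-type functional has the form \<open>\<integral> \<Phi>(d(s)) ds\<close>, where \<open>d\<close> is the
  distribution function of \<open>|f|\<close>, so two of them are equivalent as soon as the functions \<open>\<Phi>\<close> are: for the
  Lorentz endpoint space \<open>\<Phi>\<close> is \<open>\<psi>\<close>, for \<open>L\<^sup>\<infinity>\<^sup>,\<^sup>1\<^sup>,\<^sup>a\<close> it is \<open>q \<phi>\<close>, and for \<open>\<Lambda>\<^sup>1(b')\<close> it is \<open>b - b(0+)\<close>
  by the fundamental theorem of calculus for absolutely continuous functions.\<close>

section \<open>Equivalence and quasinorms\<close>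

text \<open>The concave function \<open>\<psi>\<close> of an endpoint space is an arbitrary one
  equivalent to the fundamental function. Equivalent functions may have very different derivatives,
  so the Stieltjes measure of \<open>\<psi>\<close> cannot be compared pointwise with the weights
  a(t)/t or b'(t). Exchanging the order of integration removes this obstacle: only masses of initial
  intervals remain, and these are comparable. When b(0+) > 0, the function b - b(0+) is too small
  near 0 to be equivalent to b. The summand for the space of bounded functions repairs this, because
  its profile is the constant 1 on (0,\<infinity>). In the case q = \<infinity> the derivative is
  the classical one, whereas the Radon-Nikodym theorem yields only a density of the Stieltjes
  measure. A Vitali covering argument identifies the two almost everywhere.\<close>

text \<open>Two one-sided estimates with unrelated constants are what arises in practice. The
  minimum in the lower constant guarantees that it does not exceed the upper one.\<close>

lemma equiv_onI:
  assumes "0 < C" "0 < D"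
    and "\<And>x. x \<in> S \<Longrightarrow> h x \<le> ennreal C * g x" "\<And>x. x \<in> S \<Longrightarrow> g x \<le> ennreal D * h x"
  shows "equiv_on S g h"
  unfolding equiv_on_def
proof (intro exI conjI ballI)
  fix x assume x: "x \<in> S"
  have "ennreal (min C (1 / D)) * g x \<le> ennreal (1 / D) * (ennreal D * h x)"
    by (intro mult_mono assms(4)[OF x] ennreal_leI) auto
  also have "\<dots> = h x"
    using assms by (simp add: mult.assoc[symmetric] ennreal_mult'[symmetric])
  finally show "ennreal (min C (1 / D)) * g x \<le> h x" .
  show "h x \<le> ennreal C * g x" by (rule assms(3)[OF x])
qed (use assms in auto)

lemma equiv_onE:
  assumes "equiv_on S g h"
  obtains C where "0 < C" "\<And>x. x \<in> S \<Longrightarrow> h x \<le> ennreal C * g x"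
    "\<And>x. x \<in> S \<Longrightarrow> g x \<le> ennreal C * h x"
proof -
  obtain c C :: real where c: "0 < c" "c \<le> C"
    and *: "\<And>x. x \<in> S \<Longrightarrow> ennreal c * g x \<le> h x" "\<And>x. x \<in> S \<Longrightarrow> h x \<le> ennreal C * g x"
    using assms unfolding equiv_on_def by blast
  show thesis
  proof (rule that[of "max C (1 / c)"])
    show "0 < max C (1 / c)" using c by auto
    fix x assume x: "x \<in> S"
    show "h x \<le> ennreal (max C (1 / c)) * g x"
      by (rule order_trans[OF *(2)[OF x]]) (intro mult_mono ennreal_leI; simp)
    have "g x = ennreal (1 / c) * (ennreal c * g x)"
      using c by (simp add: mult.assoc[symmetric] ennreal_mult'[symmetric])
    also have "\<dots> \<le> ennreal (max C (1 / c)) * h x"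
      by (intro mult_mono *(1)[OF x] ennreal_leI) auto
    finally show "g x \<le> ennreal (max C (1 / c)) * h x" .
  qed
qed

lemma equiv_on_sym:
  assumes "equiv_on S g h"
  shows "equiv_on S h g"
proof -
  obtain C where C: "0 < C" "\<And>x. x \<in> S \<Longrightarrow> h x \<le> ennreal C * g x"
    "\<And>x. x \<in> S \<Longrightarrow> g x \<le> ennreal C * h x" by (rule equiv_onE[OF assms]) (rule that)
  show ?thesis by (rule equiv_onI[OF C(1) C(1) C(3) C(2)])
qed

lemma equiv_on_trans:
  assumes "equiv_on S f g" "equiv_on S g h"
  shows "equiv_on S f h"
proof -
  obtain C where C: "0 < C" "\<And>x. x \<in> S \<Longrightarrow> g x \<le> ennreal C * f x"
    "\<And>x. x \<in> S \<Longrightarrow> f x \<le> ennreal C * g x" by (rule equiv_onE[OF assms(1)]) (rule that)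
  obtain D where D: "0 < D" "\<And>x. x \<in> S \<Longrightarrow> h x \<le> ennreal D * g x"
    "\<And>x. x \<in> S \<Longrightarrow> g x \<le> ennreal D * h x" by (rule equiv_onE[OF assms(2)]) (rule that)
  show ?thesis
  proof (rule equiv_onI[of "D * C" "C * D"])
    fix x assume x: "x \<in> S"
    have "h x \<le> ennreal D * (ennreal C * f x)"
      using D(2)[OF x] C(2)[OF x] by (meson mult_left_mono order_trans zero_le)
    then show "h x \<le> ennreal (D * C) * f x"
      using C D by (simp add: ennreal_mult mult.assoc)
    have "f x \<le> ennreal C * (ennreal D * h x)"
      using C(3)[OF x] D(3)[OF x] by (meson mult_left_mono order_trans zero_le)
    then show "f x \<le> ennreal (C * D) * h x"
      using C D by (simp add: ennreal_mult mult.assoc)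
  qed (use C D in auto)
qed

lemma equiv_on_subset: "equiv_on S g h \<Longrightarrow> T \<subseteq> S \<Longrightarrow> equiv_on T g h"
  unfolding equiv_on_def by blast

lemma same_spaceI:
  assumes "0 < C" "0 < D" "\<And>f. f \<in> meas_funs R \<Longrightarrow> N' f \<le> ennreal C * N f"
    "\<And>f. f \<in> meas_funs R \<Longrightarrow> N f \<le> ennreal D * N' f"
  shows "same_space R N N'"
proof -
  have "N f < \<infinity> \<longleftrightarrow> N' f < \<infinity>" if "f \<in> meas_funs R" for f
    using assms(3,4)[OF that] by (auto simp: ennreal_mult_less_top intro: le_less_trans)
  then have "space_of R N = space_of R N'"
    by (auto simp: space_of_def)
  moreover have "equiv_on (space_of R N) N N'"
    by (rule equiv_onI[of C D]) (use assms in \<open>auto simp: space_of_def\<close>)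
  ultimately show ?thesis by (simp add: same_space_def)
qed

lemma epowr_ennreal: "0 \<le> x \<Longrightarrow> 0 < r \<Longrightarrow> epowr (ennreal x) r = ennreal (x powr r)"
  by (auto simp: epowr_def ennreal_eq_0_iff)

lemma epowr_ennreal_pos: "0 < x \<Longrightarrow> epowr (ennreal x) r = ennreal (x powr r)"
  by (auto simp: epowr_def ennreal_eq_0_iff)

lemma epowr_0 [simp]: "0 < r \<Longrightarrow> epowr 0 r = 0"
  and epowr_top [simp]: "0 < r \<Longrightarrow> epowr top r = top"
  by (auto simp: epowr_def)

lemma epowr_one_right [simp]: "epowr x 1 = x"
  by (cases x) (auto simp: epowr_def ennreal_eq_0_iff)

lemma epowr_mono:
  assumes "x \<le> y" "0 < r"
  shows "epowr x r \<le> epowr y r"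
proof (cases y)
  case (real v)
  then obtain u where "x = ennreal u" "0 \<le> u"
    using assms(1) by (cases x) (auto simp: top_unique)
  then show ?thesis
    using real assms by (auto simp: epowr_ennreal intro!: ennreal_leI powr_mono2)
qed (use assms in simp)

lemma epowr_cmult:
  assumes "0 < c" "0 < r"
  shows "epowr (ennreal c * x) r = ennreal (c powr r) * epowr x r"
proof (cases x)
  case (real v)
  then show ?thesis
    using assms by (simp add: ennreal_mult[symmetric] epowr_ennreal powr_mult)
qed (use assms in \<open>simp add: ennreal_mult_top\<close>)

text \<open>Measurability of \<open>f\<close> matters for the exponent \<infinity>:
  \<open>esssup\<close> takes the value top on a function that is not measurable, so pointwise
  domination alone would not give the estimate there.\<close>

lemma Lq_norm_mono:
  assumes "f \<in> borel_measurable (lebesgue_on {0<..})" "0 < q" "\<And>t. 0 < t \<Longrightarrow> f t \<le> g t"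
  shows "Lq_norm q f \<le> Lq_norm q g"
proof (cases "q = \<infinity>")
  case True
  then show ?thesis
    using assms by (auto simp: Lq_norm_def intro!: esssup_AE_mono AE_I2)
next
  case False
  then have "0 < enn2real q"
    using assms(2) by (simp add: enn2real_positive_iff less_top)
  then show ?thesis
    using False assms(3)
    by (auto simp: Lq_norm_def intro!: epowr_mono nn_integral_mono split: split_indicator)
qed

lemma Lq_norm_cong:
  assumes "\<And>t. 0 < t \<Longrightarrow> f t = g t"
  shows "Lq_norm q f = Lq_norm q g"
proof -
  have "f \<in> borel_measurable (lebesgue_on {0<..}) \<longleftrightarrow> g \<in> borel_measurable (lebesgue_on {0<..})"
    using assms by (intro measurable_cong) auto
  then have "esssup (lebesgue_on {0<..}) f = esssup (lebesgue_on {0<..}) g"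
    using assms by (auto simp: esssup_def intro!: Limsup_eq AE_I2)
  moreover have "(\<integral>\<^sup>+ t\<in>{0<..}. epowr (f t) s \<partial>lebesgue) = (\<integral>\<^sup>+ t\<in>{0<..}. epowr (g t) s \<partial>lebesgue)" for s
    using assms by (intro nn_integral_cong) (auto split: split_indicator)
  ultimately show ?thesis by (simp add: Lq_norm_def)
qed

text \<open>Truncation at \<open>n\<close> reduces the claim to real-valued monotone functions, and
  the supremum over \<open>n\<close> recovers \<open>f\<close>.\<close>

lemma mono_ennreal_measurable:
  fixes f :: "real \<Rightarrow> ennreal"
  assumes "mono f"
  shows "f \<in> borel_measurable borel"
proof -
  have "mono (\<lambda>x. enn2real (min (f x) (of_nat n)))" for n
    using assms by (intro monoI enn2real_mono min.mono)
      (auto simp: mono_def min_less_iff_disj of_nat_less_top)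
  then have *[measurable]: "(\<lambda>x. enn2real (min (f x) (of_nat n))) \<in> borel_measurable borel" for n
    by (rule borel_measurable_mono)
  have "f x = (SUP n. min (f x) (of_nat n))" for x
  proof -
    have "(SUP n. min (f x) (of_nat n)) = inf (f x) (SUP n. of_nat n :: ennreal)"
      unfolding inf_min[symmetric] by (rule inf_SUP[symmetric])
    then show ?thesis by (simp add: ennreal_SUP_of_nat_eq_top inf_top_right)
  qed
  moreover have "min (f x) (of_nat n) = ennreal (enn2real (min (f x) (of_nat n)))" for x n
    by (simp add: ennreal_enn2real_if min_def of_nat_less_top) 
       (metis infinity_ennreal_def ennreal_of_nat_neq_top top_unique)
  ultimately have "f = (\<lambda>x. SUP n. ennreal (enn2real (min (f x) (of_nat n))))"
    by auto
  moreover have "\<dots> \<in> borel_measurable borel" by measurable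
  ultimately show ?thesis by simp
qed

lemma antimono_ennreal_measurable:
  fixes f :: "real \<Rightarrow> ennreal"
  assumes "antimono f"
  shows "f \<in> borel_measurable borel"
proof -
  have "mono (\<lambda>x. f (- x))"
    using assms by (auto simp: mono_def antimono_def)
  then have [measurable]: "(\<lambda>x. f (- x)) \<in> borel_measurable borel"
    by (rule mono_ennreal_measurable)
  have "(\<lambda>x. f (- (- x))) \<in> borel_measurable borel"
    using measurable_compose[of uminus borel borel "\<lambda>x. f (- x)" borel] by simp
  then show ?thesis by simp
qed

section \<open>Rearrangements and the layer cake formula\<close>

lemma ecmod_measurable:
  assumes "f \<in> meas_funs R"
  shows "(\<lambda>x. ecmod (f x)) \<in> borel_measurable R"
proof (rule borel_measurableI_greater)
  fix a :: ennreal
  have 1: "f -` {Infty} \<inter> space R \<in> sets R"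
    and 2: "\<And>B. B \<in> sets (borel :: complex measure) \<Longrightarrow> f -` (Fin ` B) \<inter> space R \<in> sets R"
    using assms by (auto simp: meas_funs_def)
  have "{z. a < ennreal (cmod z)} \<in> sets borel" by measurable
  note 2[OF this]
  moreover have "{x \<in> space R. a < ecmod (f x)} =
      f -` (Fin ` {z. a < ennreal (cmod z)}) \<inter> space R \<union> (if a < \<infinity> then f -` {Infty} \<inter> space R else {})"
  proof (intro set_eqI)
    fix x
    show "x \<in> {x \<in> space R. a < ecmod (f x)} \<longleftrightarrow>
      x \<in> f -` (Fin ` {z. a < ennreal (cmod z)}) \<inter> space R \<union> (if a < \<infinity> then f -` {Infty} \<inter> space R else {})"
      by (cases "f x") auto
  qed
  ultimately show "{x \<in> space R. a < ecmod (f x)} \<in> sets R"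
    using 1 by simp
qed

definition distr_fun :: "'a measure \<Rightarrow> ('a \<Rightarrow> ecomplex) \<Rightarrow> real \<Rightarrow> ennreal" where
  "distr_fun R f s = emeasure R {x \<in> space R. ennreal s < ecmod (f x)}"

lemma distr_fun_antimono:
  assumes "f \<in> meas_funs R"
  shows "antimono (distr_fun R f)"
proof (rule antimonoI)
  note [measurable] = ecmod_measurable[OF assms]
  fix s t :: real assume "s \<le> t"
  then show "distr_fun R f t \<le> distr_fun R f s"
    unfolding distr_fun_def by (intro emeasure_mono) (auto dest: ennreal_leI)
qed

lemma rearr_antimono: "antimono (rearr R f)"
  unfolding rearr_def
proof (intro antimonoI Inf_superset_mono Collect_mono impI, elim exE conjE)
  fix x y :: real and z s assume *: "x \<le> y" "z = ennreal s" "0 \<le> s"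
    "emeasure R {x \<in> space R. ennreal s < ecmod (f x)} \<le> ennreal x"
  then show "\<exists>s. z = ennreal s \<and> 0 \<le> s \<and>
      emeasure R {x \<in> space R. ennreal s < ecmod (f x)} \<le> ennreal y"
    by (intro exI[of _ s]) (auto intro: order_trans ennreal_leI)
qed

lemma rearr_measurable: "rearr R f \<in> borel_measurable borel"
  by (rule antimono_ennreal_measurable[OF rearr_antimono])

text \<open>The rearrangement is the generalised inverse of the distribution function. Strictness on
  the left rests on right-continuity of the latter: the set where |f| > s is the increasing union of
  the sets where |f| > s + 1/(n+1), so an inequality at level \<open>s\<close> survives at a
  slightly larger level.\<close>

lemma less_rearr_iff:
  assumes "f \<in> meas_funs R" "0 \<le> s"
  shows "ennreal s < rearr R f t \<longleftrightarrow> ennreal t < distr_fun R f s"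
proof
  assume "ennreal s < rearr R f t"
  moreover have "rearr R f t \<le> ennreal s" if "distr_fun R f s \<le> ennreal t"
    unfolding rearr_def using that assms(2) by (intro Inf_lower) (auto simp: distr_fun_def)
  ultimately show "ennreal t < distr_fun R f s" by (meson linorder_not_le)
next
  note [measurable] = ecmod_measurable[OF assms(1)]
  assume less: "ennreal t < distr_fun R f s"
  define A where "A n = {x \<in> space R. ennreal (s + 1 / real (Suc n)) < ecmod (f x)}" for n
  have "incseq A"
    unfolding A_def incseq_Suc_iff
  proof (intro allI subsetI, clarsimp)
    fix n x assume "ennreal (s + 1 / (1 + real n)) < ecmod (f x)"
    moreover have "ennreal (s + 1 / (2 + real n)) \<le> ennreal (s + 1 / (1 + real n))"
      by (intro ennreal_leI add_mono) (auto simp: field_simps)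
    ultimately show "ennreal (s + 1 / (2 + real n)) < ecmod (f x)" by simp
  qed
  moreover have "range A \<subseteq> sets R" by (auto simp: A_def)
  ultimately have "(SUP n. emeasure R (A n)) = emeasure R (\<Union>n. A n)"
    by (intro SUP_emeasure_incseq)
  moreover have "(\<Union>n. A n) = {x \<in> space R. ennreal s < ecmod (f x)}"
  proof (intro equalityI subsetI)
    fix x assume "x \<in> (\<Union>n. A n)"
    moreover have "ennreal s \<le> ennreal (s + 1 / real (Suc n))" for n
      by (intro ennreal_leI) simp
    ultimately show "x \<in> {x \<in> space R. ennreal s < ecmod (f x)}"
      by (auto simp: A_def intro: le_less_trans)
  next
    fix x assume x: "x \<in> {x \<in> space R. ennreal s < ecmod (f x)}"
    have "\<exists>n. ennreal (s + 1 / real (Suc n)) < ecmod (f x)"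
    proof (cases "ecmod (f x)")
      case (real v)
      then have "0 < v - s" using x assms(2) by (auto simp: ennreal_less_iff)
      then obtain n where "1 / real (Suc n) < v - s"
        using reals_Archimedean[of "v - s"] by (metis inverse_eq_divide)
      then show ?thesis using real assms(2) by (auto intro!: exI[of _ n] simp: ennreal_less_iff simp del: ennreal_plus)
    qed auto
    then show "x \<in> (\<Union>n. A n)" using x by (auto simp: A_def)
  qed
  ultimately have "ennreal t < (SUP n. emeasure R (A n))"
    using less by (simp add: distr_fun_def)
  then obtain n where n: "ennreal t < distr_fun R f (s + 1 / real (Suc n))"
    by (auto simp: less_SUP_iff A_def distr_fun_def)
  have "ennreal (s + 1 / real (Suc n)) \<le> rearr R f t"
    unfolding rearr_def
  proof (rule Inf_greatest, clarify)
    fix u assume "0 \<le> u" and u: "emeasure R {x \<in> space R. ennreal u < ecmod (f x)} \<le> ennreal t"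
    have "s + 1 / real (Suc n) \<le> u"
    proof (rule ccontr)
      assume "\<not> ?thesis"
      then have "distr_fun R f (s + 1 / real (Suc n)) \<le> distr_fun R f u"
        by (intro antimonoD[OF distr_fun_antimono[OF assms(1)]]) simp
      with u n show False by (simp add: distr_fun_def)
    qed
    then show "ennreal (s + 1 / real (Suc n)) \<le> ennreal u" by (rule ennreal_leI)
  qed
  moreover have "ennreal s < ennreal (s + 1 / real (Suc n))"
    using assms(2) by (intro ennreal_lessI add_nonneg_pos) auto
  ultimately show "ennreal s < rearr R f t" by simp
qed

lemma ennreal_eq_nn_integral_less:
  "x = (\<integral>\<^sup>+ s\<in>{0<..}. indicator {s. ennreal s < x} s \<partial>lborel)"
proof -
  have "(\<integral>\<^sup>+ s\<in>{0<..}. indicator {s. ennreal s < x} s \<partial>lborel) =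
      (\<integral>\<^sup>+ s. indicator ({0<..} \<inter> {s. ennreal s < x}) s \<partial>lborel)"
    by (intro nn_integral_cong) (auto split: split_indicator)
  also have "\<dots> = emeasure lborel ({0<..} \<inter> {s. ennreal s < x})"
    by simp
  also have "\<dots> = x"
  proof (cases x)
    case (real v)
    then have "{0<..} \<inter> {s. ennreal s < x} = {0<..<v}"
      by (auto simp: ennreal_less_iff)
    then show ?thesis using real by simp
  next
    case top
    have "of_nat n \<le> emeasure lborel {0<..(real n)}" for n by (simp add: ennreal_of_nat_eq_real_of_nat)
    moreover have "emeasure lborel {0<..(real n)} \<le> emeasure lborel {0::real<..}" for n
      by (intro emeasure_mono) auto
    ultimately have "\<And>n. of_nat n \<le> emeasure lborel {0::real<..}" by (meson order_trans)
    then have "emeasure lborel {0::real<..} = top"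
      by (metis ennreal_SUP_of_nat_eq_top SUP_least top_unique UNIV_I)
    then show ?thesis using top by (simp add: Collect_conv_if)
  qed
  finally show ?thesis by simp
qed

text \<open>The value \<open>rearr R f t\<close> is the length of the set of levels s > 0 below it.
  Fubini's theorem exchanges the two integrals, and \<open>less_rearr_iff\<close> turns the
  condition on the level into a condition on \<open>t\<close>. Measurability is stated relative to
  \<open>\<nu>\<close> because both Borel and complete measures occur.\<close>

lemma rearr_layer_cake:
  assumes f: "f \<in> meas_funs R" and "sigma_finite_measure \<nu>"
    and v[measurable]: "v \<in> borel_measurable \<nu>" and rm[measurable]: "rearr R f \<in> borel_measurable \<nu>"
  shows "(\<integral>\<^sup>+ t. rearr R f t * v t \<partial>\<nu>) =
    (\<integral>\<^sup>+ s\<in>{0<..}. (\<integral>\<^sup>+ t. indicator {t. ennreal t < distr_fun R f s} t * v t \<partial>\<nu>) \<partial>lborel)"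
proof -
  interpret sigma_finite_measure \<nu> by fact
  interpret pair_sigma_finite lborel \<nu> ..
  have "(\<integral>\<^sup>+ t. rearr R f t * v t \<partial>\<nu>) =
      (\<integral>\<^sup>+ t. (\<integral>\<^sup>+ s. indicator {0<..} s * indicator {s. ennreal s < rearr R f t} s \<partial>lborel) * v t \<partial>\<nu>)"
    by (simp only: mult.commute[of "indicator {0<..} _"] ennreal_eq_nn_integral_less[symmetric])
  also have "\<dots> = (\<integral>\<^sup>+ t. (\<integral>\<^sup>+ s. indicator {0<..} s * (if ennreal s < rearr R f t then 1 else 0) * v t \<partial>lborel) \<partial>\<nu>)"
    by (subst nn_integral_multc[symmetric]) (auto intro!: nn_integral_cong split: split_indicator)
  also have "\<dots> = (\<integral>\<^sup>+ s. (\<integral>\<^sup>+ t. indicator {0<..} s * (if ennreal s < rearr R f t then 1 else 0) * v t \<partial>\<nu>) \<partial>lborel)"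
    by (rule Fubini') measurable
  also have "\<dots> = (\<integral>\<^sup>+ s\<in>{0<..}. (\<integral>\<^sup>+ t. indicator {t. ennreal t < distr_fun R f s} t * v t \<partial>\<nu>) \<partial>lborel)"
    by (auto intro!: nn_integral_cong simp: less_rearr_iff[OF f] split: split_indicator)
  finally show ?thesis .
qed

text \<open>Since \<open>f\<^sup>*(t) > s\<close> holds exactly for \<open>t\<close> below the distribution function of \<open>f\<close> at \<open>s\<close>, every
  functional integrating \<open>f\<^sup>*\<close> against a measure has such a profile, namely the
  mass of an initial interval; two functionals are then compared through their profiles at real
  arguments only.\<close>

definition has_profile ::
  "'a measure \<Rightarrow> (('a \<Rightarrow> ecomplex) \<Rightarrow> ennreal) \<Rightarrow> (ennreal \<Rightarrow> ennreal) \<Rightarrow> bool" where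
  "has_profile R N \<Phi> \<longleftrightarrow> mono \<Phi> \<and> \<Phi> 0 = 0 \<and> \<Phi> \<infinity> = (SUP n::nat. \<Phi> (of_nat n)) \<and>
     (\<forall>f \<in> meas_funs R. N f = (\<integral>\<^sup>+ s\<in>{0<..}. \<Phi> (distr_fun R f s) \<partial>lborel))"

lemma has_profile_le:
  assumes N: "has_profile R N \<Phi>" and N': "has_profile R N' \<Phi>'"
    and le: "\<And>x. 0 < x \<Longrightarrow> \<Phi>' (ennreal x) \<le> ennreal C * \<Phi> (ennreal x)" and f: "f \<in> meas_funs R"
  shows "N' f \<le> ennreal C * N f"
proof -
  have *: "\<Phi>' (ennreal x) \<le> ennreal C * \<Phi> (ennreal x)" for x
    using N' le by (cases "0 < x") (auto simp: has_profile_def ennreal_neg)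
  have "\<Phi>' m \<le> ennreal C * \<Phi> m" for m
  proof (cases m)
    \<comment> \<open>The distribution function may be infinite, while the hypothesis covers real
      arguments; the bound at \<infinity> is inherited from the natural numbers by the supremum
      clause of \<open>has_profile\<close>.\<close>
    case top
    have "\<Phi>' (of_nat n) \<le> ennreal C * \<Phi> \<infinity>" for n
    proof -
      have "\<Phi>' (of_nat n) \<le> ennreal C * \<Phi> (of_nat n)"
        using *[of "real n"] by (simp add: ennreal_of_nat_eq_real_of_nat)
      also have "\<dots> \<le> ennreal C * \<Phi> \<infinity>"
        using N by (intro mult_left_mono monoD[of \<Phi>]) (auto simp: has_profile_def)
      finally show ?thesis .
    qed
    then show ?thesis
      using N' top by (simp add: has_profile_def SUP_least)
  qed (simp add: *)
  then have "N' f \<le> (\<integral>\<^sup>+ s. ennreal C * (\<Phi> (distr_fun R f s) * indicator {0<..} s) \<partial>lborel)"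
    using N' f by (auto simp: has_profile_def intro!: nn_integral_mono split: split_indicator)
  also have "\<dots> = ennreal C * N f"
  proof -
    have "antimono (\<lambda>s. \<Phi> (distr_fun R f s))"
      using distr_fun_antimono[OF f] N by (auto simp: has_profile_def mono_def antimono_def)
    then have [measurable]: "(\<lambda>s. \<Phi> (distr_fun R f s)) \<in> borel_measurable borel"
      by (rule antimono_ennreal_measurable)
    show ?thesis
      using N f by (subst nn_integral_cmult) (auto simp: has_profile_def)
  qed
  finally show ?thesis .
qed

lemma same_space_profile:
  assumes "has_profile R N \<Phi>" "has_profile R N' \<Phi>'"
    and "equiv_on {0<..} (\<lambda>x. \<Phi> (ennreal x)) (\<lambda>x. \<Phi>' (ennreal x))"
  shows "same_space R N N'"
proof -
  obtain C where C: "0 < C" "\<And>x. 0 < x \<Longrightarrow> \<Phi>' (ennreal x) \<le> ennreal C * \<Phi> (ennreal x)"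
    "\<And>x. 0 < x \<Longrightarrow> \<Phi> (ennreal x) \<le> ennreal C * \<Phi>' (ennreal x)"
    by (rule equiv_onE[OF assms(3)]) (rule that, auto)
  show ?thesis
  proof (rule same_spaceI[OF C(1) C(1)])
    fix f assume "f \<in> meas_funs R"
    then show "N' f \<le> ennreal C * N f" "N f \<le> ennreal C * N' f"
      using has_profile_le[OF assms(1,2) C(2)] has_profile_le[OF assms(2,1) C(3)] by blast+
  qed
qed

text \<open>A general measure \<open>\<nu>\<close> covers both the Stieltjes measure of a Lorentz
  endpoint norm and Lebesgue measure with a density. The supremum clause is monotone convergence,
  since every real number lies below some \<open>n\<close>.\<close>

lemma has_profile_weight:
  assumes "sigma_finite_measure \<nu>" and v[measurable]: "v \<in> borel_measurable \<nu>"
    and b: "\<And>g::real \<Rightarrow> ennreal. g \<in> borel_measurable borel \<Longrightarrow> g \<in> borel_measurable \<nu>"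
    and v0: "\<And>t. t < 0 \<Longrightarrow> v t = 0"
    and N: "\<And>f. f \<in> meas_funs R \<Longrightarrow> N f = (\<integral>\<^sup>+ t. rearr R f t * v t \<partial>\<nu>)"
  shows "has_profile R N (\<lambda>m. \<integral>\<^sup>+ t. indicator {t. ennreal t < m} t * v t \<partial>\<nu>)"
  unfolding has_profile_def
proof (intro conjI ballI)
  let ?\<Phi> = "\<lambda>m. \<integral>\<^sup>+ t. indicator {t. ennreal t < m} t * v t \<partial>\<nu>"
  have meas: "(\<lambda>t. indicator {t. ennreal t < m} t * v t) \<in> borel_measurable \<nu>" for m
    by (rule borel_measurable_times_ennreal[OF _ v], rule b) measurable
  show "mono ?\<Phi>"
    by (intro monoI nn_integral_mono) (auto split: split_indicator)
  show "?\<Phi> 0 = 0" by simp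
  have "(SUP n. ?\<Phi> (of_nat n)) = (\<integral>\<^sup>+ t. (SUP n. indicator {t. ennreal t < of_nat n} t * v t) \<partial>\<nu>)"
    by (intro nn_integral_monotone_convergence_SUP[symmetric] meas)
      (auto simp: incseq_def le_fun_def split: split_indicator intro: less_le_trans)
  also have "\<dots> = ?\<Phi> \<infinity>"
  proof (intro nn_integral_cong)
    fix t
    \<comment> \<open>For negative \<open>t\<close> the value \<open>ennreal t\<close> is 0, so
      \<open>n\<close> must also be positive to lie strictly above it.\<close>
    obtain n where "max t 0 < real n" using reals_Archimedean2 by blast
    then have n: "ennreal t < of_nat n"
      by (cases "0 \<le> t") (auto simp: ennreal_of_nat_eq_real_of_nat ennreal_less_iff ennreal_neg)
    show "(SUP n. indicator {t. ennreal t < of_nat n} t * v t) = indicator {t. ennreal t < \<infinity>} t * v t"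
    proof (rule antisym)
      show "indicator {t. ennreal t < \<infinity>} t * v t \<le> (SUP n. indicator {t. ennreal t < of_nat n} t * v t)"
        by (rule SUP_upper2[of n]) (use n in auto)
    qed (auto intro!: SUP_least split: split_indicator)
  qed
  finally show "?\<Phi> \<infinity> = (SUP n. ?\<Phi> (of_nat n))" by simp
  fix f assume f: "f \<in> meas_funs R"
  show "N f = (\<integral>\<^sup>+ s\<in>{0<..}. ?\<Phi> (distr_fun R f s) \<partial>lborel)"
    unfolding N[OF f] by (rule rearr_layer_cake[OF f assms(1) v b[OF rearr_measurable]])
qed

lemma has_profile_add:
  assumes N: "has_profile R N \<Phi>" and N': "has_profile R N' \<Phi>'"
  shows "has_profile R (\<lambda>f. N f + N' f) (\<lambda>m. \<Phi> m + \<Phi>' m)"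
  unfolding has_profile_def
proof (intro conjI ballI)
  show "mono (\<lambda>m. \<Phi> m + \<Phi>' m)" "\<Phi> 0 + \<Phi>' 0 = 0"
    using N N' by (auto simp: has_profile_def mono_def add_mono)
  have "incseq (\<lambda>n. \<Phi> (of_nat n))" "incseq (\<lambda>n. \<Phi>' (of_nat n))"
    using N N' by (auto simp: has_profile_def mono_def incseq_def)
  then show "\<Phi> \<infinity> + \<Phi>' \<infinity> = (SUP n::nat. \<Phi> (of_nat n) + \<Phi>' (of_nat n))"
    using N N' by (subst ennreal_SUP_add) (auto simp: has_profile_def)
  fix f assume f: "f \<in> meas_funs R"
  have "antimono (\<lambda>s. \<Phi> (distr_fun R f s))" "antimono (\<lambda>s. \<Phi>' (distr_fun R f s))"
    using distr_fun_antimono[OF f] N N' by (auto simp: has_profile_def mono_def antimono_def)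
  then have [measurable]: "(\<lambda>s. \<Phi> (distr_fun R f s)) \<in> borel_measurable borel"
    "(\<lambda>s. \<Phi>' (distr_fun R f s)) \<in> borel_measurable borel"
    by (auto intro: antimono_ennreal_measurable)
  show "N f + N' f = (\<integral>\<^sup>+ s\<in>{0<..}. \<Phi> (distr_fun R f s) + \<Phi>' (distr_fun R f s) \<partial>lborel)"
    using N N' f by (simp add: has_profile_def distrib_right nn_integral_add)
qed

text \<open>Both sides are infima of levels exceeded on a null set only. The essential supremum
  additionally admits the level \<infinity>, which cannot lower an infimum.\<close>

lemma Linf_norm_eq_rearr:
  assumes "f \<in> meas_funs R"
  shows "Linf_norm R f = rearr R f 0"
proof -
  have *: "Linf_norm R f = Inf {z. emeasure R {x \<in> space R. z < ecmod (f x)} = 0}"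
    unfolding Linf_norm_def by (rule esssup_eq[OF ecmod_measurable[OF assms]])
  show ?thesis
  proof (rule antisym)
    show "Linf_norm R f \<le> rearr R f 0"
      unfolding * rearr_def by (rule Inf_superset_mono) auto
    show "rearr R f 0 \<le> Linf_norm R f"
      unfolding *
    proof (rule Inf_greatest)
      fix z assume "z \<in> {z. emeasure R {x \<in> space R. z < ecmod (f x)} = 0}"
      then show "rearr R f 0 \<le> z"
        by (cases z) (auto simp: rearr_def intro!: Inf_lower)
    qed
  qed
qed

text \<open>The supremum norm integrates the rearrangement against a unit atom at 0, so its profile
  jumps to 1 at once. It later compensates for a positive limit of \<open>b\<close> at 0.\<close>

lemma has_profile_Linf: "has_profile R (Linf_norm R) (indicator {0<..})"
  unfolding has_profile_def
proof (intro conjI ballI)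
  show "mono (indicator {0<..} :: ennreal \<Rightarrow> ennreal)"
    by (auto simp: mono_def split: split_indicator)
  show "indicator {0<..} (\<infinity> :: ennreal) = (SUP n::nat. indicator {0<..} (of_nat n :: ennreal) :: ennreal)"
    by (intro antisym SUP_upper2[of 1] SUP_least) (auto split: split_indicator simp: less_top[symmetric])
  fix f assume f: "f \<in> meas_funs R"
  show "Linf_norm R f = (\<integral>\<^sup>+ s\<in>{0<..}. indicator {0<..} (distr_fun R f s) \<partial>lborel)"
    unfolding Linf_norm_eq_rearr[OF f]
    by (rule ennreal_eq_nn_integral_less[THEN trans])
      (auto intro!: nn_integral_cong simp: less_rearr_iff[OF f] split: split_indicator)
qed simp

section \<open>Non-atomic measures\<close>

lemma non_atomic_measure_subset:
  assumes "non_atomic R" "A \<in> fmeasurable R" "0 < measure R A"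
  obtains B where "B \<in> fmeasurable R" "B \<subseteq> A" "0 < measure R B" "measure R B < measure R A"
proof -
  have em: "emeasure R C = ennreal (measure R C)" if "C \<in> fmeasurable R" for C
    using that by (rule emeasure_eq_measure2)
  have "0 < emeasure R A" unfolding em[OF assms(2)] using assms(3) by (simp only: ennreal_less_zero_iff)
  then obtain B where B: "B \<in> sets R" "B \<subseteq> A" "0 < emeasure R B" "emeasure R B < emeasure R A"
    using assms(1) fmeasurableD[OF assms(2)] unfolding non_atomic_def by blast
  have fB: "B \<in> fmeasurable R"
    by (rule fmeasurableI2[OF assms(2) B(2,1)])
  have "0 < measure R B" using B(3) unfolding em[OF fB] by (simp only: ennreal_less_zero_iff)
  moreover have "measure R B < measure R A"
    using B(4) unfolding em[OF fB] em[OF assms(2)] by (simp only: ennreal_less_iff[OF measure_nonneg])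
  ultimately show thesis using fB B(2) by (intro that)
qed

text \<open>Repeated halving: a proper subset \<open>C\<close> of \<open>B\<close> and its
  complement in \<open>B\<close> both have positive measure, and one of them has at most half the
  measure of \<open>B\<close>.\<close>

lemma non_atomic_small_subset:
  assumes "non_atomic R" "A \<in> fmeasurable R" "0 < measure R A" "0 < e"
  obtains B where "B \<in> fmeasurable R" "B \<subseteq> A" "0 < measure R B" "measure R B \<le> e"
proof -
  have *: "\<exists>B\<in>fmeasurable R. B \<subseteq> A \<and> 0 < measure R B \<and> measure R B \<le> measure R A / 2 ^ n" for n
  proof (induction n)
    case (Suc n)
    then obtain B where B: "B \<in> fmeasurable R" "B \<subseteq> A" "0 < measure R B" "measure R B \<le> measure R A / 2 ^ n"
      by blast
    obtain C where C: "C \<in> fmeasurable R" "C \<subseteq> B" "0 < measure R C" "measure R C < measure R B"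
      by (rule non_atomic_measure_subset[OF assms(1) B(1,3)])
    have d: "measure R (B - C) = measure R B - measure R C"
      using B C by (intro measurable_measure_Diff) auto
    have half: "measure R B / 2 \<le> measure R A / 2 ^ Suc n" using B(4) by simp
    show ?case
    proof (cases "measure R C \<le> measure R B / 2")
      case True
      then show ?thesis using B C half by (intro bexI[of _ C]) auto
    next
      case False
      then show ?thesis using B C d half
        by (intro bexI[of _ "B - C"] conjI fmeasurable_Diff fmeasurableD) auto
    qed
  qed (use assms in auto)
  have "(\<lambda>n. measure R A * (1 / 2) ^ n) \<longlonglongrightarrow> measure R A * 0"
    by (intro tendsto_intros LIMSEQ_power_zero) auto
  then have "eventually (\<lambda>n. measure R A * (1 / 2) ^ n < e) sequentially"
    using \<open>0 < e\<close> by (intro order_tendstoD(2)) auto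
  then obtain n where "measure R A / 2 ^ n < e"
    by (auto simp: eventually_sequentially power_divide)
  then show thesis using *[of n] that by (meson less_imp_le order_trans)
qed

text \<open>Greedy exhaustion: each step adds a set of at least half the largest admissible measure, so a
  deficit in the limit would leave room for one small set at every step.\<close>

lemma non_atomic_subset_measure_eq:
  assumes na: "non_atomic R" and A: "A \<in> fmeasurable R" and t: "0 \<le> t" "t \<le> measure R A"
  obtains B where "B \<in> fmeasurable R" "B \<subseteq> A" "measure R B = t"
proof -
  let ?m = "measure R"
  define P where "P B \<longleftrightarrow> B \<in> fmeasurable R \<and> B \<subseteq> A \<and> ?m B \<le> t" for B
  define Q where "Q B B' \<longleftrightarrow> B \<subseteq> B' \<and>
    (\<forall>C\<in>fmeasurable R. C \<subseteq> A - B \<and> ?m B + ?m C \<le> t \<longrightarrow> ?m C \<le> 2 * (?m B' - ?m B))" for B B'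
  have "\<exists>B. \<forall>n. P (B n) \<and> Q (B n) (B (Suc n))"
  proof (rule dependent_nat_choice)
    show "\<exists>B. P B" using t by (intro exI[of _ "{}"]) (auto simp: P_def)
    fix B and n :: nat assume B: "P B"
    define S where "S = ?m ` {C \<in> fmeasurable R. C \<subseteq> A - B \<and> ?m B + ?m C \<le> t}"
    have "{} \<in> {C \<in> fmeasurable R. C \<subseteq> A - B \<and> ?m B + ?m C \<le> t}" using B by (auto simp: P_def)
    then have "?m {} \<in> S" unfolding S_def by (rule imageI)
    then have ne: "0 \<in> S" by simp
    have bdd: "bdd_above S" 
    proof (rule bdd_aboveI[of _ t])
      fix c assume "c \<in> S"
      then show "c \<le> t" using measure_nonneg[of R B] unfolding S_def by (smt (verit) imageE mem_Collect_eq)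
    qed
    \<comment> \<open>The supremum need not be attained, hence the factor 2: a positive supremum is
      more than half reached by some element, and for supremum 0 the empty set serves.\<close>
    have "\<exists>c\<in>S. Sup S \<le> 2 * c"
    proof (cases "Sup S = 0")
      case True
      then show ?thesis using ne by (intro bexI[of _ 0]) auto
    next
      case False
      moreover have "0 \<le> Sup S" using ne bdd by (rule cSup_upper)
      ultimately have "Sup S / 2 < Sup S" by simp
      then obtain c where "c \<in> S" "Sup S / 2 < c" using ne less_cSupD[of S] by blast
      then show ?thesis by (intro bexI[of _ c]) auto
    qed
    then obtain C where C: "C \<in> fmeasurable R" "C \<subseteq> A - B" "?m B + ?m C \<le> t" "Sup S \<le> 2 * ?m C"
      by (auto simp: S_def)
    have un: "?m (B \<union> C) = ?m B + ?m C"
    proof -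
      have "C - B = C" using C(2) by blast
      then show ?thesis using measure_Un2[of B R C] B C(1) by (simp add: P_def)
    qed
    show "\<exists>B'. P B' \<and> Q B B'"
    proof (intro exI[of _ "B \<union> C"] conjI)
      show "P (B \<union> C)" using B C un by (auto simp: P_def)
      show "Q B (B \<union> C)"
        unfolding Q_def
      proof (intro conjI ballI impI)
        fix D assume "D \<in> fmeasurable R" "D \<subseteq> A - B \<and> ?m B + ?m D \<le> t"
        then have "?m D \<le> Sup S" by (intro cSup_upper bdd) (auto simp: S_def)
        then show "?m D \<le> 2 * (?m (B \<union> C) - ?m B)" using C(4) un by simp
      qed simp
    qed
  qed
  then obtain B where B: "\<And>n. P (B n)" "\<And>n. Q (B n) (B (Suc n))" by blast
  have inc: "incseq B"
    by (rule incseq_SucI) (rule B(2)[unfolded Q_def, THEN conjunct1])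
  have fB: "B n \<in> fmeasurable R" "B n \<subseteq> A" "?m (B n) \<le> t" for n
    using B(1)[of n] by (simp_all only: P_def)
  define U where "U = (\<Union>n. B n)"
  have U: "U \<subseteq> A" "U \<in> sets R" unfolding U_def using fB(2) fmeasurableD[OF fB(1)] by blast+
  then have fU: "U \<in> fmeasurable R" by (rule fmeasurableI2[OF A])
  have lim: "(\<lambda>n. ?m (B n)) \<longlonglongrightarrow> ?m U"
    unfolding U_def using fmeasurableD2[OF fU] fmeasurableD[OF fB(1)]
    by (intro Lim_measure_incseq inc) (auto simp: U_def)
  have Bn: "?m (B n) \<le> ?m U" for n
    using fU fmeasurableD[OF fB(1)] by (intro measure_mono_fmeasurable) (auto simp: U_def)
  have "?m U \<le> t" using fB(3) by (intro LIMSEQ_le_const2[OF lim]) auto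
  moreover have "\<not> ?m U < t"
  proof
    assume lt: "?m U < t"
    have "?m (A - U) = ?m A - ?m U" using A fU U by (intro measurable_measure_Diff) auto
    then have pos: "0 < ?m (A - U)" using lt t by simp
    have fAU: "A - U \<in> fmeasurable R" using A U(2) by (rule fmeasurable_Diff)
    have "0 < t - ?m U" using lt by simp
    then obtain C where C: "C \<in> fmeasurable R" "C \<subseteq> A - U" "0 < ?m C" "?m C \<le> t - ?m U"
      by (rule non_atomic_small_subset[OF na fAU pos])
    have "?m C \<le> 2 * (?m (B (Suc n)) - ?m (B n))" for n
    proof -
      have "C \<subseteq> A - B n" "?m (B n) + ?m C \<le> t" using C Bn[of n] by (auto simp: U_def)
      then show ?thesis using B(2)[of n] C(1) by (auto simp: Q_def)
    qed
    moreover have "(\<lambda>n. 2 * (?m (B (Suc n)) - ?m (B n))) \<longlonglongrightarrow> 2 * (?m U - ?m U)"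
      by (intro tendsto_mult tendsto_diff tendsto_const lim LIMSEQ_Suc[OF lim])
    ultimately have "?m C \<le> 2 * (?m U - ?m U)" by (rule_tac LIMSEQ_le_const) auto
    then show False using C(3) by simp
  qed
  ultimately have "?m U = t" by simp
  with fU U(1) show thesis by (rule that)
qed

text \<open>By \<sigma>-finiteness and infinite total measure, some set of finite measure exceeds
  any real target, and non-atomicity cuts it down to the exact value. Thus the choice made in
  \<open>fundamental\<close> is a genuine one at every argument.\<close>

lemma non_atomic_emeasure_eq:
  assumes "sigma_finite_measure R" "non_atomic R" "emeasure R (space R) = \<infinity>"
  obtains E where "E \<in> sets R" "emeasure R E = t"
proof (cases t)
  case top
  then show thesis using assms(3) by (intro that[of "space R"]) auto
next
  case (real x)
  interpret sigma_finite_measure R by fact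
  obtain A where A: "range A \<subseteq> sets R" "(\<Union>i. A i) = space R" "\<And>i. emeasure R (A i) \<noteq> \<infinity>" "incseq A"
    using sigma_finite_incseq by metis
  have "(SUP n. emeasure R (A n)) = \<infinity>"
    using SUP_emeasure_incseq[OF A(1,4)] A(2) assms(3) by simp
  then have "ennreal x < (SUP n. emeasure R (A n))" by (simp only: infinity_ennreal_def ennreal_less_top)
  then obtain n where n: "ennreal x < emeasure R (A n)" by (auto simp: less_SUP_iff)
  have fA: "A n \<in> fmeasurable R" using A(1,3) by (auto simp: fmeasurable_def less_top)
  then have "emeasure R (A n) = ennreal (measure R (A n))" by (rule emeasure_eq_measure2)
  with n real have "x \<le> measure R (A n)" by (auto simp: ennreal_less_iff)
  then obtain E where E: "E \<in> fmeasurable R" "measure R E = x"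
    using non_atomic_subset_measure_eq[OF assms(2) fA] real by metis
  then show thesis using real
    by (intro that[of E] fmeasurableD) (simp_all only: emeasure_eq_measure2)
qed

section \<open>Differentiation of absolutely continuous monotone functions\<close>

lemma interval_measure_cbox:
  assumes "mono F" "continuous_on UNIV F" "a \<le> b"
  shows "emeasure (interval_measure F) {a..b} = ennreal (F b - F a)"
  using assms by (intro emeasure_interval_measure_Icc) (auto dest: monoD)

text \<open>An open set \<open>U\<close> of small length around the null set contains countably many
  non-overlapping closed intervals that still cover it. Their total length is below
  \<open>\<delta>\<close>, so absolute continuity bounds the total increment of \<open>F\<close> by
  \<open>\<epsilon>\<close>. The covering intervals stay inside [c,d], where absolute continuity is
  available.\<close>

lemma abs_cont_interval_measure_null:
  fixes F :: "real \<Rightarrow> real"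
  assumes F: "mono F" "continuous_on UNIV F" and ac: "abs_cont_on_interval c d F" and "c < d"
    and N: "N \<in> null_sets lborel" "N \<subseteq> {c..d}"
  shows "emeasure (interval_measure F) N = 0"
proof -
  let ?\<nu> = "interval_measure F"
  have "emeasure ?\<nu> N \<le> 0 + ennreal \<epsilon>" if "0 < \<epsilon>" for \<epsilon>
  proof -
    obtain \<delta> where "0 < \<delta>" and \<delta>: "\<And>D. finite D \<Longrightarrow> \<forall>(u, v) \<in> D. c \<le> u \<and> u < v \<and> v \<le> d \<Longrightarrow>
       pairwise (\<lambda>(u, v) (u', v'). {u<..<v} \<inter> {u'<..<v'} = {}) D \<Longrightarrow>
       (\<Sum>(u, v)\<in>D. v - u) < \<delta> \<Longrightarrow> (\<Sum>(u, v)\<in>D. \<bar>F v - F u\<bar>) < \<epsilon>"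
      using ac \<open>0 < \<epsilon>\<close> unfolding abs_cont_on_interval_def by meson
    have "N \<in> sets lebesgue" using N(1) by auto
    then obtain U where U: "open U" "N \<subseteq> U" "U - N \<in> lmeasurable" "emeasure lebesgue (U - N) < ennreal \<delta>"
      using sets_lebesgue_outer_open[of N \<delta>] \<open>0 < \<delta>\<close> by blast
    have "N \<in> null_sets lebesgue" using N(1) by (rule null_sets_completionI)
    moreover have "U \<in> sets lebesgue" using U(1) by simp
    ultimately have "emeasure lebesgue (U - N) = emeasure lebesgue U"
      by (rule emeasure_Diff_null_set)
    with U(4) have lU: "emeasure lborel U < ennreal \<delta>" using U(1) by (simp add: emeasure_completion)
    \<comment> \<open>This gauge forces every covering interval tagged at a point of
      \<open>N\<close> to lie inside \<open>U\<close>.\<close>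
    define \<gamma> where "\<gamma> x = (if x \<in> U then U else UNIV)" for x
    have gauge: "gauge \<gamma>" using U(1) by (auto simp: gauge_def \<gamma>_def)
    have box: "N \<subseteq> cbox c d" "box c d \<noteq> {}" using N \<open>c < d\<close> by auto
    obtain \<D> where \<D>: "countable \<D>" "\<Union>\<D> \<subseteq> cbox c d"
      "\<And>K. K \<in> \<D> \<Longrightarrow> interior K \<noteq> {} \<and> (\<exists>u v. K = cbox u v)"
      "pairwise (\<lambda>A B. interior A \<inter> interior B = {}) \<D>"
      "\<And>K. K \<in> \<D> \<Longrightarrow> \<exists>x \<in> N \<inter> K. K \<subseteq> \<gamma> x" "N \<subseteq> \<Union>\<D>"
      using covering_lemma[OF box gauge] by (metis (no_types, lifting))
    have K_U: "K \<subseteq> U" if "K \<in> \<D>" for K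
      using \<D>(5)[OF that] U(2) by (auto simp: \<gamma>_def split: if_splits)
    have fin: "emeasure ?\<nu> (\<Union>\<D>') \<le> ennreal \<epsilon>" if "finite \<D>'" "\<D>' \<subseteq> \<D>" for \<D>'
    proof -
      define P where "P = (\<lambda>K. (Inf K, Sup K)) ` \<D>'"
      have *: "{Inf K..Sup K} = K \<and> Inf K < Sup K" if "K \<in> \<D>'" for K
      proof -
        have "K \<in> \<D>" using that \<open>\<D>' \<subseteq> \<D>\<close> by blast
        then obtain u v where "K = {u..v}" "interior K \<noteq> {}"
          using \<D>(3)[of K] by auto
        then show ?thesis by auto
      qed
      then have K: "Inf K < Sup K" if "K \<in> \<D>'" for K using that by blast
      have K_eq: "{Inf K..Sup K} = K" if "K \<in> \<D>'" for K using * that by blast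
      then have inj: "inj_on (\<lambda>K. (Inf K, Sup K)) \<D>'" by (intro inj_onI) (metis prod.inject)
      have int: "interior K = {Inf K<..<Sup K}" if "K \<in> \<D>'" for K
        using interior_atLeastAtMost_real[of "Inf K" "Sup K"] K_eq[OF that] by simp
      have disj: "disjoint_family_on (\<lambda>K. {Inf K<..<Sup K}) \<D>'"
      proof (unfold disjoint_family_on_def, intro ballI impI)
        fix K L assume KL: "K \<in> \<D>'" "L \<in> \<D>'" "K \<noteq> L"
        then have "interior K \<inter> interior L = {}"
          using \<D>(4) \<open>\<D>' \<subseteq> \<D>\<close> by (auto simp: pairwise_def)
        then show "{Inf K<..<Sup K} \<inter> {Inf L<..<Sup L} = {}"
          using int KL by simp
      qed
      have "ennreal (\<Sum>(u, v)\<in>P. v - u) = (\<Sum>K\<in>\<D>'. ennreal (Sup K - Inf K))"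
        unfolding P_def using K by (subst sum.reindex[OF inj]) (auto simp: sum_ennreal less_imp_le)
      also have "\<dots> = (\<Sum>K\<in>\<D>'. emeasure lborel {Inf K<..<Sup K})"
        using K by (intro sum.cong) (auto simp: less_imp_le)
      also have "\<dots> = emeasure lborel (\<Union>K\<in>\<D>'. {Inf K<..<Sup K})"
        using disj that by (intro sum_emeasure) auto
      also have "\<dots> \<le> emeasure lborel U"
      proof (intro emeasure_mono UN_least)
        fix K assume "K \<in> \<D>'"
        then show "{Inf K<..<Sup K} \<subseteq> U"
          using int[of K] K_U[of K] that(2) interior_subset[of K] by auto
      qed (use U in auto)
      finally have "(\<Sum>(u, v)\<in>P. v - u) < \<delta>"
        using lU by (meson ennreal_leI le_less_trans not_le order_less_irrefl)
      moreover have "\<forall>(u, v)\<in>P. c \<le> u \<and> u < v \<and> v \<le> d"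
      proof -
        have "c \<le> Inf K \<and> Inf K < Sup K \<and> Sup K \<le> d" if "K \<in> \<D>'" for K
        proof -
          have "{Inf K..Sup K} \<subseteq> {c..d}" unfolding K_eq[OF that] using \<D>(2) \<open>\<D>' \<subseteq> \<D>\<close> that by auto
          then show ?thesis using K[OF that] by (simp add: less_imp_le)
        qed
        then show ?thesis by (auto simp: P_def)
      qed
      moreover have "pairwise (\<lambda>(u, v) (u', v'). {u<..<v} \<inter> {u'<..<v'} = {}) P"
        using disj by (auto simp: P_def pairwise_def disjoint_family_on_def)
      moreover have "finite P" using that by (simp add: P_def)
      ultimately have small: "(\<Sum>(u, v)\<in>P. \<bar>F v - F u\<bar>) < \<epsilon>" by (intro \<delta>)
      have "(\<Sum>(u, v)\<in>P. \<bar>F v - F u\<bar>) = (\<Sum>K\<in>\<D>'. \<bar>F (Sup K) - F (Inf K)\<bar>)"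
        unfolding P_def by (subst sum.reindex[OF inj]) auto
      then have sum: "(\<Sum>K\<in>\<D>'. \<bar>F (Sup K) - F (Inf K)\<bar>) \<le> \<epsilon>" using small by simp
      have "emeasure ?\<nu> (\<Union>\<D>') \<le> (\<Sum>K\<in>\<D>'. emeasure ?\<nu> K)"
      proof -
        have "K \<in> sets borel" if "K \<in> \<D>'" for K
          using K_eq[OF that] by (metis borel_closed closed_atLeastAtMost)
        then show ?thesis
          using emeasure_subadditive_finite[of \<D>' "\<lambda>K. K" ?\<nu>] that(1) by auto
      qed
      also have "(\<Sum>K\<in>\<D>'. emeasure ?\<nu> K) = (\<Sum>K\<in>\<D>'. ennreal \<bar>F (Sup K) - F (Inf K)\<bar>)"
      proof (intro sum.cong refl)
        fix K assume "K \<in> \<D>'"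
        then have le: "Inf K \<le> Sup K" and eq: "{Inf K..Sup K} = K"
          using K[of K] K_eq[of K] by (simp_all only: less_imp_le)
        have "emeasure ?\<nu> K = ennreal (F (Sup K) - F (Inf K))"
          using interval_measure_cbox[OF F le] by (simp only: eq)
        then show "emeasure ?\<nu> K = ennreal \<bar>F (Sup K) - F (Inf K)\<bar>"
          using monoD[OF F(1) le] by simp
      qed
      also have "\<dots> \<le> ennreal \<epsilon>" using sum by (simp add: sum_ennreal ennreal_leI)
      finally show ?thesis .
    qed
    show ?thesis
    proof (cases "\<D> = {}")
      case True
      then show ?thesis using \<D>(6) by simp
    next
      case False
      \<comment> \<open>Absolute continuity speaks of finite families only. Finite unions exhaust
        the countable family, and continuity from below carries the bound over.\<close>
      define A where "A n = (\<Union>i<n. from_nat_into \<D> i)" for n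
      have sets: "K \<in> sets borel" if "K \<in> \<D>" for K using \<D>(3)[OF that] by auto
      have "A n \<in> sets borel" for n unfolding A_def using from_nat_into[OF False] sets by auto
      moreover have "incseq A" by (auto simp: A_def incseq_def intro: less_le_trans)
      ultimately have "emeasure ?\<nu> (\<Union>n. A n) = (SUP n. emeasure ?\<nu> (A n))"
        by (intro SUP_emeasure_incseq[symmetric]) auto
      also have "\<dots> \<le> ennreal \<epsilon>"
      proof (rule SUP_least)
        fix n show "emeasure ?\<nu> (A n) \<le> ennreal \<epsilon>"
          unfolding A_def using from_nat_into[OF False] by (intro fin) auto
      qed
      finally have le: "emeasure ?\<nu> (\<Union>n. A n) \<le> ennreal \<epsilon>" .
      have "N \<subseteq> (\<Union>n. A n)"
      proof
        fix x assume "x \<in> N"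
        then obtain K where "K \<in> \<D>" "x \<in> K" using \<D>(6) by auto
        then obtain i where "from_nat_into \<D> i = K" using from_nat_into_surj[OF \<D>(1)] by blast
        then have "x \<in> A (Suc i)" using \<open>x \<in> K\<close> by (auto simp: A_def)
        then show "x \<in> (\<Union>n. A n)" by blast
      qed
      then have "emeasure ?\<nu> N \<le> emeasure ?\<nu> (\<Union>n. A n)"
        using \<open>\<And>n. A n \<in> sets borel\<close> by (intro emeasure_mono) auto
      also note le
      finally show ?thesis by simp
    qed
  qed
  then have "emeasure ?\<nu> N \<le> 0" by (rule ennreal_le_epsilon)
  then show ?thesis by simp
qed

text \<open>Vitali covering bounds the measure of the exceptional set by \<open>2 / \<kappa>\<close> times the
  \<open>\<sigma>\<close>-mass of an arbitrarily tight open neighbourhood of \<open>A\<close>.\<close>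

lemma negligible_upper_derivative_on_null_set:
  fixes \<sigma> :: "real measure"
  assumes \<sigma>: "sets \<sigma> = sets borel" "emeasure \<sigma> (space \<sigma>) \<noteq> \<infinity>"
    and A: "A \<in> sets borel" "emeasure \<sigma> A = 0" and "0 < \<kappa>"
  shows "negligible {x \<in> A. \<forall>d>0. \<exists>a r. 0 < r \<and> r < d \<and> x \<in> cball a r \<and>
    ennreal (\<kappa> * r) \<le> emeasure \<sigma> (cball a r)}" (is "negligible ?E")
  unfolding negligible_outer_le
proof (intro allI impI)
  fix e :: real assume "0 < e"
  then have "emeasure \<sigma> A < ennreal (\<kappa> * e / 2)"
    using A(2) \<open>0 < \<kappa>\<close> by simp
  then obtain U where U: "open U" "A \<subseteq> U" "emeasure \<sigma> U < ennreal (\<kappa> * e / 2)"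
    unfolding outer_regular[OF \<sigma> A(1)] by (auto simp: INF_less_iff)
  define K where "K = {(a, r). 0 < r \<and> cball a r \<subseteq> U \<and> ennreal (\<kappa> * r) \<le> emeasure \<sigma> (cball a r)}"
  have cover: "\<exists>i. i \<in> K \<and> x \<in> cball (fst i) (snd i) \<and> snd i < d" if x: "x \<in> ?E" and "0 < d" for x d
  proof -
    obtain \<rho> where \<rho>: "0 < \<rho>" "ball x \<rho> \<subseteq> U"
      using x U(1,2) open_contains_ball by blast
    \<comment> \<open>The ball contains \<open>x\<close> without being centred there, so its
      diameter 2r must stay below \<open>\<rho>\<close> to keep it inside \<open>U\<close>; this is
      the origin of \<open>\<rho> / 2\<close>.\<close>
    obtain a r where ar: "0 < r" "r < min d (\<rho> / 2)" "x \<in> cball a r" "ennreal (\<kappa> * r) \<le> emeasure \<sigma> (cball a r)"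
      using x \<open>0 < d\<close> \<open>0 < \<rho>\<close> by (auto dest!: spec[of _ "min d (\<rho> / 2)"])
    have "cball a r \<subseteq> ball x \<rho>"
    proof
      fix y assume "y \<in> cball a r"
      then have "dist x y \<le> r + r" using ar(3) dist_triangle[of x y a] by (simp add: dist_commute)
      then show "y \<in> ball x \<rho>" using ar(2) by simp
    qed
    then have "(a, r) \<in> K" using ar \<rho> by (auto simp: K_def)
    then show ?thesis using ar by (intro exI[of _ "(a, r)"]) auto
  qed
  have pos: "0 < snd i" if "i \<in> K" for i using that by (auto simp: K_def)
  obtain C where C: "countable C" "C \<subseteq> K"
    "pairwise (\<lambda>i j. disjnt (cball (fst i) (snd i)) (cball (fst j) (snd j))) C"
    "negligible (?E - (\<Union>i\<in>C. cball (fst i) (snd i)))"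
    by (rule Vitali_covering_theorem_cballs[of K snd ?E fst, OF pos cover])
  let ?T = "\<Union>i\<in>C. cball (fst i) (snd i)"
  have T: "?T \<in> sets borel" using C(1) by (intro sets.countable_UN') auto
  have disj: "disjoint_family_on (\<lambda>i. cball (fst i) (snd i)) C"
    using C(3) by (auto simp: pairwise_def disjnt_def disjoint_family_on_def)
  have "emeasure lborel ?T = (\<integral>\<^sup>+ i. emeasure lborel (cball (fst i) (snd i)) \<partial>count_space C)"
    using C(1) disj by (intro emeasure_UN_countable) auto
  also have "\<dots> \<le> (\<integral>\<^sup>+ i. ennreal (2 / \<kappa>) * emeasure \<sigma> (cball (fst i) (snd i)) \<partial>count_space C)"
  proof (intro nn_integral_mono)
    fix i assume "i \<in> space (count_space C)"
    then have i: "0 < snd i" "ennreal (\<kappa> * snd i) \<le> emeasure \<sigma> (cball (fst i) (snd i))"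
      using C(2) by (auto simp: K_def)
    have "emeasure lborel (cball (fst i) (snd i)) = ennreal (2 * snd i)"
      using i(1) by (simp add: cball_eq_atLeastAtMost)
    also have "\<dots> = ennreal (2 / \<kappa>) * ennreal (\<kappa> * snd i)"
      using i(1) \<open>0 < \<kappa>\<close> by (simp add: ennreal_mult[symmetric])
    also have "\<dots> \<le> ennreal (2 / \<kappa>) * emeasure \<sigma> (cball (fst i) (snd i))"
      by (intro mult_left_mono i(2)) simp
    finally show "emeasure lborel (cball (fst i) (snd i)) \<le> ennreal (2 / \<kappa>) * emeasure \<sigma> (cball (fst i) (snd i))" .
  qed
  also have "\<dots> = ennreal (2 / \<kappa>) * (\<integral>\<^sup>+ i. emeasure \<sigma> (cball (fst i) (snd i)) \<partial>count_space C)"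
    by (rule nn_integral_cmult) simp
  also have "\<dots> = ennreal (2 / \<kappa>) * emeasure \<sigma> ?T"
    using C(1) disj by (subst emeasure_UN_countable) (auto simp: \<sigma>)
  also have "\<dots> \<le> ennreal (2 / \<kappa>) * ennreal (\<kappa> * e / 2)"
  proof (intro mult_left_mono order_trans[OF emeasure_mono less_imp_le[OF U(3)]])
    show "?T \<subseteq> U" using C(2) by (force simp: K_def)
  qed (use U \<sigma> in auto)
  also have "\<dots> = ennreal e" using \<open>0 < \<kappa>\<close> \<open>0 < e\<close> by (simp add: ennreal_mult[symmetric])
  finally have Te: "emeasure lborel ?T \<le> ennreal e" .
  have null: "?E - ?T \<in> null_sets lebesgue" using C(4) by (simp add: negligible_iff_null_sets)
  show "\<exists>T. ?E \<subseteq> T \<and> T \<in> lmeasurable \<and> measure lebesgue T \<le> e"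
  proof (intro exI conjI)
    have Tl: "?T \<in> sets lebesgue" using T by simp
    have eq: "emeasure lebesgue (?T \<union> (?E - ?T)) = emeasure lborel ?T"
      using emeasure_Un_null_set[OF Tl null] T by (simp add: emeasure_completion)
    show "?E \<subseteq> ?T \<union> (?E - ?T)" by blast
    show "?T \<union> (?E - ?T) \<in> lmeasurable"
    proof (rule fmeasurableI)
      show "?T \<union> (?E - ?T) \<in> sets lebesgue" by (rule sets.Un[OF Tl null_setsD2[OF null]])
      show "emeasure lebesgue (?T \<union> (?E - ?T)) < \<infinity>"
        unfolding eq infinity_ennreal_def by (rule le_less_trans[OF Te ennreal_less_top])
    qed
    show "measure lebesgue (?T \<union> (?E - ?T)) \<le> e"
      unfolding measure_def eq using Te \<open>0 < e\<close> by (intro enn2real_leI) auto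
  qed
qed

lemma le_diff_add_ennreal: "x \<le> (x - y) + (y :: ennreal)"
  by (cases "y \<le> x") (auto simp: diff_add_cancel_ennreal add_increasing)

lemma AE_upper_derivative_on_null_set:
  fixes \<sigma> :: "real measure"
  assumes "sets \<sigma> = sets borel" "emeasure \<sigma> (space \<sigma>) \<noteq> \<infinity>"
    and "A \<in> sets borel" "emeasure \<sigma> A = 0" and "0 < \<kappa>"
  shows "AE x in lebesgue. x \<in> A \<longrightarrow>
    (\<exists>d>0. \<forall>a r. 0 < r \<and> r < d \<and> x \<in> cball a r \<longrightarrow> emeasure \<sigma> (cball a r) < ennreal (\<kappa> * r))"
proof -
  have "AE x in lebesgue. x \<notin> {x \<in> A. \<forall>d>0. \<exists>a r. 0 < r \<and> r < d \<and> x \<in> cball a r \<and>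
    ennreal (\<kappa> * r) \<le> emeasure \<sigma> (cball a r)}"
    by (intro AE_not_in) (use negligible_upper_derivative_on_null_set[OF assms] in \<open>simp add: negligible_iff_null_sets\<close>)
  then show ?thesis by eventually_elim (auto simp: not_le[symmetric])
qed

text \<open>Where \<open>g \<le> \<alpha>\<close>, the excess measure with density \<open>g - \<alpha>\<close> (truncated subtraction) is null, so
  its derivative vanishes there and the difference quotients of \<open>F\<close> are asymptotically at most \<open>\<alpha>\<close>;
  dually from below.\<close>

lemma density_interval_measure_derivative:
  fixes F :: "real \<Rightarrow> real" and g :: "real \<Rightarrow> ennreal"
  assumes F: "mono F" "continuous_on UNIV F"
    and [measurable]: "g \<in> borel_measurable borel" and g: "density lborel g = interval_measure F"
  shows "AE x in lebesgue. g x < \<infinity> \<and> (F has_real_derivative enn2real (g x)) (at x)"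
proof -
  \<comment> \<open>The bounded window makes both measures finite, as outer regularity requires.
    \<open>\<sigma>p\<close> carries the excess of \<open>g\<close> over the level
    \<open>\<alpha>\<close>, \<open>\<sigma>m\<close> the deficit.\<close>
  define \<sigma>p where "\<sigma>p n \<alpha> = density lborel (\<lambda>x. indicator {- real n<..<real n} x * (g x - ennreal \<alpha>))" for n \<alpha>
  define \<sigma>m where "\<sigma>m n \<alpha> = density lborel (\<lambda>x. indicator {- real n<..<real n} x * (ennreal \<alpha> - g x))" for n \<alpha>
  have cont: "continuous (at_right a) F" for a
    using F(2) by (simp add: continuous_on_eq_continuous_within continuous_at_imp_continuous_at_within)
  have nu_cbox: "emeasure (density lborel g) {a..b} = ennreal (F b - F a)" if "a \<le> b" for a b
    unfolding g by (rule interval_measure_cbox[OF F that])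
  have fin: "AE x in lborel. g x \<noteq> \<infinity>"
  proof -
    have "sigma_finite_measure (density lborel g)"
      unfolding g using F(1) cont by (intro sigma_finite_interval_measure) (auto dest: monoD)
    then show ?thesis using sigma_finite_measure.sigma_finite_iff_density_finite[OF sigma_finite_lborel, of g] by simp
  qed
  have 1: "AE x in lebesgue. x \<in> {- real n<..<real n} \<inter> {x. g x \<le> ennreal \<alpha>} \<longrightarrow>
      (\<exists>d>0. \<forall>a r. 0 < r \<and> r < d \<and> x \<in> cball a r \<longrightarrow>
        emeasure (\<sigma>p n \<alpha>) (cball a r) < ennreal (1 / real (Suc k) * r))" for n k \<alpha>
  proof (rule AE_upper_derivative_on_null_set)
    have "emeasure (\<sigma>p n \<alpha>) (space (\<sigma>p n \<alpha>)) = (\<integral>\<^sup>+ x. indicator {- real n<..<real n} x * (g x - ennreal \<alpha>) \<partial>lborel)"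
      unfolding \<sigma>p_def by (subst emeasure_density) auto
    also have "\<dots> \<le> (\<integral>\<^sup>+ x. g x * indicator {- real n..real n} x \<partial>lborel)"
      by (intro nn_integral_mono) (auto split: split_indicator)
    also have "\<dots> = emeasure (density lborel g) {- real n..real n}"
      by (subst emeasure_density) auto
    also have "\<dots> < \<infinity>" by (subst nu_cbox) auto
    finally show "emeasure (\<sigma>p n \<alpha>) (space (\<sigma>p n \<alpha>)) \<noteq> \<infinity>" by simp
    show "emeasure (\<sigma>p n \<alpha>) ({- real n<..<real n} \<inter> {x. g x \<le> ennreal \<alpha>}) = 0"
      unfolding \<sigma>p_def by (subst emeasure_density)
        (auto simp: nn_integral_0_iff_AE diff_eq_0_iff_ennreal intro!: AE_I2 intro: le_less_trans[OF _ ennreal_less_top] split: split_indicator)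
  qed (auto simp: \<sigma>p_def)
  have 2: "AE x in lebesgue. x \<in> {- real n<..<real n} \<inter> {x. ennreal \<alpha> \<le> g x} \<longrightarrow>
      (\<exists>d>0. \<forall>a r. 0 < r \<and> r < d \<and> x \<in> cball a r \<longrightarrow>
        emeasure (\<sigma>m n \<alpha>) (cball a r) < ennreal (1 / real (Suc k) * r))" for n k \<alpha>
  proof (rule AE_upper_derivative_on_null_set)
    have "emeasure (\<sigma>m n \<alpha>) (space (\<sigma>m n \<alpha>)) = (\<integral>\<^sup>+ x. indicator {- real n<..<real n} x * (ennreal \<alpha> - g x) \<partial>lborel)"
      unfolding \<sigma>m_def by (subst emeasure_density) auto
    also have "\<dots> \<le> (\<integral>\<^sup>+ x. ennreal \<alpha> * indicator {- real n..real n} x \<partial>lborel)"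
      by (intro nn_integral_mono) (auto split: split_indicator)
    also have "\<dots> < \<infinity>" by (subst nn_integral_cmult_indicator) (auto simp: ennreal_mult_less_top)
    finally show "emeasure (\<sigma>m n \<alpha>) (space (\<sigma>m n \<alpha>)) \<noteq> \<infinity>" by simp
    show "emeasure (\<sigma>m n \<alpha>) ({- real n<..<real n} \<inter> {x. ennreal \<alpha> \<le> g x}) = 0"
      unfolding \<sigma>m_def by (subst emeasure_density)
        (auto simp: nn_integral_0_iff_AE diff_eq_0_iff_ennreal intro!: AE_I2 intro: le_less_trans[OF _ ennreal_less_top] split: split_indicator)
  qed (auto simp: \<sigma>m_def)
  \<comment> \<open>Rational levels, integer windows and slopes 1/(k+1) form a countable family, so
    a single null set serves for all of them.\<close>
  have "AE x in lebesgue. \<forall>\<alpha>\<in>\<rat>. \<forall>n k. x \<in> {- real n<..<real n} \<inter> {x. g x \<le> ennreal \<alpha>} \<longrightarrow>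
      (\<exists>d>0. \<forall>a r. 0 < r \<and> r < d \<and> x \<in> cball a r \<longrightarrow>
        emeasure (\<sigma>p n \<alpha>) (cball a r) < ennreal (1 / real (Suc k) * r))"
    using 1 by (simp only: AE_ball_countable[OF countable_rat] AE_all_countable) blast
  moreover have "AE x in lebesgue. \<forall>\<alpha>\<in>\<rat>. \<forall>n k. x \<in> {- real n<..<real n} \<inter> {x. ennreal \<alpha> \<le> g x} \<longrightarrow>
      (\<exists>d>0. \<forall>a r. 0 < r \<and> r < d \<and> x \<in> cball a r \<longrightarrow>
        emeasure (\<sigma>m n \<alpha>) (cball a r) < ennreal (1 / real (Suc k) * r))"
    using 2 by (simp only: AE_ball_countable[OF countable_rat] AE_all_countable) blast
  moreover have "AE x in lebesgue. g x \<noteq> \<infinity>" using fin by (rule AE_completion)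
  ultimately show ?thesis
  proof eventually_elim
    case (elim x)
    define \<gamma> where "\<gamma> = enn2real (g x)"
    have \<gamma>: "g x = ennreal \<gamma>" "0 \<le> \<gamma>" using elim(3) by (auto simp: \<gamma>_def less_top)
    have "((\<lambda>y. (F y - F x) / (y - x)) \<longlongrightarrow> \<gamma>) (at x)"
    proof (rule tendstoI)
      fix e :: real assume "0 < e"
      obtain \<alpha> where \<alpha>: "\<alpha> \<in> \<rat>" "\<gamma> < \<alpha>" "\<alpha> < \<gamma> + e / 2"
        using Rats_dense_in_real[of \<gamma> "\<gamma> + e / 2"] \<open>0 < e\<close> by auto
      \<comment> \<open>The lower level has to be non-negative because \<open>ennreal\<close>
        truncates at 0. At \<open>\<gamma>\<close> = 0 it coincides with \<open>\<gamma>\<close>,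
        which is why \<open>\<beta> \<le> \<gamma>\<close> is not strict.\<close>
      have "\<exists>\<beta>\<in>\<rat>. \<gamma> - e / 2 < \<beta> \<and> \<beta> \<le> \<gamma> \<and> 0 \<le> \<beta>"
      proof (cases "\<gamma> = 0")
        case True
        then show ?thesis using \<open>0 < e\<close> by (intro bexI[of _ 0]) auto
      next
        case False
        then have "max 0 (\<gamma> - e / 2) < \<gamma>" using \<gamma>(2) \<open>0 < e\<close> by auto
        from Rats_dense_in_real[OF this] show ?thesis by (auto intro: less_imp_le)
      qed
      then obtain \<beta> where \<beta>: "\<beta> \<in> \<rat>" "\<gamma> - e / 2 < \<beta>" "\<beta> \<le> \<gamma>" "0 \<le> \<beta>" by blast
      obtain n where n: "\<bar>x\<bar> + 1 < real n" using reals_Archimedean2 by blast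
      obtain k where k: "1 / real (Suc k) < e"
        using reals_Archimedean[OF \<open>0 < e\<close>] by (metis inverse_eq_divide)
      have xn: "x \<in> {- real n<..<real n}" using n by auto
      have "g x \<le> ennreal \<alpha>" "ennreal \<beta> \<le> g x" using \<gamma> \<alpha> \<beta> by (auto intro: ennreal_leI)
      with xn elim(1) elim(2) \<alpha>(1) \<beta>(1)
      have "\<exists>d>0. \<forall>a r. 0 < r \<and> r < d \<and> x \<in> cball a r \<longrightarrow>
          emeasure (\<sigma>p n \<alpha>) (cball a r) < ennreal (1 / real (Suc k) * r)"
        "\<exists>d>0. \<forall>a r. 0 < r \<and> r < d \<and> x \<in> cball a r \<longrightarrow>
          emeasure (\<sigma>m n \<beta>) (cball a r) < ennreal (1 / real (Suc k) * r)" by blast+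
      then obtain d1 d2 where "0 < d1" "0 < d2"
        and d1: "\<And>a r. 0 < r \<Longrightarrow> r < d1 \<Longrightarrow> x \<in> cball a r \<Longrightarrow>
          emeasure (\<sigma>p n \<alpha>) (cball a r) < ennreal (1 / real (Suc k) * r)"
        and d2: "\<And>a r. 0 < r \<Longrightarrow> r < d2 \<Longrightarrow> x \<in> cball a r \<Longrightarrow>
          emeasure (\<sigma>m n \<beta>) (cball a r) < ennreal (1 / real (Suc k) * r)" by blast
      define d where "d = min 1 (min d1 d2)"
      have "0 < d" using \<open>0 < d1\<close> \<open>0 < d2\<close> by (simp add: d_def)
      \<comment> \<open>The interval [u,v] is a ball of radius \<open>r\<close> containing
        \<open>x\<close> anywhere, so left and right difference quotients are treated together.
        Excess and deficit on it are below r/(k+1), which is half of 1/(k+1) relative to its length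
        2r. The window contains [u,v] because its length is below 1 and |x| + 1 < n.\<close>
      have key: "\<bar>(F v - F u) / (v - u) - \<gamma>\<bar> < e" if "u < v" "x \<in> {u..v}" "v - u < d" for u v
      proof -
        define r a where "r = (v - u) / 2" and "a = (u + v) / 2"
        have r: "0 < r" "r < d1" "r < d2" "r < 1" using that by (auto simp: r_def d_def)
        have cb: "cball a r = {u..v}" by (auto simp: cball_eq_atLeastAtMost r_def a_def field_simps)
        have sub: "{u..v} \<subseteq> {- real n<..<real n}" using that n by (auto simp: d_def)
        have len: "emeasure lborel {u..v} = ennreal (2 * r)" using that by (simp add: r_def)
        have nu: "(\<integral>\<^sup>+ t\<in>{u..v}. g t \<partial>lborel) = ennreal (F v - F u)"
          using nu_cbox[of u v] that by (simp add: emeasure_density)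
        have *: "1 / real (Suc k) * r + \<alpha> * (2 * r) \<ge> F v - F u"
        proof -
          have "ennreal (F v - F u) \<le> (\<integral>\<^sup>+ t. indicator {- real n<..<real n} t * (g t - ennreal \<alpha>) * indicator {u..v} t
              + ennreal \<alpha> * indicator {u..v} t \<partial>lborel)"
            unfolding nu[symmetric] using sub le_diff_add_ennreal
            by (intro nn_integral_mono) (auto split: split_indicator)
          also have "\<dots> = emeasure (\<sigma>p n \<alpha>) {u..v} + ennreal \<alpha> * ennreal (2 * r)"
            by (simp add: nn_integral_add \<sigma>p_def emeasure_density nn_integral_cmult_indicator len)
          also have "\<dots> \<le> ennreal (1 / real (Suc k) * r) + ennreal \<alpha> * ennreal (2 * r)"
            using d1[of r a] r that by (intro add_right_mono) (simp add: cb less_imp_le)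
          also have "\<dots> = ennreal (1 / real (Suc k) * r + \<alpha> * (2 * r))"
            using r \<alpha> \<gamma> by (simp add: ennreal_mult'[symmetric])
          finally show ?thesis using r \<alpha> \<gamma> by (subst (asm) ennreal_le_iff) auto
        qed
        have **: "\<beta> * (2 * r) \<le> 1 / real (Suc k) * r + (F v - F u)"
        proof -
          have "ennreal (\<beta> * (2 * r)) = (\<integral>\<^sup>+ t. ennreal \<beta> * indicator {u..v} t \<partial>lborel)"
            using r \<beta> by (simp add: nn_integral_cmult_indicator len ennreal_mult')
          also have "\<dots> \<le> (\<integral>\<^sup>+ t. indicator {- real n<..<real n} t * (ennreal \<beta> - g t) * indicator {u..v} t
              + g t * indicator {u..v} t \<partial>lborel)"
            using sub le_diff_add_ennreal
            by (intro nn_integral_mono) (auto split: split_indicator)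
          also have "\<dots> = emeasure (\<sigma>m n \<beta>) {u..v} + ennreal (F v - F u)"
            by (simp add: nn_integral_add \<sigma>m_def emeasure_density nu)
          also have "\<dots> \<le> ennreal (1 / real (Suc k) * r) + ennreal (F v - F u)"
            using d2[of r a] r that by (intro add_right_mono) (simp add: cb less_imp_le)
          also have "\<dots> = ennreal (1 / real (Suc k) * r + (F v - F u))"
            using r monoD[OF F(1), of u v] that by (simp add: ennreal_plus)
          finally show ?thesis using r monoD[OF F(1), of u v] that by (subst (asm) ennreal_le_iff) auto
        qed
        define \<kappa> where "\<kappa> = 1 / real (Suc k)"
        have "v - u = 2 * r" by (simp add: r_def)
        then have q: "(F v - F u) / (v - u) = (F v - F u) / (2 * r)" by simp
        define X where "X = (F v - F u) / (2 * r)"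
        have "X \<le> \<kappa> / 2 + \<alpha>"
          using * r unfolding \<kappa>_def[symmetric] X_def by (simp add: field_simps)
        moreover have "\<beta> \<le> \<kappa> / 2 + X"
          using ** r unfolding \<kappa>_def[symmetric] X_def by (simp add: field_simps)
        ultimately show ?thesis unfolding q X_def[symmetric] using k[folded \<kappa>_def] \<alpha>(2,3) \<beta>(2,3) by linarith
      qed
      show "eventually (\<lambda>y. dist ((F y - F x) / (y - x)) \<gamma> < e) (at x)"
        unfolding eventually_at
      proof (intro exI[of _ d] conjI ballI impI \<open>0 < d\<close>)
        fix y assume y: "y \<noteq> x \<and> dist y x < d"
        show "dist ((F y - F x) / (y - x)) \<gamma> < e"
        proof (cases "x < y")
          case True
          then show ?thesis using key[of x y] y by (auto simp: dist_real_def)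
        next
          case False
          have "(F y - F x) / (y - x) = (F x - F y) / (x - y)"
            using minus_divide_divide[of "F y - F x" "y - x"] by simp
          then show ?thesis using key[of y x] y False by (auto simp: dist_real_def)
        qed
      qed
    qed
    then show ?case
      using \<gamma> by (auto simp: has_field_derivative_iff \<gamma>_def[symmetric])
  qed
qed

text \<open>Absolute continuity holds only on compact subintervals of (0,\<infinity>), without
  uniformity near 0. A null set is therefore exhausted by pieces in such subintervals together with
  [-n,0], which carries no mass because \<open>F\<close> is constant there and continuous at 0.
  Radon-Nikodym then applies, and the density is the derivative almost everywhere.\<close>

lemma abs_cont_mono_FTC:
  fixes F :: "real \<Rightarrow> real"
  assumes F: "mono F" "continuous_on UNIV F" and ac: "locally_abs_cont F"
    and F0: "\<And>x. x \<le> 0 \<Longrightarrow> F x = F 0"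
  obtains g where "g \<in> borel_measurable borel" "density lborel g = interval_measure F"
    "AE x in lebesgue. g x < \<infinity> \<and> (F has_real_derivative enn2real (g x)) (at x)"
proof -
  have "absolutely_continuous lborel (interval_measure F)"
    unfolding absolutely_continuous_def
  proof
    fix N :: "real set" assume N: "N \<in> null_sets lborel"
    \<comment> \<open>The shift by 2 makes the left endpoint strictly smaller than the right one
      already for n = 0.\<close>
    define A where "A n = N \<inter> {1 / real (n + 2)..real (n + 2)}" for n
    have "A n \<in> null_sets (interval_measure F)" for n
    proof -
      have A: "A n \<in> null_sets lborel" unfolding A_def
        using null_set_Int2[OF N, of "{1 / real (n + 2)..real (n + 2)}"] by (simp add: Int_commute)
      have lt: "1 / real (n + 2) < real (n + 2)"
        by (rule less_trans[of _ 1]) auto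
      then have "abs_cont_on_interval (1 / real (n + 2)) (real (n + 2)) F"
        using ac unfolding locally_abs_cont_def by simp
      from abs_cont_interval_measure_null[OF F this lt A] A
      show ?thesis by (auto simp: A_def intro!: null_setsI)
    qed
    moreover define B where "B n = {- real n..0}" for n
    have "B n \<in> null_sets (interval_measure F)" for n
      using interval_measure_cbox[OF F, of "- real n" 0] F0[of "- real n"] by (auto simp: B_def intro!: null_setsI)
    ultimately have "(\<Union>n. A n) \<union> (\<Union>n. B n) \<in> null_sets (interval_measure F)" by auto
    moreover have "N \<subseteq> (\<Union>n. A n) \<union> (\<Union>n. B n)"
    proof
      fix x assume x: "x \<in> N"
      obtain n where n: "\<bar>x\<bar> < real n" using reals_Archimedean2 by blast
      show "x \<in> (\<Union>n. A n) \<union> (\<Union>n. B n)"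
      proof (cases "0 < x")
        case True
        obtain m where m: "1 / real (Suc m) < x"
          using reals_Archimedean[OF True] by (metis inverse_eq_divide)
        have "1 / real (n + m + 2) \<le> 1 / real (Suc m)" by (intro divide_left_mono) auto
        then have "x \<in> A (n + m)" using x n m by (auto simp: A_def)
        then show ?thesis by blast
      next
        case False
        then have "x \<in> B n" using n by (auto simp: B_def)
        then show ?thesis by blast
      qed
    qed
    moreover have "N \<in> sets (interval_measure F)" using N by auto
    ultimately show "N \<in> null_sets (interval_measure F)"
      by (meson null_sets_subset)
  qed
  then obtain g where g: "g \<in> borel_measurable lborel" "density lborel g = interval_measure F"
    using sigma_finite_measure.Radon_Nikodym[OF sigma_finite_lborel, of "interval_measure F"] by auto
  show thesis
    using g density_interval_measure_derivative[OF F _ g(2)] by (intro that[of g]) auto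
qed

section \<open>Slowly varying weights\<close>

text \<open>The function t^(-1/2) b(t) is within a factor \<open>C\<close> of a non-increasing one;
  passing to that function and back costs C^2. The maximum with 1 gives K \<ge> 1, convenient for
  later estimates. Any exponent strictly between 0 and 1 would serve: being below 1 is what makes
  the tail integrals converge.\<close>

lemma slowly_varying_bound:
  assumes "slowly_varying b"
  obtains K where "1 \<le> K" "\<And>t s. 0 < t \<Longrightarrow> t \<le> s \<Longrightarrow> b s \<le> K * (s / t) powr (1 / 2) * b t"
proof -
  have bpos: "0 < b t" if "0 < t" for t using assms that by (auto simp: slowly_varying_def)
  have "\<exists>g h :: real \<Rightarrow> real. mono_on {0<..} g \<and> antimono_on {0<..} h \<and>
        equiv_on {0<..} (\<lambda>t. ennreal (t powr (1/2) * b t)) (\<lambda>t. ennreal (g t)) \<and>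
        equiv_on {0<..} (\<lambda>t. ennreal (t powr (- (1/2)) * b t)) (\<lambda>t. ennreal (h t))"
    by (rule assms[unfolded slowly_varying_def, THEN conjunct2, THEN conjunct2, rule_format]) simp
  then obtain h :: "real \<Rightarrow> real" where h: "antimono_on {0<..} h"
    "equiv_on {0<..} (\<lambda>t. ennreal (t powr (- (1/2)) * b t)) (\<lambda>t. ennreal (h t))" by blast
  obtain C where C: "0 < C" "\<And>t. t \<in> {0<..} \<Longrightarrow> ennreal (h t) \<le> ennreal C * ennreal (t powr (- (1/2)) * b t)"
    "\<And>t. t \<in> {0<..} \<Longrightarrow> ennreal (t powr (- (1/2)) * b t) \<le> ennreal C * ennreal (h t)"
    by (rule equiv_onE[OF h(2)]) (rule that)
  show thesis
  proof (rule that[of "max 1 (C * C)"])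
    fix t s :: real assume ts: "0 < t" "t \<le> s"
    have "ennreal (s powr (- (1/2)) * b s) \<le> ennreal C * ennreal (h s)"
      using ts by (intro C(3)) auto
    also have "\<dots> \<le> ennreal C * ennreal (h t)"
      using ts h(1) by (intro mult_left_mono ennreal_leI monotone_onD[OF h(1)]) auto
    also have "\<dots> \<le> ennreal C * (ennreal C * ennreal (t powr (- (1/2)) * b t))"
      using ts by (intro mult_left_mono C(2)) auto
    also have "\<dots> = ennreal (C * (C * (t powr (- (1/2)) * b t)))"
      using less_imp_le[OF C(1)] less_imp_le[OF bpos[OF ts(1)]] by (simp add: ennreal_mult)
    finally have le: "s powr (- (1/2)) * b s \<le> C * (C * (t powr (- (1/2)) * b t))"
      using C(1) bpos[OF ts(1)] by (subst (asm) ennreal_le_iff) auto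
    have "b s = s powr (1/2) * (s powr (- (1/2)) * b s)"
      using ts by (simp add: powr_minus field_simps)
    also have "\<dots> \<le> s powr (1/2) * (C * (C * (t powr (- (1/2)) * b t)))"
      by (intro mult_left_mono le) simp
    also have "\<dots> = C * C * (s / t) powr (1 / 2) * b t"
      using ts by (simp add: powr_minus powr_divide field_simps)
    also have "\<dots> \<le> max 1 (C * C) * (s / t) powr (1 / 2) * b t"
      using bpos[OF ts(1)] by (intro mult_right_mono) auto
    finally show "b s \<le> max 1 (C * C) * (s / t) powr (1 / 2) * b t" .
  qed simp
qed

section \<open>Change of variables along a primitive\<close>

text \<open>The probability integral transform without normalisation. In the absence of atoms the
  distribution function is continuous and attains every value strictly between 0 and the total mass.
  The set where it is at most \<open>x\<close> is then squeezed between half-lines of mass slightly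
  below and slightly above \<open>x\<close>, so flat pieces need no separate treatment.\<close>

lemma distr_cdf_continuous:
  assumes "finite_borel_measure M" and null: "\<And>x. measure M {x} = 0"
  shows "distr M borel (cdf M) = density lborel (indicator {0<..<measure M UNIV})"
proof -
  interpret finite_borel_measure M by fact
  let ?T = "measure M UNIV"
  note [simp] = M_is_borel borel_UNIV
  have mono: "mono (cdf M)" by (auto simp: mono_def cdf_nondecreasing)
  then have [measurable]: "cdf M \<in> borel_measurable M" "cdf M \<in> borel_measurable borel"
    using borel_measurable_mono[OF mono] by (simp_all add: measurable_cong_sets[OF M_is_borel refl])
  have cont: "continuous_on A (cdf M)" for A
    using null isCont_cdf by (intro continuous_at_imp_continuous_on) auto
  have ex: "\<exists>u. cdf M u = x" if "0 < x" "x < ?T" for x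
  proof -
    have "eventually (\<lambda>u. cdf M u < x) at_bot" "eventually (\<lambda>u. x < cdf M u) at_top"
      using order_tendstoD(2)[OF cdf_lim_at_bot that(1)] order_tendstoD(1)[OF cdf_lim_at_top, of x] that(2) by auto
    then obtain u v where "cdf M u < x" "x < cdf M v"
      using eventually_happens[of _ at_bot] eventually_happens[of _ at_top] by fastforce
    moreover from this have "u \<le> v" using cdf_nondecreasing[of v u] by (cases "u \<le> v") auto
    ultimately show ?thesis using IVT'[of "cdf M" u x v] cont by fastforce
  qed
  have le: "measure M {u. cdf M u \<le> x} = x" if x: "0 \<le> x" "x < ?T" for x
  proof (rule antisym)
    show "measure M {u. cdf M u \<le> x} \<le> x"
    proof (rule dense_ge_bounded[OF x(2)])
      fix y assume y: "x < y" "y < ?T"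
      then obtain u where u: "cdf M u = y" using ex[of y] x by auto
      have "{v. cdf M v \<le> x} \<subseteq> {..u}"
        using u y(1) cdf_nondecreasing by (auto simp: not_le[symmetric]) (meson less_le_not_le linear order_trans)
      then have "measure M {v. cdf M v \<le> x} \<le> measure M {..u}"
        by (intro finite_measure_mono) auto
      then show "measure M {u. cdf M u \<le> x} \<le> y" using u by (simp add: cdf_def)
    qed
    show "x \<le> measure M {u. cdf M u \<le> x}"
    proof (cases "x = 0")
      case False
      then have "0 < x" using that by simp
      then show ?thesis
      proof (rule dense_le_bounded)
        fix y assume y: "0 < y" "y < x"
        then obtain u where u: "cdf M u = y" using ex[of y] x by auto
        have "{..u} \<subseteq> {v. cdf M v \<le> x}"
          using u y(2) cdf_nondecreasing by force
        then have "measure M {..u} \<le> measure M {v. cdf M v \<le> x}"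
          by (intro finite_measure_mono) auto
        then show "y \<le> measure M {u. cdf M u \<le> x}" using u by (simp add: cdf_def)
      qed
    qed simp
  qed
  show ?thesis
  proof (rule measure_eqI_lessThan)
    fix x
    have l: "emeasure (distr M borel (cdf M)) {x<..} = emeasure M {u. x < cdf M u}"
      by (subst emeasure_distr) (auto intro!: arg_cong[of _ _ "emeasure M"])
    have r: "emeasure (density lborel (indicator {0<..<?T})) {x<..} = emeasure lborel ({0<..<?T} \<inter> {x<..})"
      by (simp add: emeasure_density indicator_inter_arith[symmetric])
    show "emeasure (distr M borel (cdf M)) {x<..} < \<infinity>"
      unfolding l by (simp add: emeasure_eq_measure)
    consider "x < 0" | "0 \<le> x" "x < ?T" | "?T \<le> x" "0 \<le> x" by linarith
    then show "emeasure (distr M borel (cdf M)) {x<..} =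
        emeasure (density lborel (indicator {0<..<?T})) {x<..}"
    proof cases
      case 1
      then have "{u. x < cdf M u} = UNIV" using cdf_nonneg by (auto intro: less_le_trans)
      moreover have "{0<..<?T} \<inter> {x<..} = {0<..<?T}" using 1 by auto
      ultimately show ?thesis unfolding l r by (simp add: emeasure_eq_measure)
    next
      case 2
      have "{u. x < cdf M u} = UNIV - {u. cdf M u \<le> x}" by auto
      moreover have "measure M (space M - {u. cdf M u \<le> x}) = measure M (space M) - measure M {u. cdf M u \<le> x}"
        by (intro finite_measure_compl) auto
      ultimately have "measure M {u. x < cdf M u} = ?T - x" using le[OF 2] by simp
      moreover have "{0<..<?T} \<inter> {x<..} = {x<..<?T}" using 2 by auto
      ultimately show ?thesis unfolding l r using 2 by (simp add: emeasure_eq_measure)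
    next
      case 3
      then have "{u. x < cdf M u} = {}" using cdf_bounded by (auto simp: not_less intro: order_trans)
      moreover have "{0<..<?T} \<inter> {x<..} = {}" using 3 by auto
      ultimately show ?thesis unfolding l r by simp
    qed
  qed auto
qed

text \<open>This avoids differentiating \<open>W\<close>: the image under \<open>W\<close> of the measure with density \<open>w\<close> is
  Lebesgue measure.\<close>

lemma nn_integral_primitive_substitution:
  fixes w :: "real \<Rightarrow> ennreal" and \<phi> :: "real \<Rightarrow> ennreal"
  defines "W \<equiv> \<lambda>x. \<integral>\<^sup>+ u\<in>{0<..<x}. w u \<partial>lebesgue"
  assumes w: "(\<lambda>u. w u * indicator {0<..} u) \<in> borel_measurable lebesgue" and "0 < t" and fin: "W t < \<infinity>"
    and [measurable]: "\<phi> \<in> borel_measurable borel"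
  shows "(\<integral>\<^sup>+ u\<in>{0<..<t}. \<phi> (enn2real (W u)) * w u \<partial>lebesgue) =
    (\<integral>\<^sup>+ y\<in>{0<..<enn2real (W t)}. \<phi> y \<partial>lborel)"
proof -
  \<comment> \<open>Cutting off at \<open>t\<close> leaves the total mass W(t), which is
    finite.\<close>
  define w' where "w' u = w u * indicator {0<..<t} u" for u
  have "w' = (\<lambda>u. (w u * indicator {0<..} u) * indicator {0<..<t} u)"
    by (auto simp: w'_def fun_eq_iff split: split_indicator)
  also have "\<dots> \<in> borel_measurable lebesgue"
    by (intro borel_measurable_times_ennreal w borel_measurable_indicator) simp
  finally have [measurable]: "w' \<in> borel_measurable lebesgue" .
  \<comment> \<open>The density is only Lebesgue measurable. Pushing forward along the identity
    restricts the measure to Borel sets, where distribution functions are available.\<close>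
  define M where "M = distr (density lebesgue w') borel (\<lambda>x. x)"
  have id: "(\<lambda>x. x) \<in> lebesgue \<rightarrow>\<^sub>M (borel :: real measure)"
    by (rule measurableI) auto
  have id': "(\<lambda>x. x) \<in> density lebesgue w' \<rightarrow>\<^sub>M (borel :: real measure)"
    using id by (simp add: measurable_cong_sets[OF sets_density refl])
  have emM: "emeasure M A = (\<integral>\<^sup>+ u. w' u * indicator A u \<partial>lebesgue)" if "A \<in> sets borel" for A
    unfolding M_def using that by (subst emeasure_distr[OF id']) (auto simp: emeasure_density)
  have tot: "emeasure M UNIV = W t" by (simp add: emM W_def w'_def)
  have setsM: "sets M = sets borel" by (simp add: M_def)
  interpret M: finite_borel_measure M
  proof (intro finite_borel_measure.intro finite_measureI finite_borel_measure_axioms.intro)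
    show "emeasure M (space M) \<noteq> \<infinity>" using tot fin by (simp add: M_def)
  qed (fact setsM)
  have null: "measure M {x} = 0" for x
  proof -
    have "AE u in lborel. u \<noteq> x" by (rule AE_lborel_singleton)
    then have "AE u in lebesgue. u \<noteq> x" by (rule AE_completion)
    then have "AE u in lebesgue. w' u * indicator {x} u = 0" by eventually_elim simp
    then have "emeasure M {x} = 0" by (simp add: emM nn_integral_0_iff_AE)
    then show ?thesis by (simp add: measure_def)
  qed
  have cdf: "cdf M u = enn2real (W u)" if "0 < u" "u < t" for u
  proof -
    have "AE v in lebesgue. v \<noteq> u" by (rule AE_completion[OF AE_lborel_singleton])
    then have "(\<integral>\<^sup>+ v. w' v * indicator {..u} v \<partial>lebesgue) = W u"
      unfolding W_def
      by (rule_tac nn_integral_cong_AE, eventually_elim)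
        (use that in \<open>auto simp: w'_def split: split_indicator\<close>)
    then show ?thesis by (simp add: cdf_def measure_def emM)
  qed
  have "mono (cdf M)" by (auto simp: mono_def M.cdf_nondecreasing)
  then have cm[measurable]: "cdf M \<in> borel_measurable borel" by (rule borel_measurable_mono)
  have "(\<integral>\<^sup>+ u\<in>{0<..<t}. \<phi> (enn2real (W u)) * w u \<partial>lebesgue) = (\<integral>\<^sup>+ u. w' u * \<phi> (cdf M u) \<partial>lebesgue)"
    by (intro nn_integral_cong) (auto simp: w'_def cdf mult.commute split: split_indicator)
  also have "\<dots> = (\<integral>\<^sup>+ u. \<phi> (cdf M u) \<partial>density lebesgue w')"
    using measurable_compose[OF id, of "\<lambda>u. \<phi> (cdf M u)" borel] by (subst nn_integral_density) auto
  also have "\<dots> = (\<integral>\<^sup>+ u. \<phi> (cdf M u) \<partial>M)"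
  proof -
    have "(\<lambda>u. \<phi> (cdf M u)) \<in> borel_measurable M"
      by (subst measurable_cong_sets[OF setsM refl]) measurable
    then show ?thesis
      using nn_integral_distr[OF id', of "\<lambda>u. \<phi> (cdf M u)"] by (simp add: M_def[symmetric])
  qed
  also have "\<dots> = (\<integral>\<^sup>+ y. \<phi> y \<partial>distr M borel (cdf M))"
  proof -
    have "cdf M \<in> borel_measurable M"
      by (subst measurable_cong_sets[OF setsM refl]) (rule cm)
    then show ?thesis using nn_integral_distr[of "cdf M" M borel \<phi>] by simp
  qed
  also have "\<dots> = (\<integral>\<^sup>+ y\<in>{0<..<measure M UNIV}. \<phi> y \<partial>lborel)"
    unfolding distr_cdf_continuous[OF M.finite_borel_measure_axioms null]
    by (subst nn_integral_density) (auto simp: mult.commute)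
  finally show ?thesis by (simp add: measure_def tot)
qed

lemma nn_integral_powr_from_0:
  assumes "-1 < a" "0 \<le> T"
  shows "(\<integral>\<^sup>+ y\<in>{0<..<T}. ennreal (y powr a) \<partial>lborel) = ennreal (T powr (a + 1) / (a + 1))"
proof -
  have "(\<integral>\<^sup>+ y. indicator {0..T} y * ennreal (y powr a) \<partial>lborel) = ennreal (T powr (a + 1) / (a + 1))"
    using nn_integral_has_integral_lebesgue[OF _ has_integral_powr_from_0[OF assms]]
    by (simp add: ennreal_mult' ennreal_indicator)
  moreover have *: "AE y in lborel. y \<noteq> 0 \<and> y \<noteq> T"
    using AE_lborel_singleton[of 0] AE_lborel_singleton[of T] by eventually_elim simp
  from * have "(\<integral>\<^sup>+ y. indicator {0..T} y * ennreal (y powr a) \<partial>lborel) = (\<integral>\<^sup>+ y\<in>{0<..<T}. ennreal (y powr a) \<partial>lborel)"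
    by (rule_tac nn_integral_cong_AE, eventually_elim) (auto split: split_indicator)
  ultimately show ?thesis by simp
qed

lemma nn_integral_powr_tail:
  assumes "0 < a" "0 < t"
  shows "(\<integral>\<^sup>+ u\<in>{t..}. ennreal (u powr (- a - 1)) \<partial>lborel) = ennreal (t powr (- a) / a)"
proof -
  have "(\<integral>\<^sup>+ u. ennreal (u powr (- a - 1)) * indicator {t..} u \<partial>lborel) = ennreal (0 - (- (t powr (- a) / a)))"
  proof (rule nn_integral_FTC_atLeast)
    fix u assume "t \<le> u"
    then have "0 < u" using assms by simp
    then show "((\<lambda>u. - (u powr (- a) / a)) has_real_derivative u powr (- a - 1)) (at u)"
      using assms by (auto intro!: derivative_eq_intros)
  next
    have "((\<lambda>u. u powr (- a)) \<longlongrightarrow> 0) at_top"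
      using assms by (intro tendsto_neg_powr filterlim_ident) auto
    then have "((\<lambda>u. - (u powr (- a) / a)) \<longlongrightarrow> - (0 / a)) at_top"
      by (intro tendsto_minus tendsto_divide) (use assms in auto)
    then show "((\<lambda>u. - (u powr (- a) / a)) \<longlongrightarrow> 0) at_top" by simp
  qed auto
  then show ?thesis by simp
qed

section \<open>Power integrals of a slowly growing weight\<close>

locale slow_growth =
  fixes b :: "real \<Rightarrow> real" and K :: real
  assumes pos: "\<And>t. 0 < t \<Longrightarrow> 0 < b t"
    and meas: "b \<in> borel_measurable (lebesgue_on {0<..})"
    and K: "1 \<le> K"
    and bound: "\<And>t s. 0 < t \<Longrightarrow> t \<le> s \<Longrightarrow> b s \<le> K * (s / t) powr (1 / 2) * b t"

locale slow_growth_power = slow_growth +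
  fixes r :: real
  assumes r: "0 < r"
    and integrable_at_0: "(\<integral>\<^sup>+ s\<in>{0<..<1}. ennreal (b s powr r / s) \<partial>lebesgue) < \<infinity>"
begin

definition w :: "real \<Rightarrow> ennreal" where "w s = ennreal (b s powr r / s)"

definition B :: "real \<Rightarrow> ennreal" where "B t = (\<integral>\<^sup>+ s\<in>{0<..<t}. w s \<partial>lebesgue)"

lemma w_meas: "(\<lambda>s. w s * indicator {0<..} s) \<in> borel_measurable lebesgue"
proof -
  note [measurable] = meas
  have [measurable]: "(\<lambda>x::real. x) \<in> borel_measurable (lebesgue_on {0<..})"
    using id_borel_measurable_lebesgue_on[of "{0<..}"] by (simp add: id_def)
  have "(\<lambda>s. w s) \<in> borel_measurable (lebesgue_on {0<..})"
    unfolding w_def by measurable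
  then show ?thesis
    by (subst (asm) borel_measurable_restrict_space_iff_ennreal) (auto simp: mult.commute)
qed

lemma w_meas_restrict:
  assumes "A \<in> sets lebesgue" "A \<subseteq> {0<..}"
  shows "(\<lambda>s. w s * indicator A s) \<in> borel_measurable lebesgue"
proof -
  have "(\<lambda>s. w s * indicator A s) = (\<lambda>s. (w s * indicator {0<..} s) * indicator A s)"
    using assms(2) by (auto simp: fun_eq_iff split: split_indicator)
  also have "\<dots> \<in> borel_measurable lebesgue"
    by (intro borel_measurable_times_ennreal w_meas borel_measurable_indicator assms)
  finally show ?thesis .
qed

lemma B_mono: "s \<le> t \<Longrightarrow> B s \<le> B t"
  unfolding B_def by (intro nn_integral_mono) (auto split: split_indicator)

lemma B_split:
  assumes "0 < s" "s \<le> t"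
  shows "B t = B s + (\<integral>\<^sup>+ u\<in>{s..<t}. w u \<partial>lebesgue)"
proof -
  have "B t = (\<integral>\<^sup>+ u. w u * indicator {0<..<s} u + w u * indicator {s..<t} u \<partial>lebesgue)"
    unfolding B_def using assms by (intro nn_integral_cong) (auto split: split_indicator)
  moreover have "(\<lambda>u. w u * indicator {0<..<s} u) \<in> borel_measurable lebesgue"
    "(\<lambda>u. w u * indicator {s..<t} u) \<in> borel_measurable lebesgue"
    using assms by (intro w_meas_restrict; force)+
  ultimately show ?thesis
    unfolding B_def by (simp only: nn_integral_add)
qed

text \<open>Integrability near 0 is the hypothesis on the weight; on [1,t) the growth bound makes
  the integrand bounded.\<close>

lemma B_finite: "B t < \<infinity>"
proof (cases "t \<le> 1")
  case True
  then show ?thesis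
    using B_mono[of t 1] integrable_at_0 unfolding B_def w_def by (auto intro: le_less_trans)
next
  case False
  have "(\<integral>\<^sup>+ u\<in>{1..<t}. w u \<partial>lebesgue) \<le> (\<integral>\<^sup>+ u. ennreal ((K * t powr (1/2) * b 1) powr r) * indicator {1..<t} u \<partial>lebesgue)"
  proof (intro nn_integral_mono)
    fix u
    have "b u powr r / u \<le> (K * t powr (1/2) * b 1) powr r" if "1 \<le> u" "u < t"
    proof -
      have "b u \<le> K * (u / 1) powr (1/2) * b 1" using that by (intro bound) auto
      also have "\<dots> \<le> K * t powr (1/2) * b 1"
        using that pos[of 1] K by (intro mult_right_mono mult_left_mono powr_mono2) auto
      finally have "b u powr r \<le> (K * t powr (1/2) * b 1) powr r"
        using pos[of u] that r by (intro powr_mono2) auto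
      moreover have "b u powr r / u \<le> b u powr r"
        using that divide_left_mono[of 1 u "b u powr r"] by simp
      ultimately show ?thesis by simp
    qed
    then show "w u * indicator {1..<t} u \<le> ennreal ((K * t powr (1/2) * b 1) powr r) * indicator {1..<t} u"
      by (auto simp: w_def intro: ennreal_leI split: split_indicator)
  qed
  also have "\<dots> < \<infinity>"
    using False by (subst nn_integral_cmult_indicator) (auto simp: ennreal_mult_less_top)
  finally have "(\<integral>\<^sup>+ u\<in>{1..<t}. w u \<partial>lebesgue) < \<infinity>" .
  moreover have "B 1 < \<infinity>" using integrable_at_0 by (simp add: B_def w_def)
  ultimately show ?thesis using B_split[of 1 t] False by simp
qed

text \<open>For u in [t/2,t) the growth bound gives b(t) \<le> 2 K b(u), since (t/u)^(1/2) \<le> 2.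
  Integrating (b(t)/(2K))^r / t over this interval of length t/2 yields the remaining factor
  2.\<close>

lemma power_le_B:
  assumes "0 < t"
  shows "ennreal (b t powr r) \<le> ennreal (2 * (2 * K) powr r) * B t"
proof -
  have "ennreal ((b t / (2 * K)) powr r / 2) = (\<integral>\<^sup>+ u\<in>{t/2..<t}. ennreal ((b t / (2 * K)) powr r / t) \<partial>lebesgue)"
    using assms by (subst nn_integral_cmult_indicator) (auto simp: ennreal_mult[symmetric])
  also have "\<dots> \<le> B t"
    unfolding B_def
  proof (intro nn_integral_mono)
    fix u
    have "(b t / (2 * K)) powr r / t \<le> b u powr r / u" if u: "t / 2 \<le> u" "u < t"
    proof -
      have "b t \<le> K * (t / u) powr (1/2) * b u" using that assms by (intro bound) auto
      also have "\<dots> \<le> K * 2 * b u"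
      proof -
        have "(t / u) powr (1/2) \<le> (t / u) powr 1"
          using that assms by (intro powr_mono) auto
        also have "\<dots> \<le> 2" using that assms by (auto simp: field_simps)
        finally show ?thesis using K pos[of u] that assms by (intro mult_right_mono mult_left_mono) auto
      qed
      finally have "b t / (2 * K) \<le> b u" using K by (simp add: field_simps)
      then have "(b t / (2 * K)) powr r \<le> b u powr r"
        using pos[OF assms] K r by (intro powr_mono2) auto
      then show ?thesis using that assms by (intro frac_le) auto
    qed
    then show "ennreal ((b t / (2 * K)) powr r / t) * indicator {t/2..<t} u \<le> w u * indicator {0<..<t} u"
      using assms by (auto simp: w_def intro: ennreal_leI split: split_indicator)
  qed
  finally have le: "ennreal ((b t / (2 * K)) powr r / 2) \<le> B t" .
  have "ennreal (b t powr r) = ennreal (2 * (2 * K) powr r) * ennreal ((b t / (2 * K)) powr r / 2)"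
    using pos[OF assms] K by (simp add: ennreal_mult[symmetric] powr_divide)
  also have "\<dots> \<le> ennreal (2 * (2 * K) powr r) * B t" by (intro mult_left_mono le) simp
  finally show ?thesis .
qed

text \<open>The factor t/u is the value of the maximal rearrangement at \<open>u\<close> for the
  indicator of a set of measure \<open>t\<close>. By the growth bound the integrand is at most K^r
  b(t)^r (t/u)^(r/2) / u, whose integral is K^r (2/r) b(t)^r; then \<open>power_le_B\<close>
  applies.\<close>

lemma tail_le_B:
  assumes "0 < t"
  shows "(\<integral>\<^sup>+ u\<in>{t..}. ennreal ((t / u) powr r) * w u \<partial>lebesgue) \<le>
    ennreal (K powr r * (2 / r) * (2 * (2 * K) powr r)) * B t"
proof -
  have "(\<integral>\<^sup>+ u\<in>{t..}. ennreal ((t / u) powr r) * w u \<partial>lebesgue) \<le>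
      (\<integral>\<^sup>+ u. ennreal (K powr r * b t powr r * t powr (r/2)) * (ennreal (u powr (- (r/2) - 1)) * indicator {t..} u) \<partial>lebesgue)"
  proof (intro nn_integral_mono)
    fix u
    have "(t / u) powr r * (b u powr r / u) \<le> K powr r * b t powr r * t powr (r/2) * u powr (- (r/2) - 1)"
      if "t \<le> u"
    proof -
      have "0 < u" using that assms by simp
      have "b u powr r \<le> (K * (u / t) powr (1/2) * b t) powr r"
        using bound[OF assms that] pos[OF \<open>0 < u\<close>] r by (intro powr_mono2) auto
      also have "\<dots> = K powr r * (u / t) powr (r/2) * b t powr r"
        using K pos[OF assms] by (simp add: powr_mult powr_powr)
      finally have "(t / u) powr r * (b u powr r / u) \<le> (t / u) powr r * (K powr r * (u / t) powr (r/2) * b t powr r / u)"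
        using \<open>0 < u\<close> by (intro mult_left_mono divide_right_mono) auto
      also have "\<dots> = K powr r * b t powr r * ((t / u) powr r * (u / t) powr (r/2) / u)" by simp
      also have "(t / u) powr r * (u / t) powr (r/2) / u = t powr (r/2) * u powr (- (r/2) - 1)"
      proof -
        have "(t / u) powr r = (t / u) powr (r/2) * (t / u) powr (r/2)"
          by (simp add: powr_add[symmetric])
        moreover have "(t / u) powr (r/2) * (u / t) powr (r/2) = 1"
          using \<open>0 < u\<close> assms by (simp add: powr_divide)
        moreover have "u powr (- (r/2) - 1) = u powr (- (r/2)) / u" using \<open>0 < u\<close> by (simp add: powr_diff)
        moreover have "u powr (- (r/2)) = 1 / u powr (r/2)" by (rule powr_minus_divide)
        ultimately show ?thesis using \<open>0 < u\<close> assms by (simp add: powr_divide)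
      qed
      finally show ?thesis by (simp add: mult.assoc)
    qed
    then show "ennreal ((t / u) powr r) * w u * indicator {t..} u \<le>
        ennreal (K powr r * b t powr r * t powr (r/2)) * (ennreal (u powr (- (r/2) - 1)) * indicator {t..} u)"
      using assms by (auto simp: w_def ennreal_mult'[symmetric] intro!: ennreal_leI split: split_indicator)
  qed
  also have "\<dots> = ennreal (K powr r * b t powr r * t powr (r/2)) * (\<integral>\<^sup>+ u. ennreal (u powr (- (r/2) - 1)) * indicator {t..} u \<partial>lborel)"
    by (subst nn_integral_completion) (auto simp: nn_integral_cmult)
  also have "\<dots> = ennreal (K powr r * b t powr r * t powr (r/2)) * ennreal (t powr (- (r/2)) / (r/2))"
    using assms r by (subst nn_integral_powr_tail) auto
  also have "\<dots> = ennreal (K powr r * (2 / r)) * ennreal (b t powr r)"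
    using assms r by (simp add: ennreal_mult[symmetric] powr_minus field_simps)
  also have "\<dots> \<le> ennreal (K powr r * (2 / r)) * (ennreal (2 * (2 * K) powr r) * B t)"
    by (intro mult_left_mono power_le_B[OF assms]) simp
  also have "\<dots> = ennreal (K powr r * (2 / r) * (2 * (2 * K) powr r)) * B t"
    using K r by (subst ennreal_mult[of "K powr r * (2 / r)"]) (simp_all only: mult.assoc, auto)
  finally show ?thesis .
qed

text \<open>After taking r-th roots this is quasi-concavity of the fundamental function up to a
  constant. On [t,s) one has 1 \<le> (s/u)^r = (s/t)^r (t/u)^r, so the increment of \<open>B\<close>
  is at most (s/t)^r times the tail integral.\<close>

lemma B_growth:
  assumes "0 < t" "t \<le> s"
  shows "B s \<le> ennreal ((1 + K powr r * (2 / r) * (2 * (2 * K) powr r)) * (s / t) powr r) * B t"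
proof -
  let ?C = "K powr r * (2 / r) * (2 * (2 * K) powr r)"
  have C: "0 \<le> ?C" using K r by simp
  have st: "1 \<le> (s / t) powr r" using assms r by (intro ge_one_powr_ge_zero) auto
  have "(\<integral>\<^sup>+ u\<in>{t..<s}. w u \<partial>lebesgue) \<le>
      (\<integral>\<^sup>+ u. ennreal ((s / t) powr r) * (ennreal ((t / u) powr r) * w u * indicator {t..} u) \<partial>lebesgue)"
  proof (intro nn_integral_mono)
    fix u
    have "w u \<le> ennreal ((s / t) powr r) * (ennreal ((t / u) powr r) * w u)" if "t \<le> u" "u < s"
    proof -
      have "1 \<le> (s / u) powr r" using that assms r by (intro ge_one_powr_ge_zero) auto
      also have "(s / u) powr r = (s / t) powr r * (t / u) powr r"
        using assms that by (simp add: powr_divide)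
      finally have "1 \<le> ennreal ((s / t) powr r) * ennreal ((t / u) powr r)"
        by (simp add: ennreal_mult[symmetric] ennreal_ge_1)
      then have "1 * w u \<le> (ennreal ((s / t) powr r) * ennreal ((t / u) powr r)) * w u"
        by (rule mult_right_mono) simp
      then show ?thesis by (simp add: mult.assoc)
    qed
    then show "w u * indicator {t..<s} u \<le> ennreal ((s / t) powr r) * (ennreal ((t / u) powr r) * w u * indicator {t..} u)"
      by (auto split: split_indicator)
  qed
  also have "\<dots> = ennreal ((s / t) powr r) * (\<integral>\<^sup>+ u\<in>{t..}. ennreal ((t / u) powr r) * w u \<partial>lebesgue)"
  proof (rule nn_integral_cmult)
    have "(\<lambda>u. ennreal ((t / u) powr r)) \<in> borel_measurable lebesgue"
      by (intro measurable_completion) simp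
    then have "(\<lambda>u. ennreal ((t / u) powr r) * (w u * indicator {t..} u)) \<in> borel_measurable lebesgue"
      using assms by (intro borel_measurable_times_ennreal w_meas_restrict) auto
    then show "(\<lambda>u. ennreal ((t / u) powr r) * w u * indicator {t..} u) \<in> borel_measurable lebesgue"
      by (simp add: mult.assoc)
  qed
  also have "\<dots> \<le> ennreal ((s / t) powr r) * (ennreal ?C * B t)"
    by (intro mult_left_mono tail_le_B assms) simp
  finally have "B s \<le> 1 * B t + ennreal ((s / t) powr r) * (ennreal ?C * B t)"
    unfolding B_split[OF assms] by (simp add: add_left_mono)
  also have "\<dots> \<le> ennreal ((s / t) powr r) * B t + ennreal ((s / t) powr r) * (ennreal ?C * B t)"
    using st by (intro add_right_mono mult_right_mono) (auto simp: ennreal_ge_1)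
  also have "\<dots> = ennreal ((1 + ?C) * (s / t) powr r) * B t"
  proof -
    have "ennreal x * y + ennreal x * (ennreal c * y) = ennreal ((1 + c) * x) * y"
      if "0 \<le> c" "0 \<le> x" for c x :: real and y
      using that by (simp add: ennreal_mult distrib_left distrib_right mult_ac)
    from this[OF C, of "(s / t) powr r"] show ?thesis by simp
  qed
  finally show ?thesis .
qed

text \<open>The fundamental function at real arguments as a real-valued function, which finiteness
  of \<open>B\<close> permits; the concave majorant is built from it.\<close>

definition P :: "real \<Rightarrow> real" where "P t = enn2real (B t) powr (1 / r)"

lemma B_eq: "B t = ennreal (enn2real (B t))"
  using B_finite[of t] by (simp add: less_top)

lemma epowr_B: "epowr (B t) (1 / r) = ennreal (P t)"
  using r by (subst B_eq) (simp add: epowr_ennreal P_def)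

lemma B_pos:
  assumes "0 < t"
  shows "0 < enn2real (B t)"
proof -
  have "0 < b t powr r" using pos[OF assms] by simp
  then have "B t \<noteq> 0" using power_le_B[OF assms] by (auto simp: ennreal_eq_0_iff)
  then show ?thesis using B_finite[of t] by (simp only: enn2real_positive_iff zero_less_iff_neq_zero infinity_ennreal_def) simp
qed

lemma P_pos: "0 < t \<Longrightarrow> 0 < P t" using B_pos[of t] by (simp add: P_def)

lemma P_0: "P 0 = 0" by (simp add: P_def B_def)

lemma P_mono: "mono P"
  unfolding P_def using r B_finite
  by (intro monoI powr_mono2 enn2real_mono B_mono) (auto simp: less_top)

lemma P_growth:
  obtains D where "1 \<le> D" "\<And>t s. 0 < t \<Longrightarrow> t \<le> s \<Longrightarrow> P s \<le> D * (s / t) * P t"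
proof (rule that)
  let ?C = "1 + K powr r * (2 / r) * (2 * (2 * K) powr r)"
  have C: "1 \<le> ?C" using K r by simp
  show "1 \<le> ?C powr (1 / r)" using C r by (intro ge_one_powr_ge_zero) auto
  fix t s :: real assume ts: "0 < t" "t \<le> s"
  have "ennreal (enn2real (B s)) \<le> ennreal (?C * (s / t) powr r) * ennreal (enn2real (B t))"
    using B_growth[OF ts] by (simp only: B_eq[symmetric])
  also have "\<dots> = ennreal (?C * (s / t) powr r * enn2real (B t))"
    using C by (intro ennreal_mult[symmetric]) auto
  finally have "enn2real (B s) \<le> ?C * (s / t) powr r * enn2real (B t)"
    using C by (subst (asm) ennreal_le_iff) auto
  then have "P s \<le> (?C * (s / t) powr r * enn2real (B t)) powr (1 / r)"
    unfolding P_def using r by (intro powr_mono2) auto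
  also have "\<dots> = ?C powr (1 / r) * (s / t) * P t"
    using C r ts by (simp add: P_def powr_mult powr_powr)
  finally show "P s \<le> ?C powr (1 / r) * (s / t) * P t" .
qed

text \<open>Formally the differential of B^(1/r) is (1/r) B^(1/r-1) dB. The substitution y = B(u)
  turns the integral into that of y^(1/r-1), which converges at 0 for every positive
  \<open>r\<close>; the factor \<open>r\<close> comes from the antiderivative.\<close>

lemma nn_integral_density_P:
  assumes "0 < t"
  shows "(\<integral>\<^sup>+ u\<in>{0<..<t}. epowr (B u) (1 / r - 1) * w u \<partial>lebesgue) = ennreal (r * P t)"
proof -
  have "(\<integral>\<^sup>+ u\<in>{0<..<t}. epowr (B u) (1 / r - 1) * w u \<partial>lebesgue) =
      (\<integral>\<^sup>+ u\<in>{0<..<t}. ennreal (enn2real (B u) powr (1 / r - 1)) * w u \<partial>lebesgue)"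
  proof (intro nn_integral_cong)
    fix u
    have "epowr (B u) (1 / r - 1) = ennreal (enn2real (B u) powr (1 / r - 1))" if "0 < u"
      using epowr_ennreal_pos[OF B_pos[OF that]] by (simp only: B_eq[symmetric])
    then show "epowr (B u) (1 / r - 1) * w u * indicator {0<..<t} u =
        ennreal (enn2real (B u) powr (1 / r - 1)) * w u * indicator {0<..<t} u"
      by (auto split: split_indicator)
  qed
  also have "\<dots> = (\<integral>\<^sup>+ y\<in>{0<..<enn2real (B t)}. ennreal (y powr (1 / r - 1)) \<partial>lborel)"
    unfolding B_def using assms B_finite[of t, unfolded B_def]
    by (intro nn_integral_primitive_substitution[where \<phi> = "\<lambda>y. ennreal (y powr (1 / r - 1))"] w_meas) auto
  also have "\<dots> = ennreal (enn2real (B t) powr (1 / r - 1 + 1) / (1 / r - 1 + 1))"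
    using r by (intro nn_integral_powr_from_0) auto
  also have "\<dots> = ennreal (r * P t)" by (simp add: P_def mult.commute)
  finally show ?thesis .
qed

end

section \<open>Concave majorants and endpoint spaces\<close>

text \<open>The majorant is the infimum of all affine majorants with non-negative coefficients, reset to
  \<open>0\<close> at \<open>0\<close>; the growth condition makes \<open>s \<mapsto> P t + D * P t / t * s\<close> one of them.\<close>

lemma concave_majorant:
  fixes P :: "real \<Rightarrow> real"
  assumes mono: "mono_on {0..} P" and P0: "P 0 = 0" and pos: "\<And>t. 0 < t \<Longrightarrow> 0 < P t" and D: "1 \<le> D"
    and growth: "\<And>t s. 0 < t \<Longrightarrow> t \<le> s \<Longrightarrow> P s \<le> D * (s / t) * P t"
  obtains \<psi> where "mono_on {0..} \<psi>" "concave_on {0..} \<psi>" "\<psi> 0 = 0"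
    "\<And>t. 0 \<le> t \<Longrightarrow> P t \<le> \<psi> t" "\<And>t. 0 \<le> t \<Longrightarrow> \<psi> t \<le> (1 + D) * P t"
proof -
  define A where "A = {(a, c). 0 \<le> a \<and> 0 \<le> c \<and> (\<forall>s>0. P s \<le> a + c * s)}"
  define L where "L t = (\<lambda>(a, c). a + c * t) ` A" for t :: real
  define \<psi> where "\<psi> t = (if t = 0 then 0 else Inf (L t))" for t
  have in_A: "(P t, D * P t / t) \<in> A" if "0 < t" for t
    unfolding A_def
  proof (clarsimp, intro conjI allI impI)
    show "0 \<le> P t" "0 \<le> D * P t / t" using pos[OF that] D that by auto
    fix s :: real assume "0 < s"
    show "P s \<le> P t + D * P t * s / t"
    proof (cases "s \<le> t")
      case True
      then have "P s \<le> P t" using \<open>0 < s\<close> by (intro mono_onD[OF mono]) auto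
      moreover have "0 \<le> D * P t * s / t" using pos[OF that] D that \<open>0 < s\<close> by auto
      ultimately show ?thesis by simp
    next
      case False
      then have "P s \<le> D * (s / t) * P t" using that by (intro growth) auto
      then show ?thesis using pos[OF that] by (simp add: mult_ac)
    qed
  qed
  have ne: "L t \<noteq> {}" for t using in_A[of 1] by (auto simp: L_def)
  have bdd: "bdd_below (L t)" if "0 \<le> t" for t
    by (rule bdd_belowI[of _ 0]) (auto simp: L_def A_def that)
  have lower: "P t \<le> \<psi> t" if "0 \<le> t" for t
  proof (cases "t = 0")
    case False
    then have "P t \<le> Inf (L t)" using that ne by (intro cInf_greatest) (auto simp: L_def A_def)
    then show ?thesis using False by (simp add: \<psi>_def)
  qed (simp add: \<psi>_def P0)
  have le: "\<psi> t \<le> a + c * t" if "0 \<le> t" "(a, c) \<in> A" for t a c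
  proof (cases "t = 0")
    case False
    have "a + c * t \<in> L t" using that(2) by (force simp: L_def)
    then have "Inf (L t) \<le> a + c * t" using that(1) bdd by (intro cInf_lower)
    then show ?thesis using False by (simp add: \<psi>_def)
  qed (use that in \<open>simp add: \<psi>_def A_def\<close>)
  have ge: "x \<le> \<psi> t" if "0 < t" "\<And>a c. (a, c) \<in> A \<Longrightarrow> x \<le> a + c * t" for t x
  proof -
    have "x \<le> Inf (L t)" using that(2) ne by (intro cInf_greatest) (auto simp: L_def)
    then show ?thesis using that(1) by (simp add: \<psi>_def)
  qed
  show thesis
  proof (rule that[of \<psi>])
    show "mono_on {0..} \<psi>"
    proof (rule mono_onI)
      fix s t :: real assume st: "s \<in> {0..}" "t \<in> {0..}" "s \<le> t"
      show "\<psi> s \<le> \<psi> t"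
      proof (cases "t = 0")
        case False
        show ?thesis
        proof (rule ge)
          fix a c assume ac: "(a, c) \<in> A"
          have "\<psi> s \<le> a + c * s" using st ac by (intro le) auto
          also have "\<dots> \<le> a + c * t" using st ac by (auto simp: A_def intro: mult_left_mono)
          finally show "\<psi> s \<le> a + c * t" .
        qed (use st False in auto)
      qed (use st in auto)
    qed
    show "concave_on {0..} \<psi>"
      unfolding concave_on_iff
    proof (intro conjI ballI allI impI)
      fix x y u v :: real assume xy: "x \<in> {0..}" "y \<in> {0..}" and uv: "0 \<le> u" "0 \<le> v" "u + v = 1"
      show "u * \<psi> x + v * \<psi> y \<le> \<psi> (u *\<^sub>R x + v *\<^sub>R y)"
      \<comment> \<open>Lowering a concave function at the endpoint of its domain keeps it concave:
        a combination equals 0 only if every point of positive weight is 0, and then both sides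
        vanish.\<close>
      proof (cases "u * x + v * y = 0")
        case True
        then have "u * x = 0" "v * y = 0" using xy uv by (auto simp: add_nonneg_eq_0_iff)
        then show ?thesis using True by (auto simp: \<psi>_def)
      next
        case False
        show ?thesis
        proof (rule ge)
          show "0 < u *\<^sub>R x + v *\<^sub>R y" using False xy uv by (auto simp: less_le)
          fix a c assume ac: "(a, c) \<in> A"
          have "u * \<psi> x + v * \<psi> y \<le> u * (a + c * x) + v * (a + c * y)"
            using xy uv ac by (intro add_mono mult_left_mono le) auto
          also have "\<dots> = (u + v) * a + c * (u * x + v * y)" by (simp add: algebra_simps)
          finally show "u * \<psi> x + v * \<psi> y \<le> a + c * (u *\<^sub>R x + v *\<^sub>R y)" using uv by simp
        qed
      qed
    qed simp
    show "\<psi> 0 = 0" by (simp add: \<psi>_def)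
    fix t :: real assume t: "0 \<le> t"
    show "P t \<le> \<psi> t" by (rule lower[OF t])
    show "\<psi> t \<le> (1 + D) * P t"
    proof (cases "t = 0")
      case False
      then show ?thesis using le[OF t in_A[of t]] t by (simp add: algebra_simps)
    qed (simp add: \<psi>_def P0)
  qed
qed

lemma concave_scale:
  fixes \<psi> :: "real \<Rightarrow> real"
  assumes "concave_on {0..} \<psi>" "\<psi> 0 = 0" "0 \<le> s" "s \<le> t" "0 < t"
  shows "s / t * \<psi> t \<le> \<psi> s"
  using concave_onD[OF assms(1), of "s / t" 0 t] assms by simp

lemma concave_imp_quasi_concave:
  assumes "mono_on {0..} \<psi>" "concave_on {0..} \<psi>" "\<psi> 0 = 0" "\<And>t. 0 < t \<Longrightarrow> 0 < \<psi> t"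
  shows "quasi_concave \<psi>"
  unfolding quasi_concave_def
proof (intro conjI allI impI)
  fix t :: real assume "0 \<le> t"
  then show "0 \<le> \<psi> t" "\<psi> t = 0 \<longleftrightarrow> t = 0"
    using assms(3) assms(4)[of t] by (cases "t = 0"; force)+
next
  show "mono_on {0<..} (\<lambda>t. t / \<psi> t)"
  proof (rule mono_onI)
    fix s t :: real assume st: "s \<in> {0<..}" "t \<in> {0<..}" "s \<le> t"
    have "s / t * \<psi> t \<le> \<psi> s" using st assms by (intro concave_scale) auto
    then show "s / \<psi> s \<le> t / \<psi> t" using st assms(4)[of s] assms(4)[of t] by (simp add: field_simps)
  qed
qed (fact assms(1))

text \<open>The concave majorant is itself quasi-concave, so one function witnesses both
  claims.\<close>

lemma quasi_concave_and_concave_choice: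
  assumes \<phi>: "\<And>t. 0 \<le> t \<Longrightarrow> \<phi> (ennreal t) = ennreal (P t)"
    and mono: "mono_on {0..} P" and P0: "P 0 = 0" and pos: "\<And>t. 0 < t \<Longrightarrow> 0 < P t" and D: "1 \<le> D"
    and growth: "\<And>t s. 0 < t \<Longrightarrow> t \<le> s \<Longrightarrow> P s \<le> D * (s / t) * P t"
  shows "equiv_quasi_concave \<phi> \<and> (\<exists>\<psi>. concave_choice \<phi> \<psi>)"
proof -
  obtain \<psi> where \<psi>: "mono_on {0..} \<psi>" "concave_on {0..} \<psi>" "\<psi> 0 = 0"
    "\<And>t. 0 \<le> t \<Longrightarrow> P t \<le> \<psi> t" "\<And>t. 0 \<le> t \<Longrightarrow> \<psi> t \<le> (1 + D) * P t"
    using concave_majorant[OF mono P0 pos D growth] by metis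
  have nn: "0 \<le> P t" if "0 \<le> t" for t using pos[of t] P0 that by (cases "t = 0") auto
  have eq: "equiv_on {0..} (\<lambda>t. \<phi> (ennreal t)) (\<lambda>t. ennreal (\<psi> t))"
  proof (rule equiv_onI[of "1 + D" 1])
    fix t :: real assume "t \<in> {0..}"
    then have t: "0 \<le> t" by simp
    show "ennreal (\<psi> t) \<le> ennreal (1 + D) * \<phi> (ennreal t)"
      using \<phi>[OF t] \<psi>(5)[OF t] D nn[OF t] by (simp add: ennreal_mult[symmetric] ennreal_leI del: ennreal_plus)
    show "\<phi> (ennreal t) \<le> ennreal 1 * ennreal (\<psi> t)"
      using \<phi>[OF t] \<psi>(4)[OF t] by (simp add: ennreal_leI)
  qed (use D in auto)
  have "quasi_concave \<psi>"
    using \<psi> pos by (intro concave_imp_quasi_concave) (auto intro: less_le_trans less_imp_le)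
  then show ?thesis
    using eq \<psi> unfolding equiv_quasi_concave_def concave_choice_def by blast
qed

lemma max_rearr_measurable: "max_rearr R f \<in> borel_measurable borel"
proof -
  have "mono (\<lambda>t. \<integral>\<^sup>+ s\<in>{0<..<t}. rearr R f s \<partial>lebesgue)"
    by (intro monoI nn_integral_mono) (auto split: split_indicator)
  then have [measurable]: "(\<lambda>t. \<integral>\<^sup>+ s\<in>{0<..<t}. rearr R f s \<partial>lebesgue) \<in> borel_measurable borel"
    by (rule mono_ennreal_measurable)
  show ?thesis unfolding max_rearr_def[abs_def] by measurable
qed

text \<open>The product of \<open>t\<close> and \<open>max_rearr R f t\<close> is an integral over
  (0,t), hence non-decreasing. So averages cannot drop faster than 1/t.\<close>

lemma max_rearr_scale:
  assumes "0 < t" "t \<le> s"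
  shows "max_rearr R f t \<le> ennreal (s / t) * max_rearr R f s"
proof -
  let ?I = "\<lambda>t. \<integral>\<^sup>+ s\<in>{0<..<t}. rearr R f s \<partial>lebesgue"
  have I: "?I t \<le> ?I s" using assms by (intro nn_integral_mono) (auto split: split_indicator)
  have inv: "inverse (ennreal t) = ennreal (s / t) * inverse (ennreal s)"
    using assms by (simp add: inverse_ennreal ennreal_mult[symmetric] field_simps)
  have "max_rearr R f t = ?I t * inverse (ennreal t)"
    by (simp add: max_rearr_def divide_ennreal_def)
  also have "\<dots> \<le> ?I s * inverse (ennreal t)" by (intro mult_right_mono I) simp
  also have "\<dots> = ennreal (s / t) * max_rearr R f s"
    by (simp add: max_rearr_def divide_ennreal_def inv mult_ac)
  finally show ?thesis .
qed

lemma same_space_Marcinkiewicz: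
  assumes "equiv_on {0..} (\<lambda>t. ennreal (\<psi> t)) (\<lambda>t. ennreal (\<psi>' t))"
  shows "same_space R (Marcinkiewicz R \<psi>) (Marcinkiewicz R \<psi>')"
proof -
  obtain C where C: "0 < C" "\<And>t. t \<in> {0..} \<Longrightarrow> ennreal (\<psi>' t) \<le> ennreal C * ennreal (\<psi> t)"
    "\<And>t. t \<in> {0..} \<Longrightarrow> ennreal (\<psi> t) \<le> ennreal C * ennreal (\<psi>' t)"
    by (rule equiv_onE[OF assms]) (rule that)
  have *: "Marcinkiewicz R \<beta> f \<le> ennreal C * Marcinkiewicz R \<alpha> f"
    if "\<And>t. t \<in> {0..} \<Longrightarrow> ennreal (\<beta> t) \<le> ennreal C * ennreal (\<alpha> t)" for \<alpha> \<beta> :: "real \<Rightarrow> real" and f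
    unfolding Marcinkiewicz_def
  proof (rule SUP_least)
    fix t :: real assume t: "t \<in> {0<..}"
    have "ennreal (\<beta> t) * max_rearr R f t \<le> (ennreal C * ennreal (\<alpha> t)) * max_rearr R f t"
      using t by (intro mult_right_mono that) auto
    also have "\<dots> = ennreal C * (ennreal (\<alpha> t) * max_rearr R f t)" by (simp add: mult.assoc)
    also have "\<dots> \<le> ennreal C * (SUP t\<in>{0<..}. ennreal (\<alpha> t) * max_rearr R f t)"
      using t by (intro mult_left_mono SUP_upper) auto
    finally show "ennreal (\<beta> t) * max_rearr R f t \<le> ennreal C * (SUP t\<in>{0<..}. ennreal (\<alpha> t) * max_rearr R f t)" .
  qed
  show ?thesis by (rule same_spaceI[OF C(1) C(1)]) (rule *, rule C, assumption)+
qed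

text \<open>The essential supremum ignores null sets, whereas the Marcinkiewicz norm sees every
  \<open>t\<close>. The essential bound holds at some \<open>s\<close> in (t,2t), a set of positive
  measure. From \<open>t\<close> to \<open>s\<close> the function \<open>\<psi>\<close> does not
  decrease and \<open>max_rearr\<close> loses at most half its value, whence the factor 2.\<close>

lemma same_space_Marcinkiewicz_LK_max:
  assumes \<psi>: "concave_choice \<phi> \<psi>" and mono: "mono (\<lambda>t. \<phi> (ennreal t))"
  shows "same_space R (Marcinkiewicz R \<psi>) (LK_max R \<infinity> \<infinity> (\<lambda>t. \<phi> (ennreal t)))"
proof -
  have "equiv_on {0..} (\<lambda>t. \<phi> (ennreal t)) (\<lambda>t. ennreal (\<psi> t))"
    using \<psi> by (simp add: concave_choice_def)
  then obtain C where C: "0 < C" "\<And>t. t \<in> {0..} \<Longrightarrow> ennreal (\<psi> t) \<le> ennreal C * \<phi> (ennreal t)"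
    "\<And>t. t \<in> {0..} \<Longrightarrow> \<phi> (ennreal t) \<le> ennreal C * ennreal (\<psi> t)"
    by (rule equiv_onE) (rule that)
  from mono have [measurable]: "(\<lambda>t. \<phi> (ennreal t)) \<in> borel_measurable borel"
    by (rule mono_ennreal_measurable)
  note [measurable] = max_rearr_measurable
  have LK: "LK_max R \<infinity> \<infinity> (\<lambda>t. \<phi> (ennreal t)) f =
      esssup (lebesgue_on {0<..}) (\<lambda>t. ennreal (t powr 0) * \<phi> (ennreal t) * max_rearr R f t)" for f
    by (simp add: LK_max_def Lq_norm_def)
  have meas: "(\<lambda>t. ennreal (t powr 0) * \<phi> (ennreal t) * max_rearr R f t) \<in> borel_measurable (lebesgue_on {0<..})" for f
    by (intro measurable_restrict_space1 measurable_completion) measurable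
  show ?thesis
  proof (rule same_spaceI[of C "2 * C"])
    fix f
    have "\<phi> (ennreal t) * max_rearr R f t \<le> ennreal C * Marcinkiewicz R \<psi> f" if "0 < t" for t
    proof -
      have "\<phi> (ennreal t) * max_rearr R f t \<le> (ennreal C * ennreal (\<psi> t)) * max_rearr R f t"
        using that by (intro mult_right_mono C) auto
      also have "\<dots> = ennreal C * (ennreal (\<psi> t) * max_rearr R f t)" by (simp add: mult.assoc)
      also have "\<dots> \<le> ennreal C * Marcinkiewicz R \<psi> f"
        unfolding Marcinkiewicz_def using that by (intro mult_left_mono SUP_upper) auto
      finally show ?thesis .
    qed
    then show "LK_max R \<infinity> \<infinity> (\<lambda>t. \<phi> (ennreal t)) f \<le> ennreal C * Marcinkiewicz R \<psi> f"
      unfolding LK by (intro esssup_I meas AE_I2) auto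
    show "Marcinkiewicz R \<psi> f \<le> ennreal (2 * C) * LK_max R \<infinity> \<infinity> (\<lambda>t. \<phi> (ennreal t)) f"
      unfolding Marcinkiewicz_def
    proof (rule SUP_least)
      fix t :: real assume "t \<in> {0<..}"
      then have t: "0 < t" by simp
      let ?N = "LK_max R \<infinity> \<infinity> (\<lambda>t. \<phi> (ennreal t)) f"
      have "AE s in lebesgue_on {0<..}. ennreal (s powr 0) * \<phi> (ennreal s) * max_rearr R f s \<le> ?N"
        unfolding LK by (rule esssup_AE)
      then have ae: "AE s in lebesgue. s \<in> {0<..} \<longrightarrow> \<phi> (ennreal s) * max_rearr R f s \<le> ?N"
        by (subst (asm) AE_restrict_space_iff) auto
      have not_ae: "\<not> (AE s in lebesgue. s \<notin> {t<..<2*t})"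
      proof
        assume "AE s in lebesgue. s \<notin> {t<..<2*t}"
        then have "emeasure lebesgue {t<..<2*t} = 0"
          by (subst (asm) AE_iff_measurable[where N = "{t<..<2*t}"]) auto
        then show False using t by simp
      qed
      have "\<exists>s\<in>{t<..<2*t}. \<phi> (ennreal s) * max_rearr R f s \<le> ?N"
      proof (rule ccontr)
        assume *: "\<not> ?thesis"
        from ae have "AE s in lebesgue. s \<notin> {t<..<2*t}"
          by eventually_elim (use * t in force)
        with not_ae show False ..
      qed
      then obtain s where s: "s \<in> {t<..<2*t}" "\<phi> (ennreal s) * max_rearr R f s \<le> ?N"
        by blast
      have "ennreal (\<psi> t) * max_rearr R f t \<le> (ennreal C * \<phi> (ennreal s)) * (ennreal 2 * max_rearr R f s)"
      proof (intro mult_mono)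
        have "ennreal (\<psi> t) \<le> ennreal (\<psi> s)"
          using \<psi> s t by (intro ennreal_leI mono_onD[of "{0..}" \<psi>]) (auto simp: concave_choice_def)
        also have "\<dots> \<le> ennreal C * \<phi> (ennreal s)" using s t by (intro C) auto
        finally show "ennreal (\<psi> t) \<le> ennreal C * \<phi> (ennreal s)" .
        have "max_rearr R f t \<le> ennreal (s / t) * max_rearr R f s"
          using s t by (intro max_rearr_scale) auto
        also have "\<dots> \<le> ennreal 2 * max_rearr R f s"
          using s t by (intro mult_right_mono ennreal_leI) (auto simp: field_simps)
        finally show "max_rearr R f t \<le> ennreal 2 * max_rearr R f s" .
      qed auto
      also have "\<dots> = ennreal (2 * C) * (\<phi> (ennreal s) * max_rearr R f s)"
        using C(1) by (simp add: ennreal_mult mult_ac)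
      also have "\<dots> \<le> ennreal (2 * C) * ?N" by (intro mult_left_mono s) simp
      finally show "ennreal (\<psi> t) * max_rearr R f t \<le> ennreal (2 * C) * ?N" .
    qed
  qed (use C in auto)
qed

lemma sigma_finite_lebesgue: "sigma_finite_measure (lebesgue :: real measure)"
proof
  show "\<exists>A::real set set. countable A \<and> A \<subseteq> sets lebesgue \<and> \<Union>A = space lebesgue \<and> (\<forall>a\<in>A. emeasure lebesgue a \<noteq> \<infinity>)"
  proof (intro exI[of _ "range (\<lambda>n. {- real n..real n})"] conjI)
    have "\<exists>n. x \<in> {- real n..real n}" for x :: real
    proof -
      obtain n where "\<bar>x\<bar> \<le> real n" using real_arch_simple by blast
      then show ?thesis by (intro exI[of _ n]) auto
    qed
    then show "\<Union>(range (\<lambda>n. {- real n..real n})) = space lebesgue" by auto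
  qed auto
qed

section \<open>Stieltjes measures of concave functions\<close>

context
  fixes \<psi> :: "real \<Rightarrow> real" and G :: "real \<Rightarrow> real"
  assumes mono: "mono_on {0..} \<psi>" and concave: "concave_on {0..} \<psi>" and zero: "\<psi> 0 = 0"
  defines "G \<equiv> \<lambda>t. if t < 0 then 0 else Lim (at_right t) \<psi>"
begin

lemma psi_nonneg: "0 \<le> t \<Longrightarrow> 0 \<le> \<psi> t"
  using mono_onD[OF mono, of 0 t] zero by simp

lemma psi_right_limit:
  assumes "0 \<le> t"
  shows "(\<psi> \<longlongrightarrow> G t) (at_right t)" "0 \<le> G t" "t < s \<Longrightarrow> G t \<le> \<psi> s"
proof -
  have "(\<psi> \<longlongrightarrow> Inf (\<psi> ` ({t<..} \<inter> UNIV))) (at t within ({t<..} \<inter> UNIV))"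
  proof (rule Lim_right_bound)
    fix x y :: real assume "t < x" "x \<le> y"
    then show "\<psi> x \<le> \<psi> y" using assms by (intro mono_onD[OF mono]) auto
  next
    fix x :: real assume "t < x"
    then show "0 \<le> \<psi> x" using assms by (intro psi_nonneg) auto
  qed
  then have L: "(\<psi> \<longlongrightarrow> Inf (\<psi> ` {t<..})) (at_right t)" by simp
  have "Lim (at_right t) \<psi> = Inf (\<psi> ` {t<..})" by (rule tendsto_Lim[OF _ L]) simp
  then have G: "G t = Inf (\<psi> ` {t<..})" using assms by (simp add: G_def)
  have nn: "0 \<le> x" if "x \<in> \<psi> ` {t<..}" for x
    using that assms psi_nonneg by force
  show "(\<psi> \<longlongrightarrow> G t) (at_right t)" unfolding G by (rule L)
  show "0 \<le> G t" unfolding G by (rule cInf_greatest[OF _ nn]) auto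
  show "G t \<le> \<psi> s" if "t < s"
  proof -
    have "\<psi> s \<in> \<psi> ` {t<..}" using that by auto
    then show ?thesis unfolding G by (rule cInf_lower[OF _ bdd_belowI[OF nn]])
  qed
qed

text \<open>A concave function is continuous in the interior of its domain, so right limits
  reproduce it there.\<close>

lemma stieltjes_distribution_eq:
  assumes "0 < t"
  shows "G t = \<psi> t"
proof -
  have "concave_on {0<..} \<psi>"
    using concave unfolding concave_on_def by (rule convex_on_subset) auto
  then have "continuous_on {0<..} (\<lambda>t. - \<psi> t)"
    unfolding concave_on_def by (rule convex_on_continuous[rotated]) simp
  then have "continuous_on {0<..} (\<lambda>t. - (- \<psi> t))" by (rule continuous_on_minus)
  then have "isCont \<psi> t" using assms by (simp add: continuous_on_eq_continuous_at)
  then have "(\<psi> \<longlongrightarrow> \<psi> t) (at_right t)"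
    by (auto simp: isCont_def intro: filterlim_at_split[THEN iffD1, THEN conjunct2])
  then show ?thesis
    using psi_right_limit(1)[of t] assms by (intro tendsto_unique[of "at_right t" \<psi>]) auto
qed

lemma stieltjes_distribution_mono: "x \<le> y \<Longrightarrow> G x \<le> G y"
proof -
  assume "x \<le> y"
  consider "x < 0" "y < 0" | "x < 0" "0 \<le> y" | "x = y" | "0 \<le> x" "x < y" using \<open>x \<le> y\<close> by linarith
  then show ?thesis
  proof cases
    case 2
    then show ?thesis using psi_right_limit(2)[of y] by (simp add: G_def)
  next
    case 4
    then show ?thesis using psi_right_limit(3)[of x y] stieltjes_distribution_eq[of y] by simp
  qed (simp_all add: G_def)
qed

lemma stieltjes_distribution_right_cont: "continuous (at_right a) G"
proof (cases "a < 0")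
  case True
  have "eventually (\<lambda>x. G a = G x) (at_right a)"
    using eventually_at_right_real[OF True] by eventually_elim (use True in \<open>simp add: G_def\<close>)
  then show ?thesis unfolding continuous_within by (rule tendsto_eventually[OF eventually_mono]) simp
next
  case False
  have "eventually (\<lambda>x. \<psi> x = G x) (at_right a)"
    using eventually_at_right_less[of a] by eventually_elim (use False stieltjes_distribution_eq in auto)
  with psi_right_limit(1)[of a] False show ?thesis
    unfolding continuous_within by (auto intro: Lim_transform_eventually)
qed

lemma emeasure_stieltjes_Ioc: "x \<le> y \<Longrightarrow> emeasure (stieltjes \<psi>) {x<..y} = ennreal (G y - G x)"
  unfolding stieltjes_def G_def[symmetric]
  by (rule emeasure_interval_measure_Ioc[OF _ stieltjes_distribution_mono stieltjes_distribution_right_cont])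

lemma sigma_finite_stieltjes: "sigma_finite_measure (stieltjes \<psi>)"
  unfolding stieltjes_def G_def[symmetric]
  by (rule sigma_finite_interval_measure[OF stieltjes_distribution_mono stieltjes_distribution_right_cont])

lemma sets_stieltjes: "sets (stieltjes \<psi>) = sets borel"
  by (simp add: stieltjes_def)

text \<open>The intervals (-1,y] whose mass is explicit include a piece of the negative axis, which
  has to be stripped off. It is exhausted from inside by (-1,-1/(n+1)], away from the possible atom
  at 0.\<close>

lemma stieltjes_negative: "emeasure (stieltjes \<psi>) {-1<..<0} = 0"
proof -
  have "{-1<..<0::real} \<subseteq> (\<Union>n. {-1<..- (1 / real (Suc n))})"
  proof
    fix x :: real assume x: "x \<in> {-1<..<0}"
    then obtain n where "1 / real (Suc n) < - x"
      using reals_Archimedean[of "- x"] by (auto simp: inverse_eq_divide)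
    then show "x \<in> (\<Union>n. {-1<..- (1 / real (Suc n))})" using x by (auto intro!: exI[of _ n])
  qed
  moreover have "{-1<..- (1 / real (Suc n))} \<in> null_sets (stieltjes \<psi>)" for n
    using emeasure_stieltjes_Ioc[of "-1" "- (1 / real (Suc n))"]
    by (intro null_setsI) (auto simp: sets_stieltjes G_def)
  then have "(\<Union>n. {-1<..- (1 / real (Suc n))}) \<in> null_sets (stieltjes \<psi>)" by auto
  ultimately have "{-1<..<0} \<in> null_sets (stieltjes \<psi>)"
    by (elim null_sets_subset) (auto simp: sets_stieltjes)
  then show ?thesis by auto
qed

text \<open>Profiles need the mass of [0,x), while explicit masses belong to intervals closed on the
  right. Up to the massless negative part, [0,x) lies between (-1,x/2] and (-1,x]. Concavity gives
  \<psi>(x) \<le> 2 \<psi>(x/2), which replaces a discussion of left limits.\<close>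

lemma stieltjes_Ico_bounds:
  assumes "0 < x"
  shows "emeasure (stieltjes \<psi>) {0..<x} \<le> ennreal (\<psi> x)"
    and "ennreal (\<psi> x) \<le> ennreal 2 * emeasure (stieltjes \<psi>) {0..<x}"
proof -
  have Ioc: "emeasure (stieltjes \<psi>) {-1<..y} = ennreal (\<psi> y)" if "0 < y" for y
    using emeasure_stieltjes_Ioc[of "-1" y] stieltjes_distribution_eq[OF that] that by (simp add: G_def)
  have "emeasure (stieltjes \<psi>) {0..<x} \<le> emeasure (stieltjes \<psi>) {-1<..x}"
    by (intro emeasure_mono) (auto simp: sets_stieltjes)
  then show "emeasure (stieltjes \<psi>) {0..<x} \<le> ennreal (\<psi> x)" using Ioc[OF assms] by simp
  have "ennreal (\<psi> (x / 2)) = emeasure (stieltjes \<psi>) {-1<..x/2}" using Ioc[of "x/2"] assms by simp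
  also have "\<dots> \<le> emeasure (stieltjes \<psi>) ({-1<..<0} \<union> {0..<x})"
    using assms by (intro emeasure_mono) (auto simp: sets_stieltjes)
  also have "\<dots> \<le> emeasure (stieltjes \<psi>) {-1<..<0} + emeasure (stieltjes \<psi>) {0..<x}"
    by (intro emeasure_subadditive) (auto simp: sets_stieltjes)
  finally have "ennreal (\<psi> (x / 2)) \<le> emeasure (stieltjes \<psi>) {0..<x}" by (simp add: stieltjes_negative)
  moreover have "\<psi> x \<le> 2 * \<psi> (x / 2)" using concave_scale[OF concave zero, of "x / 2" x] assms by simp
  then have "ennreal (\<psi> x) \<le> ennreal 2 * ennreal (\<psi> (x / 2))"
    using psi_nonneg[of "x / 2"] assms by (subst ennreal_mult[symmetric]) (auto intro: ennreal_leI)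
  ultimately show "ennreal (\<psi> x) \<le> ennreal 2 * emeasure (stieltjes \<psi>) {0..<x}"
    by (meson mult_left_mono order_trans zero_le)
qed

end

lemma Lorentz_profile:
  assumes \<psi>: "mono_on {0..} \<psi>" "concave_on {0..} \<psi>" "\<psi> 0 = 0"
  obtains \<Phi> where "has_profile R (Lorentz R \<psi>) \<Phi>" "equiv_on {0<..} (\<lambda>x. ennreal (\<psi> x)) (\<lambda>x. \<Phi> (ennreal x))"
proof -
  let ?\<Phi> = "\<lambda>m. \<integral>\<^sup>+ t. indicator {t. ennreal t < m} t * indicator {0..} t \<partial>stieltjes \<psi>"
  have "has_profile R (Lorentz R \<psi>) ?\<Phi>"
  proof (rule has_profile_weight)
    show "sigma_finite_measure (stieltjes \<psi>)" by (rule sigma_finite_stieltjes[OF \<psi>])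
    show "(indicator {0..} :: real \<Rightarrow> ennreal) \<in> borel_measurable (stieltjes \<psi>)"
      by (intro borel_measurable_indicator) (simp add: sets_stieltjes[OF \<psi>])
    show "g \<in> borel_measurable (stieltjes \<psi>)" if "g \<in> borel_measurable borel" for g :: "real \<Rightarrow> ennreal"
      using that by (subst measurable_cong_sets[OF sets_stieltjes[OF \<psi>] refl])
    show "Lorentz R \<psi> f = (\<integral>\<^sup>+ t. rearr R f t * indicator {0..} t \<partial>stieltjes \<psi>)" for f
      by (simp add: Lorentz_def)
  qed auto
  moreover have "?\<Phi> (ennreal x) = emeasure (stieltjes \<psi>) {0..<x}" if "0 < x" for x
  proof -
    have "?\<Phi> (ennreal x) = (\<integral>\<^sup>+ t. indicator {0..<x} t \<partial>stieltjes \<psi>)"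
      using that by (intro nn_integral_cong) (auto simp: ennreal_less_iff split: split_indicator)
    then show ?thesis by (simp add: sets_stieltjes[OF \<psi>])
  qed
  then have "equiv_on {0<..} (\<lambda>x. ennreal (\<psi> x)) (\<lambda>x. ?\<Phi> (ennreal x))"
    using stieltjes_Ico_bounds[OF \<psi>] by (intro equiv_onI[of 1 2]) auto
  ultimately show thesis by (rule that)
qed

text \<open>Independence of the choice of \<open>\<psi>\<close> enters here: every admissible
  \<open>\<psi>\<close> is equivalent to \<open>\<phi>\<close>, hence so is the profile of its
  Lorentz functional. Identifying the endpoint space reduces to computing one profile.\<close>

lemma same_space_Lorentz:
  assumes "concave_choice \<phi> \<psi>" and N: "has_profile R N \<Phi>"
    and eq: "equiv_on {0<..} (\<lambda>x. \<phi> (ennreal x)) (\<lambda>x. \<Phi> (ennreal x))"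
  shows "same_space R (Lorentz R \<psi>) N"
proof -
  have \<psi>: "mono_on {0..} \<psi>" "concave_on {0..} \<psi>" "\<psi> 0 = 0"
    and \<phi>: "equiv_on {0..} (\<lambda>t. \<phi> (ennreal t)) (\<lambda>t. ennreal (\<psi> t))"
    using assms(1) by (auto simp: concave_choice_def)
  obtain \<Phi>' where \<Phi>': "has_profile R (Lorentz R \<psi>) \<Phi>'"
    "equiv_on {0<..} (\<lambda>x. ennreal (\<psi> x)) (\<lambda>x. \<Phi>' (ennreal x))"
    by (rule Lorentz_profile[OF \<psi>])
  have "equiv_on {0<..} (\<lambda>t. \<phi> (ennreal t)) (\<lambda>t. ennreal (\<psi> t))"
    by (rule equiv_on_subset[OF \<phi>]) auto
  from equiv_on_trans[OF equiv_on_sym[OF equiv_on_trans[OF this \<Phi>'(2)]] eq]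
  show ?thesis by (rule same_space_profile[OF \<Phi>'(1) N])
qed

text \<open>Concave choices for equivalent functions are equivalent to each other. This transfers
  the endpoint spaces to the functional built on \<open>max_rearr\<close>.\<close>

lemma same_space_endpoint:
  assumes \<psi>: "concave_choice \<phi> \<psi>" and \<psi>': "concave_choice \<phi>' \<psi>'" and eq: "equiv_on UNIV \<phi>' \<phi>"
  shows "same_space R (Marcinkiewicz R \<psi>') (Marcinkiewicz R \<psi>)"
    and "same_space R (Lorentz R \<psi>') (Lorentz R \<psi>)"
proof -
  obtain C where C: "0 < C" "\<And>m. m \<in> UNIV \<Longrightarrow> \<phi> m \<le> ennreal C * \<phi>' m"
    "\<And>m. m \<in> UNIV \<Longrightarrow> \<phi>' m \<le> ennreal C * \<phi> m"
    by (rule equiv_onE[OF eq]) (rule that)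
  have "equiv_on {0..} (\<lambda>t. \<phi>' (ennreal t)) (\<lambda>t. \<phi> (ennreal t))"
    by (rule equiv_onI[OF C(1) C(1)]) (rule C(2) C(3), simp)+
  moreover have "equiv_on {0..} (\<lambda>t. \<phi> (ennreal t)) (\<lambda>t. ennreal (\<psi> t))"
    using \<psi> by (simp add: concave_choice_def)
  ultimately have eq': "equiv_on {0..} (\<lambda>t. \<phi>' (ennreal t)) (\<lambda>t. ennreal (\<psi> t))" by (rule equiv_on_trans)
  have "equiv_on {0..} (\<lambda>t. ennreal (\<psi>' t)) (\<lambda>t. \<phi>' (ennreal t))"
    using \<psi>' by (rule_tac equiv_on_sym) (simp add: concave_choice_def)
  then have "equiv_on {0..} (\<lambda>t. ennreal (\<psi>' t)) (\<lambda>t. ennreal (\<psi> t))" using eq' by (rule equiv_on_trans)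
  then show "same_space R (Marcinkiewicz R \<psi>') (Marcinkiewicz R \<psi>)" by (rule same_space_Marcinkiewicz)
  have "mono_on {0..} \<psi>" "concave_on {0..} \<psi>" "\<psi> 0 = 0"
    using \<psi> by (auto simp: concave_choice_def)
  then obtain \<Phi> where \<Phi>: "has_profile R (Lorentz R \<psi>) \<Phi>"
    "equiv_on {0<..} (\<lambda>x. ennreal (\<psi> x)) (\<lambda>x. \<Phi> (ennreal x))"
    by (rule Lorentz_profile)
  have "equiv_on {0<..} (\<lambda>t. \<phi>' (ennreal t)) (\<lambda>t. ennreal (\<psi> t))"
    by (rule equiv_on_subset[OF eq']) auto
  then have "equiv_on {0<..} (\<lambda>x. \<phi>' (ennreal x)) (\<lambda>x. \<Phi> (ennreal x))"
    using \<Phi>(2) by (rule equiv_on_trans)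
  then show "same_space R (Lorentz R \<psi>') (Lorentz R \<psi>)" by (rule same_space_Lorentz[OF \<psi>' \<Phi>(1)])
qed

section \<open>Rearrangements of indicator functions\<close>

lemma rearr_chi:
  assumes "E \<in> sets R"
  shows "rearr R (chi E) t = (if ennreal t < emeasure R E then 1 else 0)"
proof -
  have lev: "emeasure R {x \<in> space R. ennreal s < ecmod (chi E x)} = (if s < 1 then emeasure R E else 0)" if "0 \<le> s" for s
  proof -
    have "{x \<in> space R. ennreal s < ecmod (chi E x)} = (if s < 1 then E else {})"
      using sets.sets_into_space[OF assms] that ennreal_less_iff[of s 1] by (auto simp: chi_def)
    then show ?thesis by simp
  qed
  show ?thesis
  proof (cases "ennreal t < emeasure R E")
    case True
    have "rearr R (chi E) t = 1"
    proof (rule antisym)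
      show "rearr R (chi E) t \<le> 1"
        unfolding rearr_def by (rule Inf_lower) (use lev[of 1] in \<open>auto intro!: exI[of _ 1]\<close>)
      show "1 \<le> rearr R (chi E) t"
        unfolding rearr_def
      proof (rule Inf_greatest, clarify)
        fix s assume "0 \<le> s" "emeasure R {x \<in> space R. ennreal s < ecmod (chi E x)} \<le> ennreal t"
        then have "1 \<le> s" using lev[of s] True by (auto simp: not_le[symmetric] split: if_splits)
        then show "1 \<le> ennreal s" by (simp add: ennreal_ge_1)
      qed
    qed
    then show ?thesis using True by simp
  next
    case False
    have "rearr R (chi E) t \<le> 0"
      unfolding rearr_def by (rule Inf_lower) (use lev[of 0] False in \<open>auto intro!: exI[of _ 0]\<close>)
    then show ?thesis using False by simp
  qed
qed

lemma rearr_le_max_rearr: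
  assumes "0 < t"
  shows "rearr R f t \<le> max_rearr R f t"
proof -
  have "rearr R f t * ennreal t = (\<integral>\<^sup>+ s\<in>{0<..<t}. rearr R f t \<partial>lebesgue)"
    using assms by (subst nn_integral_cmult_indicator) auto
  also have "\<dots> \<le> (\<integral>\<^sup>+ s\<in>{0<..<t}. rearr R f s \<partial>lebesgue)"
    by (intro nn_integral_mono) (auto intro: antimonoD[OF rearr_antimono] split: split_indicator)
  finally have "(rearr R f t * ennreal t) / ennreal t \<le> max_rearr R f t"
    unfolding max_rearr_def by (rule divide_right_mono_ennreal)
  then show ?thesis using assms by (simp add: mult_divide_eq_ennreal)
qed

text \<open>For measure \<open>t\<close> the exact value is the minimum of 1 and t/s. The two upper
  bounds are used on either side of \<open>t\<close>; for infinite measure both functions are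
  constantly 1.\<close>

lemma max_rearr_chi:
  assumes E: "E \<in> sets R" and "0 < s"
  shows "max_rearr R (chi E) s \<le> 1"
    and "emeasure R E = ennreal t \<Longrightarrow> 0 \<le> t \<Longrightarrow> max_rearr R (chi E) s \<le> ennreal (t / s)"
    and "emeasure R E = \<infinity> \<Longrightarrow> max_rearr R (chi E) s = rearr R (chi E) s"
proof -
  let ?I = "\<integral>\<^sup>+ u\<in>{0<..<s}. rearr R (chi E) u \<partial>lebesgue"
  have "?I \<le> (\<integral>\<^sup>+ u. indicator {0<..<s} u \<partial>lebesgue)"
    by (intro nn_integral_mono) (auto simp: rearr_chi[OF E] split: split_indicator)
  then have "?I \<le> ennreal s" using \<open>0 < s\<close> by simp
  then have "?I / ennreal s \<le> ennreal s / ennreal s" by (rule divide_right_mono_ennreal)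
  then show 1: "max_rearr R (chi E) s \<le> 1"
    using \<open>0 < s\<close> by (simp add: max_rearr_def divide_ennreal ennreal_eq_0_iff)
  show "max_rearr R (chi E) s \<le> ennreal (t / s)" if "emeasure R E = ennreal t" "0 \<le> t"
  proof -
    have "?I \<le> (\<integral>\<^sup>+ u. indicator {0<..<t} u \<partial>lebesgue)"
      using that by (intro nn_integral_mono) (auto simp: rearr_chi[OF E] ennreal_less_iff split: split_indicator)
    then have "?I \<le> ennreal t" using that by simp
    then have "?I / ennreal s \<le> ennreal t / ennreal s" by (rule divide_right_mono_ennreal)
    then show ?thesis using \<open>0 < s\<close> that by (simp add: max_rearr_def divide_ennreal)
  qed
  show "max_rearr R (chi E) s = rearr R (chi E) s" if "emeasure R E = \<infinity>"
    using 1 rearr_le_max_rearr[OF \<open>0 < s\<close>, of R "chi E"] that by (simp add: rearr_chi[OF E])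
qed

section \<open>Fundamental functions\<close>

lemma endpoint_Marcinkiewicz:
  assumes \<phi>: "\<And>t. 0 \<le> t \<Longrightarrow> \<phi> (ennreal t) = ennreal (P t)"
    and mono: "mono_on {0..} P" and P0: "P 0 = 0" and pos: "\<And>t. 0 < t \<Longrightarrow> 0 < P t" and D: "1 \<le> D"
    and growth: "\<And>t s. 0 < t \<Longrightarrow> t \<le> s \<Longrightarrow> P s \<le> D * (s / t) * P t"
  shows "equiv_quasi_concave \<phi> \<and> (\<exists>\<psi>. concave_choice \<phi> \<psi>) \<and>
      (\<forall>\<psi>. concave_choice \<phi> \<psi> \<longrightarrow>
        same_space R (Marcinkiewicz R \<psi>) (LK_max R \<infinity> \<infinity> (\<lambda>t. \<phi> (ennreal t))))"
proof -
  have "\<phi> (ennreal t) = ennreal (P (max 0 t))" for t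
    using \<phi>[of "max 0 t"] by (cases "0 \<le> t") (auto simp: ennreal_neg max_def)
  then have "mono (\<lambda>t. \<phi> (ennreal t))"
    by (auto simp: mono_def intro!: ennreal_leI mono_onD[OF mono])
  then show ?thesis
    using quasi_concave_and_concave_choice[OF \<phi> mono P0 pos D growth] same_space_Marcinkiewicz_LK_max by blast
qed

lemma Lq_norm_finite_exponent:
  assumes "0 < q" "q < \<infinity>"
  shows "Lq_norm q g = epowr (\<integral>\<^sup>+ t\<in>{0<..}. epowr (g t) (enn2real q) \<partial>lebesgue) (1 / enn2real q)"
    and "enn2real (1 / q) = 1 / enn2real q"
proof -
  show "Lq_norm q g = epowr (\<integral>\<^sup>+ t\<in>{0<..}. epowr (g t) (enn2real q) \<partial>lebesgue) (1 / enn2real q)"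
    using assms by (auto simp: Lq_norm_def)
  obtain r where "q = ennreal r" "0 < r" using assms by (cases q) auto
  then show "enn2real (1 / q) = 1 / enn2real q"
    using divide_ennreal[of 1 r] by simp
qed

lemma LK_le_LK_max:
  assumes "0 < q" and w: "w \<in> borel_measurable (lebesgue_on {0<..})"
  shows "LK R p q w f \<le> LK_max R p q w f"
  unfolding LK_def LK_max_def
proof (rule Lq_norm_mono)
  have "(\<lambda>t. ennreal (t powr (enn2real (1 / p) - enn2real (1 / q)))) \<in> borel_measurable (lebesgue_on {0<..})"
    "rearr R f \<in> borel_measurable (lebesgue_on {0<..})"
    by (intro measurable_restrict_space1 measurable_completion; use rearr_measurable in simp)+
  then show "(\<lambda>t. ennreal (t powr (enn2real (1 / p) - enn2real (1 / q))) * w t * rearr R f t)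
      \<in> borel_measurable (lebesgue_on {0<..})"
    using w by (intro borel_measurable_times_ennreal)
qed (use assms in \<open>auto intro!: mult_left_mono rearr_le_max_rearr\<close>)

lemma LK_max_chi_top:
  assumes "E \<in> sets R" "emeasure R E = \<infinity>"
  shows "LK_max R p q w (chi E) = LK R p q w (chi E)"
  unfolding LK_def LK_max_def using assms by (intro Lq_norm_cong) (simp add: max_rearr_chi)

text \<open>The factor t^(-1/r) turns Lebesgue measure into dt/t. The general \<open>h\<close>
  serves for both rearrangements and for the indicator of (0,1) in the integrability
  hypothesis.\<close>

lemma (in slow_growth) nn_integral_Lq_weight:
  assumes r: "0 < r"
  shows "(\<integral>\<^sup>+ t\<in>{0<..}. epowr (ennreal (t powr (- (1 / r))) * ennreal (b t) * h t) r \<partial>lebesgue) =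
    (\<integral>\<^sup>+ t\<in>{0<..}. ennreal (b t powr r / t) * epowr (h t) r \<partial>lebesgue)"
proof (intro nn_integral_cong)
  fix t
  have "epowr (ennreal (t powr (- (1 / r))) * ennreal (b t) * h t) r = ennreal (b t powr r / t) * epowr (h t) r" if "0 < t"
  proof -
    have "ennreal (t powr (- (1 / r))) * ennreal (b t) = ennreal (t powr (- (1 / r)) * b t)"
      using pos[OF that] by (simp add: ennreal_mult)
    moreover have "(t powr (- (1 / r)) * b t) powr r = b t powr r / t"
      using pos[OF that] that r by (simp add: powr_mult powr_divide powr_powr powr_minus_divide)
    ultimately show ?thesis
      using pos[OF that] that r by (simp add: epowr_cmult)
  qed
  then show "epowr (ennreal (t powr (- (1 / r))) * ennreal (b t) * h t) r * indicator {0<..} t =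
      ennreal (b t powr r / t) * epowr (h t) r * indicator {0<..} t"
    by (auto split: split_indicator)
qed

context slow_growth_power
begin

context
  fixes R :: "'a measure" and q :: ennreal
  assumes q: "q = ennreal r"
begin

lemma LK_power: "LK R \<infinity> q (\<lambda>t. ennreal (b t)) f =
    epowr (\<integral>\<^sup>+ t\<in>{0<..}. w t * epowr (rearr R f t) r \<partial>lebesgue) (1 / r)"
  and LK_max_power: "LK_max R \<infinity> q (\<lambda>t. ennreal (b t)) f =
    epowr (\<integral>\<^sup>+ t\<in>{0<..}. w t * epowr (max_rearr R f t) r \<partial>lebesgue) (1 / r)"
proof -
  have "0 < q" "q < \<infinity>" "enn2real q = r" using r by (auto simp: q)
  note * = Lq_norm_finite_exponent[OF this(1,2), unfolded this(3)]
  show "LK R \<infinity> q (\<lambda>t. ennreal (b t)) f =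
      epowr (\<integral>\<^sup>+ t\<in>{0<..}. w t * epowr (rearr R f t) r \<partial>lebesgue) (1 / r)"
    "LK_max R \<infinity> q (\<lambda>t. ennreal (b t)) f =
      epowr (\<integral>\<^sup>+ t\<in>{0<..}. w t * epowr (max_rearr R f t) r \<partial>lebesgue) (1 / r)"
    by (simp_all add: LK_def LK_max_def * nn_integral_Lq_weight[OF r] w_def)
qed

lemma LK_chi:
  assumes E: "E \<in> sets R"
  shows "emeasure R E = ennreal t \<Longrightarrow> 0 \<le> t \<Longrightarrow> LK R \<infinity> q (\<lambda>t. ennreal (b t)) (chi E) = epowr (B t) (1 / r)"
    and "emeasure R E = \<infinity> \<Longrightarrow> LK R \<infinity> q (\<lambda>t. ennreal (b t)) (chi E) = epowr (\<integral>\<^sup>+ s\<in>{0<..}. w s \<partial>lebesgue) (1 / r)"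
proof -
  have one: "epowr 1 r = 1" using epowr_ennreal[of 1 r] r by simp
  show "LK R \<infinity> q (\<lambda>t. ennreal (b t)) (chi E) = epowr (B t) (1 / r)"
    if "emeasure R E = ennreal t" "0 \<le> t"
  proof -
    have "(\<integral>\<^sup>+ s\<in>{0<..}. w s * epowr (rearr R (chi E) s) r \<partial>lebesgue) = B t"
      unfolding B_def using that r
      by (intro nn_integral_cong) (auto simp: rearr_chi[OF E] one ennreal_less_iff split: split_indicator)
    then show ?thesis by (simp only: LK_power)
  qed
  show "LK R \<infinity> q (\<lambda>t. ennreal (b t)) (chi E) = epowr (\<integral>\<^sup>+ s\<in>{0<..}. w s \<partial>lebesgue) (1 / r)"
    if "emeasure R E = \<infinity>"
    unfolding LK_power using that by (simp add: rearr_chi[OF E] one)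
qed

text \<open>Bounding the average by 1 before \<open>t\<close> and by t/s after it splits the
  integral into B(t) and the tail controlled by \<open>tail_le_B\<close>; the constant is the r-th
  root of the resulting factor.\<close>

lemma LK_max_chi_le:
  assumes E: "E \<in> sets R" "emeasure R E = ennreal t" and "0 < t"
  shows "LK_max R \<infinity> q (\<lambda>t. ennreal (b t)) (chi E) \<le>
    ennreal ((1 + K powr r * (2 / r) * (2 * (2 * K) powr r)) powr (1 / r)) * epowr (B t) (1 / r)"
proof -
  let ?C = "K powr r * (2 / r) * (2 * (2 * K) powr r)"
  have C: "0 \<le> ?C" using K r by simp
  have meas1: "(\<lambda>s. w s * indicator {0<..<t} s) \<in> borel_measurable lebesgue"
    by (intro w_meas_restrict) auto
  have "(\<lambda>u. ennreal ((t / u) powr r)) \<in> borel_measurable lebesgue"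
    by (intro measurable_completion) simp
  then have "(\<lambda>u. ennreal ((t / u) powr r) * (w u * indicator {t..} u)) \<in> borel_measurable lebesgue"
    using \<open>0 < t\<close> by (intro borel_measurable_times_ennreal w_meas_restrict) auto
  then have meas2: "(\<lambda>u. ennreal ((t / u) powr r) * w u * indicator {t..} u) \<in> borel_measurable lebesgue"
    by (simp add: mult.assoc)
  have "(\<integral>\<^sup>+ s\<in>{0<..}. w s * epowr (max_rearr R (chi E) s) r \<partial>lebesgue) \<le>
      (\<integral>\<^sup>+ s. w s * indicator {0<..<t} s + ennreal ((t / s) powr r) * w s * indicator {t..} s \<partial>lebesgue)"
  proof (intro nn_integral_mono)
    fix s
    show "w s * epowr (max_rearr R (chi E) s) r * indicator {0<..} s \<le>
        w s * indicator {0<..<t} s + ennreal ((t / s) powr r) * w s * indicator {t..} s"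
    proof (cases "0 < s")
      case True
      have "epowr (max_rearr R (chi E) s) r \<le> epowr (ennreal 1) r"
        using max_rearr_chi(1)[OF E(1) True] r by (intro epowr_mono) auto
      then have 1: "epowr (max_rearr R (chi E) s) r \<le> 1" using r by (simp only: epowr_ennreal) simp
      have "epowr (max_rearr R (chi E) s) r \<le> epowr (ennreal (t / s)) r"
        using max_rearr_chi(2)[OF E(1) True E(2)] \<open>0 < t\<close> r by (intro epowr_mono) auto
      then have 2: "epowr (max_rearr R (chi E) s) r \<le> ennreal ((t / s) powr r)"
        using r \<open>0 < t\<close> True by (simp add: epowr_ennreal)
      show ?thesis
        using True mult_left_mono[OF 1, of "w s"] mult_left_mono[OF 2, of "w s"]
        by (auto simp: mult.commute split: split_indicator)
    qed auto
  qed
  also have "\<dots> = B t + (\<integral>\<^sup>+ s\<in>{t..}. ennreal ((t / s) powr r) * w s \<partial>lebesgue)"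
    unfolding B_def by (rule nn_integral_add[OF meas1 meas2])
  also have "\<dots> \<le> B t + ennreal ?C * B t"
    by (intro add_left_mono tail_le_B \<open>0 < t\<close>)
  also have "\<dots> = ennreal (1 + ?C) * B t"
    using C by (simp only: ennreal_plus[OF zero_le_one C] distrib_right) simp
  finally have "LK_max R \<infinity> q (\<lambda>t. ennreal (b t)) (chi E) \<le> epowr (ennreal (1 + ?C) * B t) (1 / r)"
    unfolding LK_max_power using r by (intro epowr_mono) auto
  also have "\<dots> = ennreal ((1 + ?C) powr (1 / r)) * epowr (B t) (1 / r)"
  proof (rule epowr_cmult)
    show "0 < 1 + ?C" using C by linarith
  qed (use r in simp)
  finally show ?thesis .
qed

text \<open>With outer exponent 1 the weight is a(t)/t, and 1/t combines with b(t)^r into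
  \<open>w\<close>. On (0,\<infinity>) the function \<open>B\<close> is finite and positive, so the
  extended power may be replaced by a real one, which settles measurability.\<close>

lemma has_profile_LK_density:
  obtains \<Phi> where "has_profile R (LK R \<infinity> 1 (\<lambda>t. epowr (B t) (1 / r - 1) * ennreal (b t powr r))) \<Phi>"
    "\<And>x. 0 < x \<Longrightarrow> \<Phi> (ennreal x) = ennreal (r * P x)"
proof -
  let ?v = "\<lambda>t. epowr (B t) (1 / r - 1) * (w t * indicator {0<..} t)"
  let ?\<Phi> = "\<lambda>m. \<integral>\<^sup>+ t. indicator {t. ennreal t < m} t * ?v t \<partial>lebesgue"
  have "has_profile R (LK R \<infinity> 1 (\<lambda>t. epowr (B t) (1 / r - 1) * ennreal (b t powr r))) ?\<Phi>"
  proof (rule has_profile_weight[OF sigma_finite_lebesgue])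
    have "B \<in> borel_measurable borel" by (rule mono_ennreal_measurable) (auto simp: mono_def B_mono)
    then have [measurable]: "(\<lambda>t. enn2real (B t)) \<in> borel_measurable borel" by simp
    have "(\<lambda>t. ennreal (enn2real (B t) powr (1 / r - 1))) \<in> borel_measurable lebesgue"
      by (intro measurable_completion) simp
    then have "(\<lambda>t. ennreal (enn2real (B t) powr (1 / r - 1)) * (w t * indicator {0<..} t)) \<in> borel_measurable lebesgue"
      using w_meas by (rule borel_measurable_times_ennreal)
    moreover have "?v t = ennreal (enn2real (B t) powr (1 / r - 1)) * (w t * indicator {0<..} t)" for t
      using epowr_ennreal_pos[OF B_pos[of t]] by (auto simp: B_eq[symmetric] split: split_indicator)
    ultimately show "?v \<in> borel_measurable lebesgue" by simp
    show "g \<in> borel_measurable lebesgue" if "g \<in> borel_measurable borel" for g :: "real \<Rightarrow> ennreal"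
      using that by (intro measurable_completion) simp
    fix f
    show "LK R \<infinity> 1 (\<lambda>t. epowr (B t) (1 / r - 1) * ennreal (b t powr r)) f = (\<integral>\<^sup>+ t. rearr R f t * ?v t \<partial>lebesgue)"
    proof -
      have "LK R \<infinity> 1 (\<lambda>t. epowr (B t) (1 / r - 1) * ennreal (b t powr r)) f =
          (\<integral>\<^sup>+ t\<in>{0<..}. ennreal (t powr - 1) * (epowr (B t) (1 / r - 1) * ennreal (b t powr r)) * rearr R f t \<partial>lebesgue)"
        by (simp add: LK_def Lq_norm_def)
      also have "\<dots> = (\<integral>\<^sup>+ t. rearr R f t * ?v t \<partial>lebesgue)"
      proof (intro nn_integral_cong)
        fix t
        have "w t = ennreal (t powr - 1) * ennreal (b t powr r)" if "0 < t"
          unfolding w_def using that by (subst ennreal_mult[symmetric]) (auto simp: powr_minus_divide)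
        then show "ennreal (t powr - 1) * (epowr (B t) (1 / r - 1) * ennreal (b t powr r)) * rearr R f t * indicator {0<..} t =
            rearr R f t * ?v t"
          by (auto simp: mult_ac split: split_indicator)
      qed
      finally show ?thesis .
    qed
  qed auto
  moreover have "?\<Phi> (ennreal x) = ennreal (r * P x)" if "0 < x" for x
  proof -
    have "?\<Phi> (ennreal x) = (\<integral>\<^sup>+ u\<in>{0<..<x}. epowr (B u) (1 / r - 1) * w u \<partial>lebesgue)"
      by (intro nn_integral_cong) (auto simp: ennreal_less_iff split: split_indicator)
    then show ?thesis using nn_integral_density_P[OF that] by simp
  qed
  ultimately show thesis by (rule that)
qed

end

end

section \<open>The exponent \<infinity> and absolutely continuous weights\<close>

lemma locally_abs_cont_isCont:
  assumes "locally_abs_cont b" "0 < x"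
  shows "isCont b x"
  unfolding continuous_at_eps_delta
proof (intro allI impI)
  fix e :: real assume "0 < e"
  have "abs_cont_on_interval (x / 2) (2 * x) b"
    using assms by (simp add: locally_abs_cont_def)
  then obtain \<delta> where "0 < \<delta>" and \<delta>: "\<forall>D. finite D \<and> (\<forall>(u, v)\<in>D. x / 2 \<le> u \<and> u < v \<and> v \<le> 2 * x) \<and>
      pairwise (\<lambda>(u, v) (u', v'). {u<..<v} \<inter> {u'<..<v'} = {}) D \<and>
      (\<Sum>(u, v)\<in>D. v - u) < \<delta> \<longrightarrow> (\<Sum>(u, v)\<in>D. \<bar>b v - b u\<bar>) < e"
    using \<open>0 < e\<close> unfolding abs_cont_on_interval_def by meson
  show "\<exists>d>0. \<forall>y. dist y x < d \<longrightarrow> dist (b y) (b x) < e"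
  proof (intro exI[of _ "min \<delta> (x / 2)"] conjI allI impI)
    fix y assume y: "dist y x < min \<delta> (x / 2)"
    show "dist (b y) (b x) < e"
    proof (cases "y = x")
      case False
      have "\<bar>b (max x y) - b (min x y)\<bar> < e"
        using spec[OF \<delta>, of "{(min x y, max x y)}"] y False
        by (auto simp: dist_real_def min_def max_def split: if_splits)
      then show ?thesis by (auto simp: dist_real_def min_def max_def abs_minus_commute split: if_splits)
    qed (use \<open>0 < e\<close> in simp)
  qed (use \<open>0 < \<delta>\<close> assms in auto)
qed

text \<open>Extending \<open>b\<close> to the left by its limit \<open>l\<close> gives a continuous
  monotone function on the whole line, so no mass is lost at 0 and integrals from 0 equal b - l.
  Where \<open>b\<close> is not differentiable, \<open>deriv\<close> is an unspecified value;
  integration therefore uses a Borel function \<open>g\<close> that agrees with it almost everywhere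
  on (0,\<infinity>).\<close>

lemma mono_locally_abs_cont_FTC:
  assumes ac: "locally_abs_cont b" and mono: "mono_on {0<..} b"
    and l: "(b \<longlongrightarrow> l) (at_right 0)"
  obtains g where "g \<in> borel_measurable borel"
    "AE t in lebesgue. 0 < t \<longrightarrow> (b has_real_derivative deriv b t) (at t) \<and> ennreal (deriv b t) = g t"
    "\<And>x. 0 < x \<Longrightarrow> (\<integral>\<^sup>+ t\<in>{0<..<x}. g t \<partial>lebesgue) = ennreal (b x - l)"
    "\<And>x. 0 < x \<Longrightarrow> l \<le> b x"
proof -
  define F where "F t = (if t \<le> 0 then l else b t)" for t
  have le: "l \<le> b x" if "0 < x" for x
  proof (rule tendsto_upperbound[OF l])
    show "eventually (\<lambda>y. b y \<le> b x) (at_right 0)"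
      using eventually_at_right_real[OF that]
      by eventually_elim (rule mono_onD[OF mono], use that in auto)
  qed simp
  have F_mono: "mono F"
  proof (rule monoI)
    fix x y :: real assume "x \<le> y"
    then show "F x \<le> F y" using le[of y] mono_onD[OF mono, of x y] by (auto simp: F_def)
  qed
  have "isCont F x" for x
  proof -
    consider "x < 0" | "x = 0" | "0 < x" by linarith
    then show ?thesis
    proof cases
      case 1
      have "eventually (\<lambda>y. F y = l) (nhds x)"
        by (rule eventually_mono[OF eventually_nhds_in_open[of "{..<0}" x]]) (use 1 in \<open>auto simp: F_def\<close>)
      then have "isCont F x = isCont (\<lambda>_. l) x" by (rule isCont_cong)
      then show ?thesis by simp
    next
      case 2
      have "eventually (\<lambda>y. F y = l) (at_left 0)"
        by (rule eventually_mono[OF eventually_at_left_real[of "-1" 0]]) (auto simp: F_def)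
      then have "(F \<longlongrightarrow> l) (at_left 0)" by (rule tendsto_eventually)
      moreover have "eventually (\<lambda>y. b y = F y) (at_right 0)"
        by (rule eventually_mono[OF eventually_at_right_less]) (auto simp: F_def)
      then have "(F \<longlongrightarrow> l) (at_right 0)" using l by (rule Lim_transform_eventually[rotated])
      ultimately show ?thesis using 2 by (simp add: isCont_def filterlim_at_split F_def)
    next
      case 3
      have "eventually (\<lambda>y. F y = b y) (nhds x)"
        by (rule eventually_mono[OF eventually_nhds_in_open[of "{0<..}" x]]) (use 3 in \<open>auto simp: F_def\<close>)
      then have "isCont F x = isCont b x" by (rule isCont_cong)
      then show ?thesis using locally_abs_cont_isCont[OF ac 3] by simp
    qed
  qed
  then have F_cont: "continuous_on UNIV F" by (simp add: continuous_on_eq_continuous_at)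
  have F_ac: "locally_abs_cont F"
    unfolding locally_abs_cont_def abs_cont_on_interval_def
  proof (intro allI impI)
    fix c d \<epsilon> :: real assume cd: "0 < c \<and> c < d" and "0 < \<epsilon>"
    then have "abs_cont_on_interval c d b" using ac by (simp add: locally_abs_cont_def)
    then obtain \<delta> where "0 < \<delta>" and \<delta>: "\<forall>D. finite D \<and> (\<forall>(u, v)\<in>D. c \<le> u \<and> u < v \<and> v \<le> d) \<and>
      pairwise (\<lambda>(u, v) (u', v'). {u<..<v} \<inter> {u'<..<v'} = {}) D \<and>
      (\<Sum>(u, v)\<in>D. v - u) < \<delta> \<longrightarrow> (\<Sum>(u, v)\<in>D. \<bar>b v - b u\<bar>) < \<epsilon>"
      using \<open>0 < \<epsilon>\<close> unfolding abs_cont_on_interval_def by meson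
    show "\<exists>\<delta>>0. \<forall>D. finite D \<and> (\<forall>(u, v)\<in>D. c \<le> u \<and> u < v \<and> v \<le> d) \<and>
      pairwise (\<lambda>(u, v) (u', v'). {u<..<v} \<inter> {u'<..<v'} = {}) D \<and>
      (\<Sum>(u, v)\<in>D. v - u) < \<delta> \<longrightarrow> (\<Sum>(u, v)\<in>D. \<bar>F v - F u\<bar>) < \<epsilon>"
    proof (intro exI[of _ \<delta>] conjI allI impI \<open>0 < \<delta>\<close>)
      fix D :: "(real \<times> real) set"
      assume D: "finite D \<and> (\<forall>(u, v)\<in>D. c \<le> u \<and> u < v \<and> v \<le> d) \<and>
        pairwise (\<lambda>(u, v) (u', v'). {u<..<v} \<inter> {u'<..<v'} = {}) D \<and> (\<Sum>(u, v)\<in>D. v - u) < \<delta>"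
      have "(\<Sum>(u, v)\<in>D. \<bar>F v - F u\<bar>) = (\<Sum>(u, v)\<in>D. \<bar>b v - b u\<bar>)"
      proof (intro sum.cong refl, clarify)
        fix u v assume "(u, v) \<in> D"
        then have "0 < u" "0 < v" using D cd by force+
        then show "\<bar>F v - F u\<bar> = \<bar>b v - b u\<bar>" by (simp add: F_def)
      qed
      also have "\<dots> < \<epsilon>" using mp[OF spec[OF \<delta>] D] .
      finally show "(\<Sum>(u, v)\<in>D. \<bar>F v - F u\<bar>) < \<epsilon>" .
    qed
  qed
  have F0: "F x = F 0" if "x \<le> 0" for x using that by (simp add: F_def)
  obtain g where g: "g \<in> borel_measurable borel" "density lborel g = interval_measure F"
    "AE x in lebesgue. g x < \<infinity> \<and> (F has_real_derivative enn2real (g x)) (at x)"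
    by (rule abs_cont_mono_FTC[OF F_mono F_cont F_ac], erule F0) (rule that)
  have ae: "AE t in lebesgue. 0 < t \<longrightarrow> (b has_real_derivative deriv b t) (at t) \<and> ennreal (deriv b t) = g t"
    using g(3)
  proof eventually_elim
    case (elim t)
      show ?case
      proof
        assume t: "0 < t"
        have d: "(b has_real_derivative enn2real (g t)) (at t)"
          by (rule has_field_derivative_transform_within_open[OF conjunct2[OF elim], of "{0<..}"])
            (use t in \<open>auto simp: F_def\<close>)
        then have "deriv b t = enn2real (g t)" by (rule DERIV_imp_deriv)
        moreover have "ennreal (enn2real (g t)) = g t" using conjunct1[OF elim] by (simp add: ennreal_enn2real_if less_top)
        ultimately show "(b has_real_derivative deriv b t) (at t) \<and> ennreal (deriv b t) = g t"
          using d by simp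
      qed
  qed
  have int: "(\<integral>\<^sup>+ t\<in>{0<..<x}. g t \<partial>lebesgue) = ennreal (b x - l)" if x: "0 < x" for x
  proof -
    have "AE t in lborel. t \<noteq> 0 \<and> t \<noteq> x"
      using AE_lborel_singleton[of 0] AE_lborel_singleton[of x] by eventually_elim simp
    then have "(\<integral>\<^sup>+ t\<in>{0<..<x}. g t \<partial>lborel) = (\<integral>\<^sup>+ t\<in>{0..x}. g t \<partial>lborel)"
      by (rule_tac nn_integral_cong_AE, eventually_elim) (auto split: split_indicator)
    also have "\<dots> = emeasure (density lborel g) {0..x}"
      using g(1) by (subst emeasure_density) auto
    also have "\<dots> = ennreal (F x - F 0)"
      unfolding g(2) using x by (intro interval_measure_cbox[OF F_mono F_cont]) simp
    finally show ?thesis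
      using x by (simp add: F_def nn_integral_completion)
  qed
  show thesis by (rule that[OF g(1) ae int le])
qed

lemma has_profile_Lambda1_deriv:
  assumes "locally_abs_cont b" "mono_on {0<..} b" "(b \<longlongrightarrow> l) (at_right 0)"
  obtains \<Phi> where "has_profile R (Lambda1 R (\<lambda>t. ennreal (deriv b t))) \<Phi>"
    "\<And>x. 0 < x \<Longrightarrow> \<Phi> (ennreal x) = ennreal (b x - l)"
proof -
  obtain g where g[measurable]: "g \<in> borel_measurable borel"
    and ae: "AE t in lebesgue. 0 < t \<longrightarrow> (b has_real_derivative deriv b t) (at t) \<and> ennreal (deriv b t) = g t"
    and int: "\<And>x. 0 < x \<Longrightarrow> (\<integral>\<^sup>+ t\<in>{0<..<x}. g t \<partial>lebesgue) = ennreal (b x - l)"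
    by (rule mono_locally_abs_cont_FTC[OF assms]) (rule that)
  let ?v = "\<lambda>t. g t * indicator {0<..} t"
  let ?\<Phi> = "\<lambda>m. \<integral>\<^sup>+ t. indicator {t. ennreal t < m} t * ?v t \<partial>lebesgue"
  have "has_profile R (Lambda1 R (\<lambda>t. ennreal (deriv b t))) ?\<Phi>"
  proof (rule has_profile_weight[OF sigma_finite_lebesgue])
    show "?v \<in> borel_measurable lebesgue" by (intro measurable_completion) simp
    show "h \<in> borel_measurable lebesgue" if "h \<in> borel_measurable borel" for h :: "real \<Rightarrow> ennreal"
      using that by (intro measurable_completion) simp
    fix f
    from ae show "Lambda1 R (\<lambda>t. ennreal (deriv b t)) f = (\<integral>\<^sup>+ t. rearr R f t * ?v t \<partial>lebesgue)"
      unfolding Lambda1_def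
      by (rule_tac nn_integral_cong_AE, eventually_elim) (auto split: split_indicator)
  qed auto
  moreover have "?\<Phi> (ennreal x) = ennreal (b x - l)" if "0 < x" for x
  proof -
    have "?\<Phi> (ennreal x) = (\<integral>\<^sup>+ t\<in>{0<..<x}. g t \<partial>lebesgue)"
      by (intro nn_integral_cong) (auto simp: ennreal_less_iff split: split_indicator)
    then show ?thesis using int[OF that] by simp
  qed
  ultimately show thesis by (rule that)
qed

context slow_growth
begin

lemma weight_meas: "(\<lambda>t. ennreal (b t)) \<in> borel_measurable (lebesgue_on {0<..})"
  using meas by (rule measurable_compose) simp

text \<open>Since s/t \<ge> 1, the exponent 1/2 may be raised to 1, which is the shape required for
  the concave majorant.\<close>

lemma growth: "0 < t \<Longrightarrow> t \<le> s \<Longrightarrow> b s \<le> K * (s / t) * b t"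
proof -
  assume ts: "0 < t" "t \<le> s"
  have "(s / t) powr (1/2) \<le> (s / t) powr 1" using ts by (intro powr_mono) auto
  then have "K * (s / t) powr (1/2) * b t \<le> K * (s / t) * b t"
    using ts K pos[OF ts(1)] by (intro mult_right_mono mult_left_mono) auto
  with bound[OF ts] show ?thesis by simp
qed

text \<open>Where the rearrangement of the indicator vanishes, every upper bound holds. Both
  essential suprema are thus infima of the same set of almost everywhere bounds, for finite and
  infinite measure alike.\<close>

lemma LK_chi_essential_sup:
  assumes E: "E \<in> sets R"
  shows "LK R \<infinity> \<infinity> (\<lambda>t. ennreal (b t)) (chi E) =
    esssup (lebesgue_on ({0<..} \<inter> {t. ennreal t < emeasure R E})) (\<lambda>t. ennreal (b t))"
proof -
  let ?S = "{0<..} \<inter> {t. ennreal t < emeasure R E}"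
  let ?f = "\<lambda>t. ennreal (t powr 0) * ennreal (b t) * rearr R (chi E) t"
  have "?S \<in> sets borel" by measurable
  then have S: "?S \<in> sets lebesgue" by simp
  have "(\<lambda>t. ennreal (t powr 0)) \<in> borel_measurable (lebesgue_on {0<..})"
    "rearr R (chi E) \<in> borel_measurable (lebesgue_on {0<..})"
    by (intro measurable_restrict_space1 measurable_completion; use rearr_measurable in simp)+
  then have "?f \<in> borel_measurable (lebesgue_on {0<..})"
    by (intro borel_measurable_times_ennreal weight_meas)
  then have LK: "LK R \<infinity> \<infinity> (\<lambda>t. ennreal (b t)) (chi E) = Inf {z. AE t in lebesgue_on {0<..}. ?f t \<le> z}"
    by (simp add: LK_def Lq_norm_def esssup_eq_AE)
  have eq: "(AE t in lebesgue_on {0<..}. ?f t \<le> z) \<longleftrightarrow> (AE t in lebesgue_on ?S. ennreal (b t) \<le> z)" for z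
  proof -
    have "(AE t in lebesgue_on {0<..}. ?f t \<le> z) \<longleftrightarrow> (AE t in lebesgue. t \<in> {0<..} \<longrightarrow> ?f t \<le> z)"
      by (rule AE_restrict_space_iff) simp
    also have "\<dots> \<longleftrightarrow> (AE t in lebesgue. t \<in> ?S \<longrightarrow> ennreal (b t) \<le> z)"
      by (intro AE_cong) (auto simp: rearr_chi[OF E])
    also have "\<dots> \<longleftrightarrow> (AE t in lebesgue_on ?S. ennreal (b t) \<le> z)"
      by (rule AE_restrict_space_iff[symmetric]) (use S in simp)
    finally show ?thesis .
  qed
  have "Inf {z. AE t in lebesgue_on ?S. ennreal (b t) \<le> z} = esssup (lebesgue_on ?S) (\<lambda>t. ennreal (b t))"
    by (rule esssup_eq_AE[symmetric], rule measurable_restrict_mono[OF weight_meas]) auto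
  then show ?thesis unfolding LK eq .
qed

text \<open>Monotonicity bounds the values on (0,t) by b(t). Conversely, by continuity any smaller
  number is exceeded on a whole interval ending at \<open>t\<close>, which has positive
  length.\<close>

lemma esssup_mono_isCont:
  assumes mono: "mono_on {0<..} b" and cont: "isCont b t" and "0 < t"
  shows "esssup (lebesgue_on {0<..<t}) (\<lambda>s. ennreal (b s)) = ennreal (b t)"
proof (rule antisym)
  have m: "(\<lambda>s. ennreal (b s)) \<in> borel_measurable (lebesgue_on {0<..<t})"
    by (rule measurable_restrict_mono[OF weight_meas]) auto
  show "esssup (lebesgue_on {0<..<t}) (\<lambda>s. ennreal (b s)) \<le> ennreal (b t)"
    using m by (rule esssup_I) (auto intro!: AE_I2 ennreal_leI mono_onD[OF mono])
  show "ennreal (b t) \<le> esssup (lebesgue_on {0<..<t}) (\<lambda>s. ennreal (b s))"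
  proof (rule ccontr)
    let ?z = "esssup (lebesgue_on {0<..<t}) (\<lambda>s. ennreal (b s))"
    assume "\<not> ?thesis"
    then have z: "?z < ennreal (b t)" by simp
    have "((\<lambda>s. ennreal (b s)) \<longlongrightarrow> ennreal (b t)) (at t)"
      using cont by (intro tendsto_ennrealI) (simp add: isCont_def)
    from order_tendstoD(1)[OF this z] obtain d where d: "0 < d"
      "\<And>s. s \<noteq> t \<Longrightarrow> dist s t < d \<Longrightarrow> ?z < ennreal (b s)"
      by (auto simp: eventually_at)
    define c where "c = max 0 (t - d)"
    have c: "0 \<le> c" "c < t" "t - d \<le> c" using \<open>0 < t\<close> \<open>0 < d\<close> by (auto simp: c_def)
    have "AE s in lebesgue_on {0<..<t}. ennreal (b s) \<le> ?z" by (rule esssup_AE)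
    then have "AE s in lebesgue. s \<in> {0<..<t} \<longrightarrow> ennreal (b s) \<le> ?z"
      by (subst (asm) AE_restrict_space_iff) auto
    then have "AE s in lebesgue. s \<notin> {c<..<t}"
    proof eventually_elim
      case (elim s)
      show ?case
      proof
        assume s: "s \<in> {c<..<t}"
        then have "?z < ennreal (b s)" using c by (intro d(2)) (auto simp: dist_real_def)
        with elim s c show False by (auto simp: not_le[symmetric])
      qed
    qed
    then have "emeasure lebesgue {c<..<t} = 0"
      by (subst (asm) AE_iff_measurable[where N = "{c<..<t}"]) auto
    then show False using c by simp
  qed
qed

text \<open>Up to \<open>t\<close> the average is at most 1 and \<open>b\<close> is at most b(t) by
  monotonicity; beyond \<open>t\<close> the average is at most t/s, which exactly offsets the linear
  growth of \<open>b\<close>.\<close>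

lemma LK_max_chi_le_infinity:
  assumes mono: "mono_on {0<..} b" and E: "E \<in> sets R" "emeasure R E = ennreal t" and "0 < t"
  shows "LK_max R \<infinity> \<infinity> (\<lambda>t. ennreal (b t)) (chi E) \<le> ennreal K * ennreal (b t)"
proof -
  let ?f = "\<lambda>s. ennreal (s powr 0) * ennreal (b s) * max_rearr R (chi E) s"
  have "(\<lambda>t. ennreal (t powr 0)) \<in> borel_measurable (lebesgue_on {0<..})"
    "max_rearr R (chi E) \<in> borel_measurable (lebesgue_on {0<..})"
    by (intro measurable_restrict_space1 measurable_completion; use max_rearr_measurable in simp)+
  then have "?f \<in> borel_measurable (lebesgue_on {0<..})"
    by (intro borel_measurable_times_ennreal weight_meas)
  moreover have "?f s \<le> ennreal K * ennreal (b t)" if "0 < s" for s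
  proof (cases "s \<le> t")
    case True
    have "?f s \<le> ennreal (b s) * 1"
      using that mult_left_mono[OF max_rearr_chi(1)[OF E(1) that], of "ennreal (b s)"] by simp
    also have "\<dots> \<le> ennreal (K * b t)"
    proof -
      have "b s \<le> b t" using that True by (intro mono_onD[OF mono]) auto
      also have "b t \<le> K * b t" using K pos[OF \<open>0 < t\<close>] by simp
      finally show ?thesis by (simp add: ennreal_leI)
    qed
    finally show ?thesis using K by (simp add: ennreal_mult')
  next
    case False
    have "?f s \<le> ennreal (b s) * ennreal (t / s)"
      using that mult_left_mono[OF max_rearr_chi(2)[OF E(1) that E(2)], of "ennreal (b s)"] \<open>0 < t\<close> by simp
    also have "\<dots> = ennreal (b s * (t / s))"
      using less_imp_le[OF pos[OF that]] \<open>0 < t\<close> that by (intro ennreal_mult[symmetric]) auto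
    also have "\<dots> \<le> ennreal (K * b t)"
    proof (rule ennreal_leI)
      have "b s * (t / s) \<le> (K * (s / t) * b t) * (t / s)"
        using False \<open>0 < t\<close> that by (intro mult_right_mono growth) auto
      also have "\<dots> = K * b t" using \<open>0 < t\<close> that by simp
      finally show "b s * (t / s) \<le> K * b t" .
    qed
    finally show ?thesis using K by (simp add: ennreal_mult')
  qed
  ultimately show ?thesis
    by (auto simp: LK_max_def Lq_norm_def intro!: esssup_I AE_I2)
qed

end

text \<open>Everything that the finite and the infinite exponent share, given a real version
  \<open>P\<close> of the fundamental function and the estimate \<open>upper\<close> for finite
  positive measure. At infinite measure the two functionals coincide on indicators.\<close>

lemma fundamental_endpoint:
  fixes R :: "'a measure"
  defines "\<phi> \<equiv> \<lambda>q w. fundamental R (LK R \<infinity> q w)" and "\<phi>' \<equiv> \<lambda>q w. fundamental R (LK_max R \<infinity> q w)"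
  assumes ex: "\<And>m. \<exists>E\<in>sets R. emeasure R E = m"
    and q: "0 < q" and w: "w \<in> borel_measurable (lebesgue_on {0<..})"
    and P: "\<And>t. 0 \<le> t \<Longrightarrow> \<phi> q w (ennreal t) = ennreal (P t)"
    and mono: "mono_on {0..} P" and P0: "P 0 = 0" and pos: "\<And>t. 0 < t \<Longrightarrow> 0 < P t" and D: "1 \<le> D"
    and growth: "\<And>t s. 0 < t \<Longrightarrow> t \<le> s \<Longrightarrow> P s \<le> D * (s / t) * P t"
    and upper: "\<And>E t. E \<in> sets R \<Longrightarrow> emeasure R E = ennreal t \<Longrightarrow> 0 < t \<Longrightarrow>
      LK_max R \<infinity> q w (chi E) \<le> ennreal C * LK R \<infinity> q w (chi E)"
  shows "equiv_quasi_concave (\<phi> q w) \<and> (\<exists>\<psi>. concave_choice (\<phi> q w) \<psi>) \<and>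
      (\<forall>\<psi>. concave_choice (\<phi> q w) \<psi> \<longrightarrow>
        same_space R (Marcinkiewicz R \<psi>) (LK_max R \<infinity> \<infinity> (\<lambda>t. \<phi> q w (ennreal t))))"
    and "equiv_on UNIV (\<phi>' q w) (\<phi> q w) \<and>
      (\<forall>\<psi> \<psi>'. concave_choice (\<phi> q w) \<psi> \<and> concave_choice (\<phi>' q w) \<psi>' \<longrightarrow>
        same_space R (Marcinkiewicz R \<psi>') (Marcinkiewicz R \<psi>) \<and>
        same_space R (Lorentz R \<psi>') (Lorentz R \<psi>))"
proof -
  show "equiv_quasi_concave (\<phi> q w) \<and> (\<exists>\<psi>. concave_choice (\<phi> q w) \<psi>) \<and>
      (\<forall>\<psi>. concave_choice (\<phi> q w) \<psi> \<longrightarrow>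
        same_space R (Marcinkiewicz R \<psi>) (LK_max R \<infinity> \<infinity> (\<lambda>t. \<phi> q w (ennreal t))))"
    by (rule endpoint_Marcinkiewicz[OF P mono P0 pos D growth])
  have eq: "equiv_on UNIV (\<phi>' q w) (\<phi> q w)"
  proof (rule equiv_onI[of 1 "max 1 C"])
    fix m
    obtain E where E: "E \<in> sets R" "emeasure R E = m" using ex by blast
    have \<phi>: "\<phi> q w m = LK R \<infinity> q w (chi E)" and \<phi>': "\<phi>' q w m = LK_max R \<infinity> q w (chi E)"
      using fundamental_LK[OF E(1)] fundamental_LK_max[OF E(1)] by (simp_all add: \<phi>_def \<phi>'_def E(2))
    show "\<phi> q w m \<le> ennreal 1 * \<phi>' q w m"
      unfolding \<phi> \<phi>' using LK_le_LK_max[OF q w] by simp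
    have "LK_max R \<infinity> q w (chi E) \<le> ennreal C * LK R \<infinity> q w (chi E) \<or>
        LK_max R \<infinity> q w (chi E) = LK R \<infinity> q w (chi E)"
    proof (cases m)
      case (real t)
      show ?thesis
      \<comment> \<open>For a null set the rearrangement and its averages both vanish, so the two
        functionals agree.\<close>
      proof (cases "t = 0")
        case True
        have "max_rearr R (chi E) s = rearr R (chi E) s" if "0 < s" for s
          using max_rearr_chi(2)[OF E(1) that, of 0] rearr_chi[OF E(1), of s] E(2) real True by simp
        then have "LK_max R \<infinity> q w (chi E) = LK R \<infinity> q w (chi E)"
          unfolding LK_def LK_max_def by (intro Lq_norm_cong) simp
        then show ?thesis ..
      next
        case False
        then show ?thesis using upper[OF E(1)] E(2) real by simp
      qed
    next
      case top
      then show ?thesis using LK_max_chi_top[OF E(1)] E(2) by simp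
    qed
    moreover have "ennreal C * LK R \<infinity> q w (chi E) \<le> ennreal (max 1 C) * LK R \<infinity> q w (chi E)"
      by (intro mult_right_mono ennreal_leI) auto
    moreover have "ennreal 1 * LK R \<infinity> q w (chi E) \<le> ennreal (max 1 C) * LK R \<infinity> q w (chi E)"
      by (intro mult_right_mono ennreal_leI) auto
    ultimately show "\<phi>' q w m \<le> ennreal (max 1 C) * \<phi> q w m"
      unfolding \<phi> \<phi>' by (auto intro: order_trans)
  qed auto
  then show "equiv_on UNIV (\<phi>' q w) (\<phi> q w) \<and>
      (\<forall>\<psi> \<psi>'. concave_choice (\<phi> q w) \<psi> \<and> concave_choice (\<phi>' q w) \<psi>' \<longrightarrow>
        same_space R (Marcinkiewicz R \<psi>') (Marcinkiewicz R \<psi>) \<and>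
        same_space R (Lorentz R \<psi>') (Lorentz R \<psi>))"
    using same_space_endpoint by blast
qed

theorem theorem3p14:
  fixes R :: "'a measure" and q :: ennreal and b :: "real \<Rightarrow> real"
  assumes "sigma_finite_measure R" and "non_atomic R" and "emeasure R (space R) = \<infinity>"
    and "0 < q"
    and "slowly_varying b"
    and "Lq_norm q (\<lambda>t. ennreal (t powr (- enn2real (1 / q))) * ennreal (b t)
           * indicator {0<..<1} t) < \<infinity>"
    and "q = \<infinity> \<Longrightarrow> locally_abs_cont b \<and> mono_on {0<..} b"
  defines "r \<equiv> enn2real q"
    and "\<phi> \<equiv> fundamental R (LK R \<infinity> q (\<lambda>t. ennreal (b t)))"
    and "\<phi>' \<equiv> fundamental R (LK_max R \<infinity> q (\<lambda>t. ennreal (b t)))"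
  shows
    "(\<comment> \<open>(1)\<close>
      (q < \<infinity> \<longrightarrow>
        (\<forall>t>0. \<phi> (ennreal t) =
           epowr (\<integral>\<^sup>+ s\<in>{0<..<t}. ennreal (b s powr r / s) \<partial>lebesgue) (1 / r)) \<and>
        \<phi> \<infinity> = epowr (\<integral>\<^sup>+ s\<in>{0<..}. ennreal (b s powr r / s) \<partial>lebesgue) (1 / r)) \<and>
      (q = \<infinity> \<longrightarrow>
        (\<forall>t>0. \<phi> (ennreal t) = esssup (lebesgue_on {0<..<t}) (\<lambda>s. ennreal (b s))) \<and>
        \<phi> \<infinity> = esssup (lebesgue_on {0<..}) (\<lambda>s. ennreal (b s)))) \<and>
     (\<comment> \<open>(2)\<close>
      equiv_quasi_concave \<phi> \<and> (\<exists>\<psi>. concave_choice \<phi> \<psi>) \<and>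
      (\<forall>\<psi>. concave_choice \<phi> \<psi> \<longrightarrow>
        same_space R (Marcinkiewicz R \<psi>) (LK_max R \<infinity> \<infinity> (\<lambda>t. \<phi> (ennreal t))))) \<and>
     (\<comment> \<open>(3)\<close>
      (q < \<infinity> \<longrightarrow>
        (\<forall>\<psi>. concave_choice \<phi> \<psi> \<longrightarrow>
          same_space R (Lorentz R \<psi>) (LK R \<infinity> 1 (\<lambda>t.
            epowr (\<integral>\<^sup>+ s\<in>{0<..<t}. ennreal (b s powr r / s) \<partial>lebesgue) (1 / r - 1)
              * ennreal (b t powr r))))) \<and>
      (q = \<infinity> \<longrightarrow>
        (AE t in lebesgue_on {0<..}. (b has_real_derivative deriv b t) (at t)) \<and>
        (\<forall>\<psi>. concave_choice \<phi> \<psi> \<longrightarrow>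
          ((b \<longlongrightarrow> 0) (at_right 0) \<longrightarrow>
            same_space R (Lorentz R \<psi>) (Lambda1 R (\<lambda>t. ennreal (deriv b t)))) \<and>
          (\<forall>l>0. (b \<longlongrightarrow> l) (at_right 0) \<longrightarrow>
            same_space R (Lorentz R \<psi>)
              (\<lambda>f. Lambda1 R (\<lambda>t. ennreal (deriv b t)) f + Linf_norm R f))))) \<and>
     (\<comment> \<open>(4)\<close>
      equiv_on UNIV \<phi>' \<phi> \<and>
      (\<forall>\<psi> \<psi>'. concave_choice \<phi> \<psi> \<and> concave_choice \<phi>' \<psi>' \<longrightarrow>
        same_space R (Marcinkiewicz R \<psi>') (Marcinkiewicz R \<psi>) \<and>
        same_space R (Lorentz R \<psi>') (Lorentz R \<psi>)))"
proof -
  obtain K where K: "1 \<le> K" "\<And>t s. 0 < t \<Longrightarrow> t \<le> s \<Longrightarrow> b s \<le> K * (s / t) powr (1 / 2) * b t"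
    by (rule slowly_varying_bound[OF assms(5)]) (rule that)
  interpret slow_growth b K
  proof
    show "b \<in> borel_measurable (lebesgue_on {0<..})" "\<And>t. 0 < t \<Longrightarrow> 0 < b t"
      using assms(5) by (simp_all add: slowly_varying_def)
  qed (rule K, assumption?)+
  have ex: "\<exists>E\<in>sets R. emeasure R E = m" for m
    by (rule non_atomic_emeasure_eq[OF assms(1-3), of m]) blast
  have \<phi>: "\<phi> (emeasure R E) = LK R \<infinity> q (\<lambda>t. ennreal (b t)) (chi E)" if "E \<in> sets R" for E
    unfolding \<phi>_def by (rule fundamental_LK[OF that])
  show ?thesis
  proof (cases "q = \<infinity>")
    case False
    have q: "q = ennreal r" "0 < r" "q < \<infinity>"
      using False assms(4) by (auto simp: r_def enn2real_positive_iff less_top)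
    interpret slow_growth_power b K r
    proof
      \<comment> \<open>Powers leave the indicator unchanged, so the quasinorm in the hypothesis is
        the r-th root of the integral of \<open>w\<close> over (0,1).\<close>
      have ind: "epowr (indicator {0<..<1} t) r = indicator {0<..<1} t" for t :: real
        using q(2) epowr_ennreal[of 1 r] by (auto split: split_indicator)
      have "(\<integral>\<^sup>+ s\<in>{0<..<1}. ennreal (b s powr r / s) \<partial>lebesgue) =
          (\<integral>\<^sup>+ s\<in>{0<..}. ennreal (b s powr r / s) * epowr (indicator {0<..<1} s) r \<partial>lebesgue)"
        unfolding ind by (intro nn_integral_cong) (auto split: split_indicator)
      moreover have "epowr (\<integral>\<^sup>+ s\<in>{0<..}. ennreal (b s powr r / s) * epowr (indicator {0<..<1} s) r \<partial>lebesgue) (1 / r) < \<infinity>"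
        using assms(6) Lq_norm_finite_exponent[OF assms(4) q(3)] nn_integral_Lq_weight[OF q(2), of "indicator {0<..<1}"]
        by (simp add: r_def)
      ultimately show "(\<integral>\<^sup>+ s\<in>{0<..<1}. ennreal (b s powr r / s) \<partial>lebesgue) < \<infinity>"
        using q(2) by (cases "(\<integral>\<^sup>+ s\<in>{0<..<1}. ennreal (b s powr r / s) \<partial>lebesgue) = \<infinity>") (auto simp: less_top)
    qed (rule q)
    have \<phi>B: "\<phi> (ennreal t) = epowr (B t) (1 / r)" if "0 \<le> t" for t
      using ex[of "ennreal t"] \<phi> LK_chi(1)[OF q(1) _ _ that] by metis
    have \<phi>P: "\<phi> (ennreal t) = ennreal (P t)" if "0 \<le> t" for t
      using \<phi>B[OF that] epowr_B by simp
    have \<phi>_top: "\<phi> \<infinity> = epowr (\<integral>\<^sup>+ s\<in>{0<..}. w s \<partial>lebesgue) (1 / r)"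
      using ex[of \<infinity>] \<phi> LK_chi(2)[OF q(1)] by metis
    obtain D where D: "1 \<le> D" "\<And>t s. 0 < t \<Longrightarrow> t \<le> s \<Longrightarrow> P s \<le> D * (s / t) * P t"
      by (rule P_growth) (rule that)
    have P_mono_on: "mono_on {0..} P" using P_mono by (rule mono_on_subset) simp
    have upper: "LK_max R \<infinity> q (\<lambda>t. ennreal (b t)) (chi E) \<le>
        ennreal ((1 + K powr r * (2 / r) * (2 * (2 * K) powr r)) powr (1 / r)) * LK R \<infinity> q (\<lambda>t. ennreal (b t)) (chi E)"
      if "E \<in> sets R" "emeasure R E = ennreal t" "0 < t" for E t
      using LK_max_chi_le[OF q(1) that] LK_chi(1)[OF q(1) that(1,2)] that(3) by simp
    have "same_space R (Lorentz R \<psi>) (LK R \<infinity> 1 (\<lambda>t. epowr (B t) (1 / r - 1) * ennreal (b t powr r)))"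
      if \<psi>: "concave_choice \<phi> \<psi>" for \<psi>
    proof -
      obtain \<Phi> where \<Phi>: "has_profile R (LK R \<infinity> 1 (\<lambda>t. epowr (B t) (1 / r - 1) * ennreal (b t powr r))) \<Phi>"
        "\<And>x. 0 < x \<Longrightarrow> \<Phi> (ennreal x) = ennreal (r * P x)"
        by (rule has_profile_LK_density[OF q(1)]) (rule that)
      have "equiv_on {0<..} (\<lambda>x. \<phi> (ennreal x)) (\<lambda>x. \<Phi> (ennreal x))"
      \<comment> \<open>The profile is exactly \<open>r\<close> times the fundamental function,
        hence these constants.\<close>
      proof (rule equiv_onI[of r "1 / r"])
        fix x :: real assume "x \<in> {0<..}"
        then have x: "0 < x" by simp
        show "\<Phi> (ennreal x) \<le> ennreal r * \<phi> (ennreal x)" "\<phi> (ennreal x) \<le> ennreal (1 / r) * \<Phi> (ennreal x)"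
          using x P_pos[OF x] q(2) by (simp_all add: \<Phi>(2) \<phi>P ennreal_mult[symmetric])
      qed (use q(2) in auto)
      then show ?thesis by (rule same_space_Lorentz[OF \<psi> \<Phi>(1)])
    qed
    moreover note fundamental_endpoint[OF ex assms(4) weight_meas \<phi>P[unfolded \<phi>_def] P_mono_on P_0 P_pos D upper,
        folded \<phi>_def \<phi>'_def]
    ultimately show ?thesis
      using \<phi>B \<phi>_top False q(3) by (simp add: B_def w_def)
  next
    case True
    have ac: "locally_abs_cont b" and mono: "mono_on {0<..} b" using assms(7)[OF True] by auto
    \<comment> \<open>The value of \<open>b\<close> at 0 is arbitrary, whereas the fundamental
      function vanishes there.\<close>
    define P where "P t = (if t \<le> 0 then 0 else b t)" for t
    have cont: "isCont b t" if "0 < t" for t by (rule locally_abs_cont_isCont[OF ac that])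
    have \<phi>_chi: "\<phi> (emeasure R E) = esssup (lebesgue_on ({0<..} \<inter> {t. ennreal t < emeasure R E})) (\<lambda>t. ennreal (b t))"
      if "E \<in> sets R" for E
      using \<phi>[OF that] LK_chi_essential_sup[OF that] True by simp
    have \<phi>_eq: "\<phi> m = esssup (lebesgue_on ({0<..} \<inter> {t. ennreal t < m})) (\<lambda>t. ennreal (b t))" for m
      using ex[of m] \<phi>_chi by blast
    have ivl: "{0<..} \<inter> {s. ennreal s < ennreal t} = {0<..<t}" for t
      by (auto simp: ennreal_less_iff)
    have ivl_top: "{0<..} \<inter> {s. ennreal s < \<infinity>} = {0::real<..}" by auto
    have \<phi>b: "\<phi> (ennreal t) = ennreal (b t)" if "0 < t" for t
      unfolding \<phi>_eq ivl by (rule esssup_mono_isCont[OF mono cont[OF that] that])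
    have \<phi>P: "\<phi> (ennreal t) = ennreal (P t)" if "0 \<le> t" for t
    proof (cases "t = 0")
      case True
      have "esssup (lebesgue_on {0<..}) (\<lambda>t::real. 0 :: ennreal) \<le> 0"
        by (rule esssup_I) auto
      then have "LK R \<infinity> q (\<lambda>t. ennreal (b t)) (chi {}) = 0"
        using \<open>q = \<infinity>\<close> by (simp add: LK_def Lq_norm_def rearr_chi)
      then show ?thesis using \<phi>[of "{}"] True by (simp add: P_def)
    qed (use \<phi>b that in \<open>simp add: P_def\<close>)
    have P_mono: "mono_on {0..} P"
    proof (rule mono_onI)
      fix s t :: real assume "s \<in> {0..}" "t \<in> {0..}" "s \<le> t"
      then show "P s \<le> P t" using mono_onD[OF mono, of s t] pos[of t] by (auto simp: P_def)
    qed
    have P: "P 0 = 0" "\<And>t. 0 < t \<Longrightarrow> 0 < P t" "\<And>t s. 0 < t \<Longrightarrow> t \<le> s \<Longrightarrow> P s \<le> K * (s / t) * P t"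
      using pos growth by (auto simp: P_def)
    have upper: "LK_max R \<infinity> q (\<lambda>t. ennreal (b t)) (chi E) \<le> ennreal K * LK R \<infinity> q (\<lambda>t. ennreal (b t)) (chi E)"
      if E: "E \<in> sets R" "emeasure R E = ennreal t" "0 < t" for E t
      using LK_max_chi_le_infinity[OF mono E] \<phi>[OF E(1)] \<phi>b[OF E(3)] E(2) True by simp
    \<comment> \<open>Monotonicity provides the limit at 0. It is needed because differentiability
      almost everywhere is asserted whatever that limit is.\<close>
    obtain l where l: "(b \<longlongrightarrow> l) (at_right 0)"
    proof -
      have "(b \<longlongrightarrow> Inf (b ` ({0<..} \<inter> UNIV))) (at 0 within ({0<..} \<inter> UNIV))"
      proof (rule Lim_right_bound)
        show "b x \<le> b y" if "0 < x" "x \<le> y" for x y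
          using that by (intro mono_onD[OF mono]) auto
        show "0 \<le> b x" if "0 < x" for x using pos[OF that] by simp
      qed
      then show thesis using that by simp
    qed
    have "AE t in lebesgue. 0 < t \<longrightarrow> (b has_real_derivative deriv b t) (at t)"
    proof -
      obtain g where "AE t in lebesgue. 0 < t \<longrightarrow> (b has_real_derivative deriv b t) (at t) \<and> ennreal (deriv b t) = g t"
        by (rule mono_locally_abs_cont_FTC[OF ac mono l]) (rule that)
      then show ?thesis by eventually_elim simp
    qed
    then have ae: "AE t in lebesgue_on {0<..}. (b has_real_derivative deriv b t) (at t)"
      by (subst AE_restrict_space_iff) auto
    have L0: "same_space R (Lorentz R \<psi>) (Lambda1 R (\<lambda>t. ennreal (deriv b t)))"
      if \<psi>: "concave_choice \<phi> \<psi>" and l: "(b \<longlongrightarrow> 0) (at_right 0)" for \<psi>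
    proof -
      obtain \<Phi> where \<Phi>: "has_profile R (Lambda1 R (\<lambda>t. ennreal (deriv b t))) \<Phi>"
        "\<And>x. 0 < x \<Longrightarrow> \<Phi> (ennreal x) = ennreal (b x - 0)"
        by (rule has_profile_Lambda1_deriv[OF ac mono l]) (rule that)
      have "equiv_on {0<..} (\<lambda>x. \<phi> (ennreal x)) (\<lambda>x. \<Phi> (ennreal x))"
        by (rule equiv_onI[of 1 1]) (auto simp: \<Phi>(2) \<phi>b)
      then show ?thesis by (rule same_space_Lorentz[OF \<psi> \<Phi>(1)])
    qed
    have Ll: "same_space R (Lorentz R \<psi>) (\<lambda>f. Lambda1 R (\<lambda>t. ennreal (deriv b t)) f + Linf_norm R f)"
      if \<psi>: "concave_choice \<phi> \<psi>" and "0 < l" and l: "(b \<longlongrightarrow> l) (at_right 0)" for \<psi> l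
    proof -
      obtain \<Phi> where \<Phi>: "has_profile R (Lambda1 R (\<lambda>t. ennreal (deriv b t))) \<Phi>"
        "\<And>x. 0 < x \<Longrightarrow> \<Phi> (ennreal x) = ennreal (b x - l)"
        by (rule has_profile_Lambda1_deriv[OF ac mono l]) (rule that)
      have le: "l \<le> b x" if "0 < x" for x
        by (rule mono_locally_abs_cont_FTC[OF ac mono l]) (use that in blast)
      have "equiv_on {0<..} (\<lambda>x. \<phi> (ennreal x)) (\<lambda>x. \<Phi> (ennreal x) + indicator {0<..} (ennreal x))"
      \<comment> \<open>Write b for b(x). From b \<ge> l one gets 1 \<le> b/l, hence b - l + 1 \<le>
        (1 + 1/l) b. Conversely (1 + l)(b - l + 1) = b + 1 + l (b - l) \<ge> b.\<close>
      proof (rule equiv_onI[of "1 + 1 / l" "1 + l"])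
        fix x :: real assume "x \<in> {0<..}"
        then have x: "0 < x" by simp
        have sum: "\<Phi> (ennreal x) + indicator {0<..} (ennreal x) = ennreal (b x - l + 1)"
          using x le[OF x] ennreal_plus[of "b x - l" 1] by (simp add: \<Phi>(2) del: ennreal_plus)
        have "1 \<le> b x / l" using le[OF x] \<open>0 < l\<close> by simp
        moreover have "(1 + 1 / l) * b x = b x + b x / l" by (simp add: distrib_right)
        ultimately have "b x - l + 1 \<le> (1 + 1 / l) * b x" using \<open>0 < l\<close> by linarith
        then have "ennreal (b x - l + 1) \<le> ennreal ((1 + 1 / l) * b x)" by (rule ennreal_leI)
        also have "\<dots> = ennreal (1 + 1 / l) * ennreal (b x)"
          using \<open>0 < l\<close> pos[OF x] by (intro ennreal_mult) auto
        finally show "\<Phi> (ennreal x) + indicator {0<..} (ennreal x) \<le> ennreal (1 + 1 / l) * \<phi> (ennreal x)"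
          unfolding sum \<phi>b[OF x] .
        have "0 \<le> l * (b x - l)" using le[OF x] \<open>0 < l\<close> by simp
        then have "b x \<le> (1 + l) * (b x - l + 1)" by (simp add: algebra_simps)
        then have "ennreal (b x) \<le> ennreal ((1 + l) * (b x - l + 1))" by (rule ennreal_leI)
        also have "\<dots> = ennreal (1 + l) * ennreal (b x - l + 1)"
          using \<open>0 < l\<close> le[OF x] by (intro ennreal_mult) auto
        finally show "\<phi> (ennreal x) \<le> ennreal (1 + l) * (\<Phi> (ennreal x) + indicator {0<..} (ennreal x))"
          unfolding sum \<phi>b[OF x] .
      qed (use \<open>0 < l\<close> in \<open>auto intro: add_pos_pos\<close>)
      then show ?thesis by (rule same_space_Lorentz[OF \<psi> has_profile_add[OF \<Phi>(1) has_profile_Linf]])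
    qed
    note fundamental_endpoint[OF ex assms(4) weight_meas \<phi>P[unfolded \<phi>_def] P_mono P(1,2) \<open>1 \<le> K\<close> P(3) upper,
        folded \<phi>_def \<phi>'_def]
    moreover have "\<forall>t>0. \<phi> (ennreal t) = esssup (lebesgue_on {0<..<t}) (\<lambda>s. ennreal (b s))"
      "\<phi> \<infinity> = esssup (lebesgue_on {0<..}) (\<lambda>s. ennreal (b s))"
      unfolding \<phi>_eq ivl ivl_top by simp_all
    ultimately show ?thesis
      using True ae L0 Ll by simp
  qed
qed

end
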